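(* Let $F$ be a Banach space. Then the following statements are equivalent: (a) the pair $(E, F)$ satisfies the WMP for every reflexive Banach space $E$; (b) $F$ has the Schur property.
   Context: Banach spaces are over $\mathbb{K} = \mathbb{R}$ or $\mathbb{C}$. $F$ has the Schur property if every weakly convergent sequence in $F$ is norm convergent. A bounded linear operator $T:E\to F$ attains its norm if there is $x_0$ in the unit sphere $S_E$ with $\|T(x_0)\|=\|T\|$. A maximizing sequence for $T$ is a sequence $(x_n)\subset S_E$ with $\|T(x_n)\|\to\|T\|$. A pair $(E,F)$ of Banach spaces has the weak maximizing property (WMP) if every bounded linear operator $T:E\to F$ that admits a non-weakly null maximizing sequence (i.e. one not converging weakly to $0$) attains its norm. *)

theory Defs
  imports "HOL-Analysis.Analysis" "HOL-Algebra.Module"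
begin

text \<open>
  The vector spaces are carrier-based, so that one formula can quantify over all Banach spaces
  whose elements lie in a given type. The scalar field is a subset \<open>K\<close> of the complex
  numbers, either \<open>\<real>\<close> or \<open>UNIV\<close>. For \<open>K = \<real>\<close> the behaviour of the scalar
  multiplication at non-real numbers is unconstrained and never used.
  The fields \<open>mult\<close> and \<open>one\<close>, inherited from the record of modules,
  play no role for a vector space.
\<close>

record 'a normed_module = "(complex, 'a) module" +
  nrm :: "'a \<Rightarrow> real"

definition scalars :: "complex set \<Rightarrow> complex ring" where
  "scalars K = \<lparr>carrier = K, mult = (*), one = 1, zero = 0, add = (+)\<rparr>"

locale normed_space = module "scalars K" E
  for K :: "complex set" and E :: "'a normed_module" (structure) +
  assumes real_or_complex: "K = \<real> \<or> K = UNIV"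
    and nrm_nonneg: "x \<in> carrier E \<Longrightarrow> 0 \<le> nrm E x"
    and nrm_eq_0: "x \<in> carrier E \<Longrightarrow> nrm E x = 0 \<longleftrightarrow> x = \<zero>"
    and nrm_smult: "a \<in> K \<Longrightarrow> x \<in> carrier E \<Longrightarrow> nrm E (a \<odot> x) = cmod a * nrm E x"
    and nrm_triangle:
      "x \<in> carrier E \<Longrightarrow> y \<in> carrier E \<Longrightarrow> nrm E (x \<oplus> y) \<le> nrm E x + nrm E y"

text \<open>
  The library locale for metric spaces demands nonnegativity and symmetry also off the carrier,
  hence the value \<open>0\<close> there.
\<close>

definition ndist :: "'a normed_module \<Rightarrow> 'a \<Rightarrow> 'a \<Rightarrow> real" where
  "ndist E x y =
     (if x \<in> carrier E \<and> y \<in> carrier E then nrm E (x \<ominus>\<^bsub>E\<^esub> y) else 0)"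

lemma (in normed_space) Metric_space_ndist: "Metric_space (carrier E) (ndist E)"
proof
  have K: "1 \<in> K" "- 1 \<in> K" using real_or_complex by auto
  have sm: "smult E (- 1) x = \<ominus> x" if x: "x \<in> carrier E" for x
  proof -
    have "- 1 = \<ominus>\<^bsub>scalars K\<^esub> \<one>\<^bsub>scalars K\<^esub>"
      using K by (intro R.minus_equality[symmetric]) (auto simp: scalars_def)
    then show ?thesis using smult_l_minus[OF R.one_closed x] x by simp
  qed
  have neg: "nrm E (\<ominus> x) = nrm E x" if "x \<in> carrier E" for x
    using nrm_smult[OF K(2) that] sm[OF that] by simp
  show "0 \<le> ndist E x y" for x y by (simp add: ndist_def nrm_nonneg)
  show "ndist E x y = ndist E y x" for x y
  proof (cases "x \<in> carrier E \<and> y \<in> carrier E")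
    case True
    then have "\<ominus> (x \<ominus> y) = y \<ominus> x" by (simp add: a_minus_def M.minus_add M.a_comm)
    with True show ?thesis using neg[of "x \<ominus> y"] by (simp add: ndist_def)
  qed (auto simp: ndist_def)
  show "ndist E x y = 0 \<longleftrightarrow> x = y" if "x \<in> carrier E" "y \<in> carrier E" for x y
  proof -
    have "(x \<ominus> y) \<oplus> y = x"
      using that by (simp add: a_minus_def M.a_assoc M.l_neg)
    then have "x \<ominus> y = \<zero> \<longleftrightarrow> x = y"
      using that by (auto simp: a_minus_def M.r_neg)
    then show ?thesis using that by (simp add: ndist_def nrm_eq_0)
  qed
  show "ndist E x z \<le> ndist E x y + ndist E y z"
    if "x \<in> carrier E" "y \<in> carrier E" "z \<in> carrier E" for x y z
  proof -
    have "\<ominus> y \<oplus> (y \<oplus> \<ominus> z) = \<ominus> z" using that by (simp add: M.r_neg1)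
    then have "x \<ominus> z = (x \<ominus> y) \<oplus> (y \<ominus> z)"
      using that by (simp add: a_minus_def M.a_assoc)
    then show ?thesis
      using that nrm_triangle[of "x \<ominus> y" "y \<ominus> z"] by (simp add: ndist_def)
  qed
qed

locale banach_space = normed_space +
  assumes complete: "Metric_space.mcomplete (carrier E) (ndist E)"

definition scalar_space :: "complex set \<Rightarrow> complex normed_module" where
  "scalar_space K = \<lparr>carrier = K, mult = (*), one = 1, zero = 0, add = (+),
                     smult = (*), nrm = cmod\<rparr>"

definition bounded_operator ::
    "complex set \<Rightarrow> 'a normed_module \<Rightarrow> 'b normed_module \<Rightarrow> ('a \<Rightarrow> 'b) \<Rightarrow> bool" where
  "bounded_operator K E F T \<longleftrightarrow>
     T \<in> carrier E \<rightarrow> carrier F \<and>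
     (\<forall>x\<in>carrier E. \<forall>y\<in>carrier E. T (x \<oplus>\<^bsub>E\<^esub> y) = T x \<oplus>\<^bsub>F\<^esub> T y) \<and>
     (\<forall>a\<in>K. \<forall>x\<in>carrier E. T (a \<odot>\<^bsub>E\<^esub> x) = a \<odot>\<^bsub>F\<^esub> T x) \<and>
     (\<exists>B. \<forall>x\<in>carrier E. nrm F (T x) \<le> B * nrm E x)"

definition operator_norm :: "'a normed_module \<Rightarrow> 'b normed_module \<Rightarrow> ('a \<Rightarrow> 'b) \<Rightarrow> real" where
  "operator_norm E F T = (SUP x\<in>{x \<in> carrier E. nrm E x \<le> 1}. nrm F (T x))"

text \<open>
  Functionals are taken to be \<open>undefined\<close> off the carrier, so that equality in
  the dual space is equality of functions.
\<close>

definition dual_space :: "complex set \<Rightarrow> 'a normed_module \<Rightarrow> ('a \<Rightarrow> complex) normed_module" where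
  "dual_space K E =
     \<lparr>carrier = {f \<in> extensional (carrier E). bounded_operator K E (scalar_space K) f},
      mult = undefined, one = undefined,
      zero = (\<lambda>x\<in>carrier E. 0),
      add = (\<lambda>f g. \<lambda>x\<in>carrier E. f x + g x),
      smult = (\<lambda>a f. \<lambda>x\<in>carrier E. a * f x),
      nrm = operator_norm E (scalar_space K)\<rparr>"

definition canonical_embedding ::
    "complex set \<Rightarrow> 'a normed_module \<Rightarrow> 'a \<Rightarrow> ('a \<Rightarrow> complex) \<Rightarrow> complex" where
  "canonical_embedding K E x = (\<lambda>f\<in>carrier (dual_space K E). f x)"

definition reflexive_space :: "complex set \<Rightarrow> 'a normed_module \<Rightarrow> bool" where
  "reflexive_space K E \<longleftrightarrow>
     canonical_embedding K E ` carrier E = carrier (dual_space K (dual_space K E))"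

definition weakly_tendsto ::
    "complex set \<Rightarrow> 'a normed_module \<Rightarrow> (nat \<Rightarrow> 'a) \<Rightarrow> 'a \<Rightarrow> bool" where
  "weakly_tendsto K E x l \<longleftrightarrow> (\<forall>f\<in>carrier (dual_space K E). (\<lambda>n. f (x n)) \<longlonglongrightarrow> f l)"

definition Schur_property :: "complex set \<Rightarrow> 'a normed_module \<Rightarrow> bool" where
  "Schur_property K F \<longleftrightarrow>
     (\<forall>x\<in>UNIV \<rightarrow> carrier F. (\<exists>l\<in>carrier F. weakly_tendsto K F x l) \<longrightarrow>
        (\<exists>l\<in>carrier F. (\<lambda>n. nrm F (x n \<ominus>\<^bsub>F\<^esub> l)) \<longlonglongrightarrow> 0))"

definition unit_sphere :: "'a normed_module \<Rightarrow> 'a set" where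
  "unit_sphere E = {x \<in> carrier E. nrm E x = 1}"

definition attains_norm :: "'a normed_module \<Rightarrow> 'b normed_module \<Rightarrow> ('a \<Rightarrow> 'b) \<Rightarrow> bool" where
  "attains_norm E F T \<longleftrightarrow> (\<exists>x\<in>unit_sphere E. nrm F (T x) = operator_norm E F T)"

definition maximizing_sequence ::
    "'a normed_module \<Rightarrow> 'b normed_module \<Rightarrow> ('a \<Rightarrow> 'b) \<Rightarrow> (nat \<Rightarrow> 'a) \<Rightarrow> bool" where
  "maximizing_sequence E F T x \<longleftrightarrow>
     (\<forall>n. x n \<in> unit_sphere E) \<and> (\<lambda>n. nrm F (T (x n))) \<longlonglongrightarrow> operator_norm E F T"

definition weak_maximizing_property ::
    "complex set \<Rightarrow> 'a normed_module \<Rightarrow> 'b normed_module \<Rightarrow> bool" where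
  "weak_maximizing_property K E F \<longleftrightarrow>
     (\<forall>T. bounded_operator K E F T \<and>
        (\<exists>x. maximizing_sequence E F T x \<and> \<not> weakly_tendsto K E x \<zero>\<^bsub>E\<^esub>) \<longrightarrow>
        attains_norm E F T)"

text \<open>
  HOL cannot quantify over types inside a formula. ``Every Banach space \<open>E\<close>'' is therefore
  expressed as ``every Banach space with carrier in a type \<open>'e\<close>'', where \<open>'e\<close> is an arbitrary
  type of at least continuum cardinality. A smaller type carries at most the zero space.
  Since \<open>'e\<close> is arbitrary, no Banach space is excluded.
\<close>

definition at_least_continuum :: "'e itself \<Rightarrow> bool" where
  "at_least_continuum _ \<longleftrightarrow> (\<exists>j :: real \<Rightarrow> 'e. inj j)"

end

theory Submission
  imports Defs
begin

text \<open>
  If \<open>F\<close> has the Schur property and \<open>E\<close> is reflexive, a maximizing sequence has a weakly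
  convergent subsequence; its image converges weakly, hence in norm, so the weak limit attains the
  norm.

  If \<open>F\<close> fails the Schur property, there is a weakly null sequence \<open>u\<close> of unit vectors. The
  interpolation method of Davis, Figiel, Johnson and Pelczynski gives a reflexive space \<open>R\<close>
  embedded in \<open>F\<close> in which \<open>u\<close> is bounded. An equivalent norm \<open>N\<close> on \<open>R\<close> satisfies
  \<open>\<parallel>y\<parallel> < N y\<close> for \<open>y \<noteq> 0\<close> and \<open>N (u n) \<longlonglongrightarrow> 1\<close>. On the \<open>\<ell>\<^sub>\<infinity>\<close>-sum of the scalars and \<open>R\<close>
  the operator \<open>(a, y) \<mapsto> y\<close> into \<open>F\<close> has norm \<open>1\<close>, does not attain it, and has the maximizing
  sequence \<open>(1, u n / N (u n))\<close>, which is not weakly null. All extensions, separations and splittings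
  of functionals come from a single form of the Hahn--Banach theorem.
\<close>

section \<open>Normed spaces\<close>

text \<open>Two obstacles shape the construction. The closed span of a weakly null sequence need not
  be reflexive (the unit vectors span \<open>c0\<close>), so it cannot serve as the domain;
  interpolation keeps the sequence but replaces the norm. And in \<open>R\<close> the normalized
  sequence \<open>u n / N (u n)\<close> is itself weakly null, so \<open>R\<close> alone does not
  refute the WMP. In a maximum norm a scalar coordinate 1 costs nothing, leaves the norm of the
  operator unattained and destroys weak nullity.

  Strictness of \<open>N\<close> and the size of the domain are settled by one device: countably
  many functionals \<open>t m\<close> separating the points of the closed span of \<open>u\<close>.
  Weighted by powers of 1/2 they give a seminorm that is positive off zero on \<open>R\<close> and
  yet tends to 0 along \<open>u\<close>; unweighted they map \<open>R\<close> injectively to complex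
  sequences, so that the counterexample fits into the type \<open>'e\<close> however large
  \<open>F\<close> is.

  The gauges of the interpolation method are suprema over polar sets of functionals instead of
  Minkowski functionals of convex sets. No closures of convex hulls are formed, and reflexivity is
  checked on functionals directly, without weak topologies.\<close>

lemma scalars_simps [simp]:
  "carrier (scalars K) = K" "a \<otimes>\<^bsub>scalars K\<^esub> b = a * b" "\<one>\<^bsub>scalars K\<^esub> = 1"
  "\<zero>\<^bsub>scalars K\<^esub> = 0" "a \<oplus>\<^bsub>scalars K\<^esub> b = a + b"
  by (simp_all add: scalars_def)

lemma scalar_space_simps [simp]:
  "carrier (scalar_space K) = K" "\<zero>\<^bsub>scalar_space K\<^esub> = 0" "a \<oplus>\<^bsub>scalar_space K\<^esub> b = a + b"
  "a \<odot>\<^bsub>scalar_space K\<^esub> b = a * b" "nrm (scalar_space K) a = cmod a"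
  by (simp_all add: scalar_space_def)

context normed_space
begin

lemma K_closed [simp, intro]:
  "0 \<in> K" "1 \<in> K" "complex_of_real r \<in> K" "a \<in> K \<Longrightarrow> b \<in> K \<Longrightarrow> a + b \<in> K"
  "a \<in> K \<Longrightarrow> b \<in> K \<Longrightarrow> a * b \<in> K" "a \<in> K \<Longrightarrow> b \<in> K \<Longrightarrow> a - b \<in> K" "a \<in> K \<Longrightarrow> - a \<in> K"
  "a \<in> K \<Longrightarrow> cnj a \<in> K" "a \<in> K \<Longrightarrow> inverse a \<in> K" "a \<in> K \<Longrightarrow> b \<in> K \<Longrightarrow> a / b \<in> K"
  using real_or_complex by (auto simp: complex_is_Real_iff Reals_cnj_iff)

lemma K_closed_set: "closed K"
  using real_or_complex closed_complex_Reals by auto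

lemma smult_in_carrier [simp, intro]: "a \<in> K \<Longrightarrow> x \<in> carrier E \<Longrightarrow> a \<odot> x \<in> carrier E"
  using smult_closed by simp

lemma smult_add_left: "a \<in> K \<Longrightarrow> b \<in> K \<Longrightarrow> x \<in> carrier E \<Longrightarrow> (a + b) \<odot> x = a \<odot> x \<oplus> b \<odot> x"
  using smult_l_distr by simp

lemma smult_add_right:
  "a \<in> K \<Longrightarrow> x \<in> carrier E \<Longrightarrow> y \<in> carrier E \<Longrightarrow> a \<odot> (x \<oplus> y) = a \<odot> x \<oplus> a \<odot> y"
  using smult_r_distr by simp

lemma smult_smult: "a \<in> K \<Longrightarrow> b \<in> K \<Longrightarrow> x \<in> carrier E \<Longrightarrow> a \<odot> (b \<odot> x) = (a * b) \<odot> x"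
  using smult_assoc1 by simp

lemma smult_1 [simp]: "x \<in> carrier E \<Longrightarrow> 1 \<odot> x = x"
  using smult_one by simp

lemma smult_0 [simp]: "x \<in> carrier E \<Longrightarrow> 0 \<odot> x = \<zero>"
  using smult_l_null by simp

lemma smult_zero_right [simp]: "a \<in> K \<Longrightarrow> a \<odot> \<zero> = \<zero>"
  using smult_r_null by simp

lemma minus_eq_smult: "x \<in> carrier E \<Longrightarrow> \<ominus> x = (- 1) \<odot> x"
  by (rule M.minus_equality) (use smult_add_left[of "-1" 1 x] in auto)

lemma diff_eq_smult: "x \<in> carrier E \<Longrightarrow> y \<in> carrier E \<Longrightarrow> x \<ominus> y = x \<oplus> (- 1) \<odot> y"
  by (simp add: a_minus_def minus_eq_smult)

lemma diff_closed [simp, intro]: "x \<in> carrier E \<Longrightarrow> y \<in> carrier E \<Longrightarrow> x \<ominus> y \<in> carrier E"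
  by (simp add: a_minus_def)

lemma add_closed [simp, intro]: "x \<in> carrier E \<Longrightarrow> y \<in> carrier E \<Longrightarrow> x \<oplus> y \<in> carrier E"
  by simp

lemma smult_diff_right:
  "a \<in> K \<Longrightarrow> x \<in> carrier E \<Longrightarrow> y \<in> carrier E \<Longrightarrow> a \<odot> (x \<ominus> y) = a \<odot> x \<ominus> a \<odot> y"
  by (simp add: diff_eq_smult smult_add_right smult_smult)

lemma nrm_zero [simp]: "nrm E \<zero> = 0"
  by (simp add: nrm_eq_0)

lemma nrm_minus: "x \<in> carrier E \<Longrightarrow> nrm E (\<ominus> x) = nrm E x"
  by (simp add: minus_eq_smult nrm_smult)

lemma nrm_diff_swap: "x \<in> carrier E \<Longrightarrow> y \<in> carrier E \<Longrightarrow> nrm E (x \<ominus> y) = nrm E (y \<ominus> x)"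
proof -
  assume xy: "x \<in> carrier E" "y \<in> carrier E"
  have "\<ominus> (x \<ominus> y) = y \<ominus> x" using xy by (simp add: a_minus_def M.minus_add M.a_comm)
  then show ?thesis using nrm_minus[of "x \<ominus> y"] xy by simp
qed

lemma diff_add_diff:
  "x \<in> carrier E \<Longrightarrow> y \<in> carrier E \<Longrightarrow> z \<in> carrier E \<Longrightarrow> (x \<ominus> y) \<oplus> (y \<ominus> z) = x \<ominus> z"
proof -
  assume xyz: "x \<in> carrier E" "y \<in> carrier E" "z \<in> carrier E"
  have "\<ominus> y \<oplus> (y \<oplus> \<ominus> z) = \<ominus> z" using xyz by (simp add: M.r_neg1)
  then show ?thesis using xyz by (simp add: a_minus_def M.a_assoc)
qed

lemma nrm_diff_triangle:
  "x \<in> carrier E \<Longrightarrow> y \<in> carrier E \<Longrightarrow> z \<in> carrier E \<Longrightarrow>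
   nrm E (x \<ominus> z) \<le> nrm E (x \<ominus> y) + nrm E (y \<ominus> z)"
  using nrm_triangle[of "x \<ominus> y" "y \<ominus> z"] by (simp add: diff_add_diff)

lemma add_diff_add:
  "x \<in> carrier E \<Longrightarrow> y \<in> carrier E \<Longrightarrow> z \<in> carrier E \<Longrightarrow> w \<in> carrier E \<Longrightarrow>
   (x \<oplus> y) \<ominus> (z \<oplus> w) = (x \<ominus> z) \<oplus> (y \<ominus> w)"
  by (simp add: a_minus_def M.minus_add M.a_ac)

lemma diff_self [simp]: "x \<in> carrier E \<Longrightarrow> x \<ominus> x = \<zero>"
  by (simp add: a_minus_def M.r_neg)

lemma diff_zero [simp]: "x \<in> carrier E \<Longrightarrow> x \<ominus> \<zero> = x"
  by (simp add: a_minus_def)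

lemma diff_add_cancel: "x \<in> carrier E \<Longrightarrow> y \<in> carrier E \<Longrightarrow> (x \<ominus> y) \<oplus> y = x"
  using diff_add_diff[of x y \<zero>] by simp

lemma diff_eq_zero_iff: "x \<in> carrier E \<Longrightarrow> y \<in> carrier E \<Longrightarrow> x \<ominus> y = \<zero> \<longleftrightarrow> x = y"
  using diff_add_cancel[of x y] by auto

lemma nrm_le_diff: "x \<in> carrier E \<Longrightarrow> y \<in> carrier E \<Longrightarrow> nrm E x \<le> nrm E (x \<ominus> y) + nrm E y"
  using nrm_triangle[of "x \<ominus> y" y] by (simp add: diff_add_cancel)

lemma abs_nrm_diff_le: "x \<in> carrier E \<Longrightarrow> y \<in> carrier E \<Longrightarrow> \<bar>nrm E x - nrm E y\<bar> \<le> nrm E (x \<ominus> y)"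
  using nrm_le_diff[of x y] nrm_le_diff[of y x] nrm_diff_swap[of x y] by auto

section \<open>Completeness through Cauchy sequences\<close>

lemma mcomplete_iff:
  "Metric_space.mcomplete (carrier E) (ndist E) \<longleftrightarrow>
   (\<forall>x\<in>UNIV \<rightarrow> carrier E. (\<forall>e>0. \<exists>N. \<forall>m\<ge>N. \<forall>n\<ge>N. nrm E (x m \<ominus> x n) < e) \<longrightarrow>
      (\<exists>l\<in>carrier E. (\<lambda>n. nrm E (x n \<ominus> l)) \<longlonglongrightarrow> 0))"
proof -
  interpret Metric_space "carrier E" "ndist E" by (rule Metric_space_ndist)
  have C: "MCauchy x \<longleftrightarrow> x \<in> UNIV \<rightarrow> carrier E \<and>
      (\<forall>e>0. \<exists>N. \<forall>m\<ge>N. \<forall>n\<ge>N. nrm E (x m \<ominus> x n) < e)" for x :: "nat \<Rightarrow> 'a"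
  proof (cases "range x \<subseteq> carrier E")
    case True
    then have "ndist E (x m) (x n) = nrm E (x m \<ominus> x n)" for m n by (auto simp: ndist_def)
    with True show ?thesis unfolding MCauchy_def by auto
  next
    case False
    then show ?thesis unfolding MCauchy_def by auto
  qed
  have L: "limitin mtopology x l sequentially \<longleftrightarrow>
      l \<in> carrier E \<and> (\<lambda>n. nrm E (x n \<ominus> l)) \<longlonglongrightarrow> 0"
    if "x \<in> UNIV \<rightarrow> carrier E" for x l
  proof (cases "l \<in> carrier E")
    case True
    with that have [simp]: "ndist E (x n) l = nrm E (x n \<ominus> l)" "x n \<in> carrier E" for n
      by (auto simp: ndist_def)
    show ?thesis
      using True
      by (auto simp: limitin_metric tendsto_iff nrm_nonneg)
  qed (auto simp: limitin_metric)
  show ?thesis unfolding mcomplete_def C by (auto simp: L cong: conj_cong)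
qed

end

lemma (in banach_space) Cauchy_limit:
  assumes "\<And>n. x n \<in> carrier E" "\<And>e. e > 0 \<Longrightarrow> \<exists>N. \<forall>m\<ge>N. \<forall>n\<ge>N. nrm E (x m \<ominus> x n) < e"
  obtains l where "l \<in> carrier E" "(\<lambda>n. nrm E (x n \<ominus> l)) \<longlonglongrightarrow> 0"
proof -
  have "\<exists>l\<in>carrier E. (\<lambda>n. nrm E (x n \<ominus> l)) \<longlonglongrightarrow> 0"
    by (rule complete[unfolded mcomplete_iff, rule_format]) (use assms in auto)
  then show ?thesis using that by blast
qed

text \<open>Any normed space \<open>F\<close> over \<open>K\<close> supplies the ring
  \<open>scalars K\<close>. Nonnegativity is derived: the triangle inequality for \<open>- x\<close>
  and \<open>x\<close> gives \<open>0 \<le> 2 * nrm E x\<close>.\<close>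

lemma normed_spaceI:
  assumes F: "normed_space K F"
    and ab: "abelian_group E"
    and sm: "\<And>a x. a \<in> K \<Longrightarrow> x \<in> carrier E \<Longrightarrow> a \<odot>\<^bsub>E\<^esub> x \<in> carrier E"
    and "\<And>a b x. a \<in> K \<Longrightarrow> b \<in> K \<Longrightarrow> x \<in> carrier E \<Longrightarrow> (a + b) \<odot>\<^bsub>E\<^esub> x = a \<odot>\<^bsub>E\<^esub> x \<oplus>\<^bsub>E\<^esub> b \<odot>\<^bsub>E\<^esub> x"
    and "\<And>a x y. a \<in> K \<Longrightarrow> x \<in> carrier E \<Longrightarrow> y \<in> carrier E \<Longrightarrow>
           a \<odot>\<^bsub>E\<^esub> (x \<oplus>\<^bsub>E\<^esub> y) = a \<odot>\<^bsub>E\<^esub> x \<oplus>\<^bsub>E\<^esub> a \<odot>\<^bsub>E\<^esub> y"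
    and "\<And>a b x. a \<in> K \<Longrightarrow> b \<in> K \<Longrightarrow> x \<in> carrier E \<Longrightarrow> (a * b) \<odot>\<^bsub>E\<^esub> x = a \<odot>\<^bsub>E\<^esub> (b \<odot>\<^bsub>E\<^esub> x)"
    and "\<And>x. x \<in> carrier E \<Longrightarrow> 1 \<odot>\<^bsub>E\<^esub> x = x"
    and eq: "\<And>x. x \<in> carrier E \<Longrightarrow> nrm E x \<le> 0 \<Longrightarrow> x = \<zero>\<^bsub>E\<^esub>"
    and hom: "\<And>a x. a \<in> K \<Longrightarrow> x \<in> carrier E \<Longrightarrow> nrm E (a \<odot>\<^bsub>E\<^esub> x) = cmod a * nrm E x"
    and tri: "\<And>x y. x \<in> carrier E \<Longrightarrow> y \<in> carrier E \<Longrightarrow> nrm E (x \<oplus>\<^bsub>E\<^esub> y) \<le> nrm E x + nrm E y"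
  shows "normed_space K E"
proof -
  interpret F: normed_space K F by (rule F)
  interpret module "scalars K" E
    by (rule moduleI) (use assms F.R.is_cring in auto)
  have z: "nrm E \<zero>\<^bsub>E\<^esub> = 0"
    using hom[of 0 "\<zero>\<^bsub>E\<^esub>"] smult_r_null[of 0] by simp
  have nn: "0 \<le> nrm E x" if x: "x \<in> carrier E" for x
  proof -
    have "(-1) \<odot>\<^bsub>E\<^esub> x \<oplus>\<^bsub>E\<^esub> x = \<zero>\<^bsub>E\<^esub>"
      using assms(4)[of "-1" 1 x] assms(7)[OF x] x smult_l_null[OF x] by simp
    then show ?thesis using tri[of "(-1) \<odot>\<^bsub>E\<^esub> x" x] hom[of "-1" x] x z sm[of "-1" x] by auto
  qed
  show ?thesis
    by unfold_locales (use F.real_or_complex nn eq hom tri z in force)+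
qed

lemma (in normed_space) normed_space_scalar_space: "normed_space K (scalar_space K)"
proof (rule normed_spaceI[OF normed_space_axioms])
  show "abelian_group (scalar_space K)"
    by (rule abelian_groupI) (auto simp: algebra_simps intro: bexI[of _ "- x" for x] exI[of _ "- x" for x])
qed (auto simp: algebra_simps norm_mult intro: norm_triangle_ineq)

section \<open>Operators and functionals\<close>

locale normed_pair = E: normed_space K E + F: normed_space K F
  for K and E :: "'a normed_module" and F :: "'b normed_module"
begin

lemma bounded_operatorI:
  assumes "\<And>x. x \<in> carrier E \<Longrightarrow> T x \<in> carrier F"
    "\<And>x y. x \<in> carrier E \<Longrightarrow> y \<in> carrier E \<Longrightarrow> T (x \<oplus>\<^bsub>E\<^esub> y) = T x \<oplus>\<^bsub>F\<^esub> T y"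
    "\<And>a x. a \<in> K \<Longrightarrow> x \<in> carrier E \<Longrightarrow> T (a \<odot>\<^bsub>E\<^esub> x) = a \<odot>\<^bsub>F\<^esub> T x"
    "\<And>x. x \<in> carrier E \<Longrightarrow> nrm F (T x) \<le> B * nrm E x"
  shows "bounded_operator K E F T"
  using assms unfolding bounded_operator_def by blast

context
  fixes T assumes T: "bounded_operator K E F T"
begin

lemma op_closed: "x \<in> carrier E \<Longrightarrow> T x \<in> carrier F"
  using T unfolding bounded_operator_def by blast

lemma op_add: "x \<in> carrier E \<Longrightarrow> y \<in> carrier E \<Longrightarrow> T (x \<oplus>\<^bsub>E\<^esub> y) = T x \<oplus>\<^bsub>F\<^esub> T y"
  using T unfolding bounded_operator_def by blast

lemma op_smult: "a \<in> K \<Longrightarrow> x \<in> carrier E \<Longrightarrow> T (a \<odot>\<^bsub>E\<^esub> x) = a \<odot>\<^bsub>F\<^esub> T x"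
  using T unfolding bounded_operator_def by blast

lemma op_bound: "\<exists>B\<ge>0. \<forall>x\<in>carrier E. nrm F (T x) \<le> B * nrm E x"
proof -
  from T obtain B where B: "\<And>x. x \<in> carrier E \<Longrightarrow> nrm F (T x) \<le> B * nrm E x"
    unfolding bounded_operator_def by blast
  have "nrm F (T x) \<le> max B 0 * nrm E x" if "x \<in> carrier E" for x
    using B[OF that] mult_right_mono[OF max.cobounded1[of B 0] E.nrm_nonneg[OF that]] by linarith
  then show ?thesis by (intro exI[of _ "max B 0"]) auto
qed

lemma op_zero: "T \<zero>\<^bsub>E\<^esub> = \<zero>\<^bsub>F\<^esub>"
  using op_smult[of 0 "\<zero>\<^bsub>E\<^esub>"] op_closed by simp

lemma bdd_above_op: "bdd_above ((\<lambda>x. nrm F (T x)) ` {x \<in> carrier E. nrm E x \<le> 1})"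
proof -
  obtain B where B: "B \<ge> 0" "\<And>x. x \<in> carrier E \<Longrightarrow> nrm F (T x) \<le> B * nrm E x"
    using op_bound by blast
  have "nrm F (T x) \<le> B" if "x \<in> carrier E" "nrm E x \<le> 1" for x
    using B(2)[OF that(1)] mult_left_mono[OF that(2) B(1)] by simp
  then show ?thesis by (auto intro!: bdd_aboveI[of _ B])
qed

lemma op_le_operator_norm1: "x \<in> carrier E \<Longrightarrow> nrm E x \<le> 1 \<Longrightarrow> nrm F (T x) \<le> operator_norm E F T"
  unfolding operator_norm_def by (rule cSUP_upper[OF _ bdd_above_op]) simp

lemma operator_norm_nonneg: "0 \<le> operator_norm E F T"
  using op_le_operator_norm1[of "\<zero>\<^bsub>E\<^esub>"] F.nrm_nonneg[OF op_closed[of "\<zero>\<^bsub>E\<^esub>"]] by auto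

lemma op_le_operator_norm: 
  assumes x: "x \<in> carrier E" shows "nrm F (T x) \<le> operator_norm E F T * nrm E x"
proof (cases "nrm E x = 0")
  case True
  then have "x = \<zero>\<^bsub>E\<^esub>" using x E.nrm_eq_0 by simp
  then show ?thesis using True by (simp add: op_zero)
next
  case False
  with E.nrm_nonneg[OF x] have pos: "nrm E x > 0" by simp
  define a where "a = complex_of_real (1 / nrm E x)"
  have a: "a \<in> K" "cmod a = 1 / nrm E x" using pos unfolding a_def by (auto simp: norm_divide)
  have "nrm F (T (a \<odot>\<^bsub>E\<^esub> x)) \<le> operator_norm E F T"
    using x a pos by (intro op_le_operator_norm1) (auto simp: E.nrm_smult)
  moreover have "nrm F (T (a \<odot>\<^bsub>E\<^esub> x)) = nrm F (T x) / nrm E x"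
    using x a by (simp add: op_smult F.nrm_smult op_closed)
  ultimately show ?thesis using pos by (simp add: field_simps)
qed

lemma operator_norm_le:
  assumes "B \<ge> 0" "\<And>x. x \<in> carrier E \<Longrightarrow> nrm F (T x) \<le> B * nrm E x"
  shows "operator_norm E F T \<le> B"
  unfolding operator_norm_def
proof (rule cSUP_least)
  show "{x \<in> carrier E. nrm E x \<le> 1} \<noteq> {}" by (auto intro!: exI[of _ "\<zero>\<^bsub>E\<^esub>"])
  show "nrm F (T x) \<le> B" if "x \<in> {x \<in> carrier E. nrm E x \<le> 1}" for x
    using assms(2)[of x] mult_left_mono[of "nrm E x" 1 B] that assms(1) by auto
qed

end
end

abbreviation dual :: "complex set \<Rightarrow> 'a normed_module \<Rightarrow> ('a \<Rightarrow> complex) set" where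
  "dual K E \<equiv> carrier (dual_space K E)"

lemma dual_space_simps [simp]:
  "\<zero>\<^bsub>dual_space K E\<^esub> = (\<lambda>x\<in>carrier E. 0)"
  "f \<oplus>\<^bsub>dual_space K E\<^esub> g = (\<lambda>x\<in>carrier E. f x + g x)"
  "a \<odot>\<^bsub>dual_space K E\<^esub> f = (\<lambda>x\<in>carrier E. a * f x)"
  "nrm (dual_space K E) f = operator_norm E (scalar_space K) f"
  by (simp_all add: dual_space_def)

context normed_space
begin

sublocale functional: normed_pair K E "scalar_space K"
  by (rule normed_pair.intro) (fact normed_space_axioms normed_space_scalar_space)+

abbreviation dnorm :: "('a \<Rightarrow> complex) \<Rightarrow> real" where
  "dnorm \<equiv> operator_norm E (scalar_space K)"

lemma dualI:
  assumes "\<And>x. x \<in> carrier E \<Longrightarrow> h x \<in> K"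
    "\<And>x y. x \<in> carrier E \<Longrightarrow> y \<in> carrier E \<Longrightarrow> h (x \<oplus> y) = h x + h y"
    "\<And>a x. a \<in> K \<Longrightarrow> x \<in> carrier E \<Longrightarrow> h (a \<odot> x) = a * h x"
    "\<And>x. x \<in> carrier E \<Longrightarrow> cmod (h x) \<le> B * nrm E x"
  shows "restrict h (carrier E) \<in> dual K E"
proof -
  have "bounded_operator K E (scalar_space K) (restrict h (carrier E))"
    by (rule functional.bounded_operatorI[of _ B]) (use assms in auto)
  then show ?thesis by (simp add: dual_space_def)
qed

lemma dual_op: "f \<in> dual K E \<Longrightarrow> bounded_operator K E (scalar_space K) f"
  by (simp add: dual_space_def)

lemma dual_extensional: "f \<in> dual K E \<Longrightarrow> f \<in> extensional (carrier E)"
  by (simp add: dual_space_def)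

lemma dual_in_K [simp, intro]: "f \<in> dual K E \<Longrightarrow> x \<in> carrier E \<Longrightarrow> f x \<in> K"
  using functional.op_closed[OF dual_op] by simp

lemma dual_add: "f \<in> dual K E \<Longrightarrow> x \<in> carrier E \<Longrightarrow> y \<in> carrier E \<Longrightarrow> f (x \<oplus> y) = f x + f y"
  using functional.op_add[OF dual_op] by simp

lemma dual_smult: "f \<in> dual K E \<Longrightarrow> a \<in> K \<Longrightarrow> x \<in> carrier E \<Longrightarrow> f (a \<odot> x) = a * f x"
  using functional.op_smult[OF dual_op] by simp

lemma dual_zero [simp]: "f \<in> dual K E \<Longrightarrow> f \<zero> = 0"
  using functional.op_zero[OF dual_op] by simp

lemma dual_diff: "f \<in> dual K E \<Longrightarrow> x \<in> carrier E \<Longrightarrow> y \<in> carrier E \<Longrightarrow> f (x \<ominus> y) = f x - f y"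
  by (simp add: diff_eq_smult dual_add dual_smult)

lemma dual_le_dnorm: "f \<in> dual K E \<Longrightarrow> x \<in> carrier E \<Longrightarrow> cmod (f x) \<le> dnorm f * nrm E x"
  using functional.op_le_operator_norm[OF dual_op] by simp

lemma dnorm_nonneg: "f \<in> dual K E \<Longrightarrow> 0 \<le> dnorm f"
  using functional.operator_norm_nonneg[OF dual_op] by simp

lemma dnorm_le:
  "f \<in> dual K E \<Longrightarrow> 0 \<le> B \<Longrightarrow> (\<And>x. x \<in> carrier E \<Longrightarrow> cmod (f x) \<le> B * nrm E x) \<Longrightarrow> dnorm f \<le> B"
  using functional.operator_norm_le[OF dual_op] by simp

lemma dual_le: "f \<in> dual K E \<Longrightarrow> dnorm f \<le> B \<Longrightarrow> x \<in> carrier E \<Longrightarrow> cmod (f x) \<le> B * nrm E x"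
  using dual_le_dnorm[of f x] mult_right_mono[of "dnorm f" B "nrm E x"] nrm_nonneg[of x] by auto

lemma dual_eqI: "f \<in> dual K E \<Longrightarrow> g \<in> dual K E \<Longrightarrow> (\<And>x. x \<in> carrier E \<Longrightarrow> f x = g x) \<Longrightarrow> f = g"
  by (meson dual_extensional extensionalityI)

lemma dual_scaleI: 
  assumes "f \<in> dual K E" "a \<in> K" shows "(\<lambda>x\<in>carrier E. a * f x) \<in> dual K E"
proof (rule dualI[where B = "cmod a * dnorm f"])
  show "cmod (a * f x) \<le> cmod a * dnorm f * nrm E x" if "x \<in> carrier E" for x
    using dual_le_dnorm[OF assms(1) that] by (auto simp: norm_mult mult.assoc intro: mult_left_mono)
qed (use assms in \<open>auto simp: dual_add dual_smult algebra_simps\<close>)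

lemma dual_addI: 
  assumes "f \<in> dual K E" "g \<in> dual K E" shows "(\<lambda>x\<in>carrier E. f x + g x) \<in> dual K E"
proof (rule dualI[where B = "dnorm f + dnorm g"])
  show "cmod (f x + g x) \<le> (dnorm f + dnorm g) * nrm E x" if "x \<in> carrier E" for x
    using dual_le_dnorm[OF assms(1) that] dual_le_dnorm[OF assms(2) that]
      norm_triangle_ineq[of "f x" "g x"] by (simp add: distrib_right)
qed (use assms in \<open>auto simp: dual_add dual_smult algebra_simps\<close>)

lemma dual_zeroI: "(\<lambda>x\<in>carrier E. 0) \<in> dual K E"
  by (rule dualI[where B = 0]) auto

lemma dual_sumI:
  assumes "finite I" "\<And>i. i \<in> I \<Longrightarrow> f i \<in> dual K E" 
  shows "(\<lambda>x\<in>carrier E. \<Sum>i\<in>I. f i x) \<in> dual K E"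
  using assms
proof (induction rule: finite_induct)
  case empty show ?case using dual_zeroI by (simp only: sum.empty)
next
  case (insert i I)
  have "(\<lambda>x\<in>carrier E. f i x + (\<lambda>x\<in>carrier E. \<Sum>i\<in>I. f i x) x) \<in> dual K E"
    using insert by (intro dual_addI) auto
  also have "(\<lambda>x\<in>carrier E. f i x + (\<lambda>x\<in>carrier E. \<Sum>i\<in>I. f i x) x) =
      (\<lambda>x\<in>carrier E. \<Sum>i\<in>insert i I. f i x)"
    using insert by (auto simp: restrict_def)
  finally show ?case .
qed

lemma normed_space_dual: "normed_space K (dual_space K E)"
proof (rule normed_spaceI[OF normed_space_axioms], goal_cases)
  case 1
  show ?case
  proof (rule abelian_groupI, goal_cases)
    case 1 then show ?case by (simp add: dual_addI)
  next
    case 2 then show ?case by (simp add: dual_zeroI)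
  next
    case (5 f) then show ?case
      by (intro dual_eqI) (auto intro: dual_addI dual_zeroI simp del: restrict_apply simp: restrict_apply')
  next
    case (6 f)
    show ?case
      using dual_scaleI[OF 6, of "-1"]
      by (intro bexI[of _ "\<lambda>x\<in>carrier E. -1 * f x"]) (auto simp: restrict_def)
  next
    case 3 then show ?case by (simp add: restrict_def add.assoc cong: if_cong)
  next
    case 4 then show ?case by (simp add: restrict_def add.commute cong: if_cong)
  qed
next
  case 2 then show ?case by (simp add: dual_scaleI)
next
  case (6 f)
  then show ?case using extensional_restrict[OF dual_extensional] by simp
next
  case (7 f)
  then show ?case using dual_le[of f 0] dnorm_nonneg[of f]
    by (intro dual_eqI[of f]) (auto intro: dual_zeroI)
next
  case (8 a f)
  \<comment> \<open>The supremum yields only this inequality; applied to \<open>inverse a\<close>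
    and the scaled functional it gives the converse. The same device recurs for
    \<open>linfty\<close> and \<open>sup_seminorm\<close>.\<close>
  have le: "dnorm (\<lambda>x\<in>carrier E. a * f x) \<le> cmod a * dnorm f" if "a \<in> K" "f \<in> dual K E" for a f
    using that dual_le_dnorm[of f]
    by (intro dnorm_le dual_scaleI) (auto simp: norm_mult mult.assoc dnorm_nonneg intro!: mult_left_mono)
  show ?case
  proof (cases "a = 0")
    case True
    then show ?thesis using le[of 0 f] dnorm_nonneg[OF dual_scaleI, of f 0] 8 by simp
  next
    case False
    let ?g = "\<lambda>x\<in>carrier E. a * f x"
    have g: "?g \<in> dual K E" using 8 dual_scaleI by simp
    have "(\<lambda>x\<in>carrier E. inverse a * ?g x) = f"
      using False 8 by (intro dual_eqI dual_scaleI g) auto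
    then have "dnorm f \<le> dnorm ?g / cmod a"
      using le[of "inverse a" ?g] g 8 by (simp add: norm_inverse divide_inverse mult.commute)
    then show ?thesis using le[of a f] 8 False by (simp add: field_simps)
  qed
next
  case (9 f g)
  have "dnorm (\<lambda>x\<in>carrier E. f x + g x) \<le> dnorm f + dnorm g"
  proof (rule dnorm_le)
    show "cmod ((\<lambda>x\<in>carrier E. f x + g x) x) \<le> (dnorm f + dnorm g) * nrm E x"
      if x: "x \<in> carrier E" for x
      using norm_triangle_ineq[of "f x" "g x"] dual_le_dnorm[of f x] dual_le_dnorm[of g x] 9 x
      by (simp add: distrib_right)
  qed (use 9 dnorm_nonneg[of f] dnorm_nonneg[of g] dual_addI in auto)
  then show ?case by simp
next
  case 3 then show ?case by (simp add: restrict_def distrib_right cong: if_cong)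
next
  case 4 then show ?case by (simp add: restrict_def distrib_left cong: if_cong)
next
  case 5 then show ?case by (simp add: restrict_def mult.assoc cong: if_cong)
qed

lemma canonical_embedding_in_bidual:
  assumes x: "x \<in> carrier E"
  shows "canonical_embedding K E x \<in> dual K (dual_space K E)"
proof -
  interpret D: normed_space K "dual_space K E" by (rule normed_space_dual)
  show ?thesis unfolding canonical_embedding_def
    by (rule D.dualI[where B = "nrm E x"]) (use x in \<open>auto simp: dual_le_dnorm mult.commute[of "nrm E x"]\<close>)
qed

text \<open>The canonical embedding always maps into the bidual, so only its surjectivity is at
  stake; since bidual functionals are extensional, their equality may be tested pointwise on the
  dual.\<close>

lemma reflexive_space_iff:
  "reflexive_space K E \<longleftrightarrow>
     (\<forall>\<phi>\<in>dual K (dual_space K E). \<exists>x\<in>carrier E. \<forall>f\<in>dual K E. \<phi> f = f x)"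
proof -
  interpret D: normed_space K "dual_space K E" by (rule normed_space_dual)
  have eq: "\<phi> = canonical_embedding K E x \<longleftrightarrow> (\<forall>f\<in>dual K E. \<phi> f = f x)"
    if "\<phi> \<in> dual K (dual_space K E)" for \<phi> x
  proof
    show "\<phi> = canonical_embedding K E x" if "\<forall>f\<in>dual K E. \<phi> f = f x"
      unfolding canonical_embedding_def
      by (rule extensionalityI[OF D.dual_extensional[OF \<open>\<phi> \<in> _\<close>]]) (use that in auto)
  qed (simp add: canonical_embedding_def)
  show ?thesis
  proof
    assume r: "reflexive_space K E"
    show "\<forall>\<phi>\<in>dual K (dual_space K E). \<exists>x\<in>carrier E. \<forall>f\<in>dual K E. \<phi> f = f x"
    proof
      fix \<phi> assume p: "\<phi> \<in> dual K (dual_space K E)"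
      then obtain x where "x \<in> carrier E" "\<phi> = canonical_embedding K E x"
        using r unfolding reflexive_space_def by blast
      with eq[OF p] show "\<exists>x\<in>carrier E. \<forall>f\<in>dual K E. \<phi> f = f x" by blast
    qed
  next
    assume r: "\<forall>\<phi>\<in>dual K (dual_space K E). \<exists>x\<in>carrier E. \<forall>f\<in>dual K E. \<phi> f = f x"
    have "dual K (dual_space K E) \<subseteq> canonical_embedding K E ` carrier E"
    proof
      fix \<phi> assume p: "\<phi> \<in> dual K (dual_space K E)"
      with r obtain x where "x \<in> carrier E" "\<forall>f\<in>dual K E. \<phi> f = f x" by blast
      with eq[OF p, of x] show "\<phi> \<in> canonical_embedding K E ` carrier E" by blast
    qed
    with canonical_embedding_in_bidual show "reflexive_space K E"
      unfolding reflexive_space_def by (intro equalityI image_subsetI)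
  qed
qed

end

section \<open>The Hahn--Banach theorem\<close>

context normed_space
begin

text \<open>The value 0 off the carrier makes the order of functions on the whole type agree with
  the pointwise order on the carrier, so that minimality below can be stated with equality of
  functions.\<close>

definition sublinear :: "('a \<Rightarrow> real) \<Rightarrow> bool" where
  "sublinear p \<longleftrightarrow> (\<forall>x\<in>carrier E. \<forall>y\<in>carrier E. p (x \<oplus> y) \<le> p x + p y) \<and>
     (\<forall>t\<ge>0. \<forall>x\<in>carrier E. p (complex_of_real t \<odot> x) = t * p x) \<and> (\<forall>x. x \<notin> carrier E \<longrightarrow> p x = 0)"

lemma sublinear_add: "sublinear p \<Longrightarrow> x \<in> carrier E \<Longrightarrow> y \<in> carrier E \<Longrightarrow> p (x \<oplus> y) \<le> p x + p y"
  and sublinear_smult: "sublinear p \<Longrightarrow> t \<ge> 0 \<Longrightarrow> x \<in> carrier E \<Longrightarrow> p (complex_of_real t \<odot> x) = t * p x"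
  and sublinear_outside: "sublinear p \<Longrightarrow> x \<notin> carrier E \<Longrightarrow> p x = 0"
  unfolding sublinear_def by blast+

lemma sublinearI:
  assumes "\<And>x y. x \<in> carrier E \<Longrightarrow> y \<in> carrier E \<Longrightarrow> p (x \<oplus> y) \<le> p x + p y"
    and zero: "p \<zero> \<ge> 0"
    and le: "\<And>t x. t > 0 \<Longrightarrow> x \<in> carrier E \<Longrightarrow> p (complex_of_real t \<odot> x) \<le> t * p x"
    and "\<And>x. x \<notin> carrier E \<Longrightarrow> p x = 0"
  shows "sublinear p"
  unfolding sublinear_def
proof (intro conjI ballI allI impI)
  \<comment> \<open>At \<open>t = 1/2\<close> the hypothesis says that \<open>p \<zero>\<close> is
    at most half of itself, hence not positive.\<close>
  have z: "p \<zero> = 0"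
    using le[of "1/2" \<zero>] smult_zero_right[OF K_closed(3), of "1/2"] zero by simp
  fix t :: real and x assume t: "0 \<le> t" and x: "x \<in> carrier E"
  show "p (complex_of_real t \<odot> x) = t * p x"
  proof (cases "t = 0")
    case True then show ?thesis using z x by simp
  next
    case False
    with t have t: "t > 0" by simp
    have "p (complex_of_real (inverse t) \<odot> (complex_of_real t \<odot> x)) \<le> inverse t * p (complex_of_real t \<odot> x)"
      using t x by (intro le) auto
    moreover have "complex_of_real (inverse t) \<odot> (complex_of_real t \<odot> x) = x"
      using t x by (subst smult_smult) (auto simp flip: of_real_mult)
    ultimately have "t * p x \<le> p (complex_of_real t \<odot> x)"
      using t by (simp add: field_simps)
    with le[OF t x] show ?thesis by simp
  qed
qed (use assms in auto)

lemma sublinear_zero: "sublinear p \<Longrightarrow> p \<zero> = 0"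
  using sublinear_smult[of p 0 \<zero>] by simp

lemma sublinear_minus: "sublinear p \<Longrightarrow> x \<in> carrier E \<Longrightarrow> - p (\<ominus> x) \<le> p x"
  using sublinear_add[of p x "\<ominus> x"] sublinear_zero[of p] by (simp add: M.r_neg)

text \<open>The common upper bound \<open>p0\<close> keeps the infimum finite, since each
  \<open>p x\<close> is at least \<open>- p0 (\<ominus> x)\<close>. The chain condition serves
  subadditivity: two members of \<open>C\<close> are replaced by the smaller one.\<close>

lemma sublinear_Inf_chain:
  assumes ne: "C \<noteq> {}" and sub: "\<And>p. p \<in> C \<Longrightarrow> sublinear p"
    and chain: "\<And>p q. p \<in> C \<Longrightarrow> q \<in> C \<Longrightarrow> p \<le> q \<or> q \<le> p"
    and le: "\<And>p. p \<in> C \<Longrightarrow> p \<le> p0"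
  shows "sublinear (\<lambda>x. INF p\<in>C. p x)" "\<And>p. p \<in> C \<Longrightarrow> (\<lambda>x. INF p\<in>C. p x) \<le> p"
proof -
  have bdd: "bdd_below ((\<lambda>p. p x) ` C)" for x
  proof (cases "x \<in> carrier E")
    case True
    have "- p0 (\<ominus> x) \<le> p x" if p: "p \<in> C" for p
      using sublinear_minus[OF sub[OF p] True] le[OF p] by (simp add: le_fun_def order.trans[rotated])
    then show ?thesis by (auto intro!: bdd_belowI[of _ "- p0 (\<ominus> x)"])
  next
    case False
    then show ?thesis using sublinear_outside[OF sub False] by (auto intro!: bdd_belowI[of _ "0::real"] order.eq_iff[THEN iffD1, THEN conjunct2])
  qed
  show *: "(\<lambda>x. INF p\<in>C. p x) \<le> p" if "p \<in> C" for p
    using that bdd by (auto simp: le_fun_def intro: cINF_lower)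
  show "sublinear (\<lambda>x. INF p\<in>C. p x)"
  proof (rule sublinearI)
    fix x y assume xy: "x \<in> carrier E" "y \<in> carrier E"
    have sum: "(INF p\<in>C. p (x \<oplus> y)) \<le> p x + q y" if pq: "p \<in> C" "q \<in> C" for p q
    proof -
      obtain r where r: "r \<in> C" "r \<le> p" "r \<le> q" using chain[OF pq] pq by blast
      have "(INF p\<in>C. p (x \<oplus> y)) \<le> r (x \<oplus> y)" using *[OF r(1)] by (simp add: le_fun_def)
      also have "\<dots> \<le> r x + r y" using sublinear_add[OF sub[OF r(1)]] xy by blast
      also have "\<dots> \<le> p x + q y" using r by (intro add_mono) (auto simp: le_fun_def)
      finally show ?thesis .
    qed
    have "(INF p\<in>C. p (x \<oplus> y)) - q y \<le> (INF p\<in>C. p x)" if "q \<in> C" for q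
      using ne sum[OF _ that] by (intro cINF_greatest) (auto simp: algebra_simps)
    then have "(INF p\<in>C. p (x \<oplus> y)) - (INF p\<in>C. p x) \<le> (INF q\<in>C. q y)"
      using ne by (intro cINF_greatest) (auto simp: algebra_simps)
    then show "(INF p\<in>C. p (x \<oplus> y)) \<le> (INF p\<in>C. p x) + (INF p\<in>C. p y)" by simp
  next
    show "0 \<le> (INF p\<in>C. p \<zero>)"
      using sublinear_zero[OF sub] by (intro cINF_greatest ne) (metis order_refl)
  next
    fix t :: real and x assume t: "t > 0" and x: "x \<in> carrier E"
    have "(INF p\<in>C. p (complex_of_real t \<odot> x)) / t \<le> (INF p\<in>C. p x)"
    proof (intro cINF_greatest ne)
      fix p assume p: "p \<in> C"
      have "(INF p\<in>C. p (complex_of_real t \<odot> x)) \<le> p (complex_of_real t \<odot> x)"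
        using *[OF p] by (simp add: le_fun_def)
      then show "(INF p\<in>C. p (complex_of_real t \<odot> x)) / t \<le> p x"
        using t x sublinear_smult[OF sub[OF p]] by (simp add: field_simps)
    qed
    then show "(INF p\<in>C. p (complex_of_real t \<odot> x)) \<le> t * (INF p\<in>C. p x)"
      using t by (simp add: field_simps)
  next
    fix x assume "x \<notin> carrier E"
    then have "(\<lambda>p. p x) ` C = {0}" using ne sublinear_outside[OF sub] by force
    then show "(INF p\<in>C. p x) = 0" by simp
  qed
qed

text \<open>The next lemma is applied to a minimal \<open>p\<close>, which it forces to be additive.\<close>

lemma sublinear_shift:
  assumes p: "sublinear p" and y: "y \<in> carrier E"
  obtains q where "sublinear q" "q \<le> p" "\<And>x. x \<in> carrier E \<Longrightarrow> q x \<le> p (x \<oplus> y) - p y"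
proof -
  \<comment> \<open>Taking the infimum over all \<open>t \<ge> 0\<close>, not only
    \<open>t = 1\<close>, makes \<open>q\<close> subadditive and positively homogeneous. The value
    \<open>t = 0\<close> gives \<open>q \<le> p\<close>, and \<open>t = 1\<close> gives the last
    claim.\<close>
  define c where "c x t = p (x \<oplus> complex_of_real t \<odot> y) - t * p y" for x t
  define q where "q x = (if x \<in> carrier E then INF t\<in>{0..}. c x t else 0)" for x
  have cge: "- p (\<ominus> x) \<le> c x t" if x: "x \<in> carrier E" and t: "t \<ge> 0" for x t
  proof -
    have "\<ominus> x \<oplus> (x \<oplus> complex_of_real t \<odot> y) = complex_of_real t \<odot> y"
      using x y by (simp add: M.r_neg1)
    then show ?thesis
      using sublinear_add[OF p, of "\<ominus> x" "x \<oplus> complex_of_real t \<odot> y"] x y sublinear_smult[OF p t y]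
      unfolding c_def by simp
  qed
  have q_le: "q x \<le> c x t" if "x \<in> carrier E" "t \<ge> 0" for x t
    using that cge[OF that(1)] unfolding q_def
    by (auto intro!: cINF_lower bdd_belowI[of _ "- p (\<ominus> x)"])
  have q_ge: "b \<le> q x" if "x \<in> carrier E" "\<And>t. t \<ge> 0 \<Longrightarrow> b \<le> c x t" for b x
    using that unfolding q_def by (auto intro: cINF_greatest)
  have "sublinear q"
  proof (rule sublinearI)
    fix x x' assume x: "x \<in> carrier E" "x' \<in> carrier E"
    have "q (x \<oplus> x') \<le> c x s + c x' t" if st: "s \<ge> 0" "t \<ge> 0" for s t
    proof -
      have "(x \<oplus> x') \<oplus> complex_of_real (s + t) \<odot> y = (x \<oplus> complex_of_real s \<odot> y) \<oplus> (x' \<oplus> complex_of_real t \<odot> y)"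
        using x y by (simp add: smult_add_left M.a_ac)
      then have "c (x \<oplus> x') (s + t) \<le> c x s + c x' t"
        using sublinear_add[OF p, of "x \<oplus> complex_of_real s \<odot> y" "x' \<oplus> complex_of_real t \<odot> y"] x y
        unfolding c_def by (simp add: algebra_simps)
      with q_le[of "x \<oplus> x'" "s + t"] x st show ?thesis by simp
    qed
    then have "q (x \<oplus> x') - c x' t \<le> q x" if "t \<ge> 0" for t
      using that x by (intro q_ge) (auto simp: algebra_simps)
    then have "q (x \<oplus> x') - q x \<le> q x'"
      using x by (intro q_ge) (auto simp: algebra_simps)
    then show "q (x \<oplus> x') \<le> q x + q x'" by simp
  next
    show "0 \<le> q \<zero>"
      using cge[of \<zero>] sublinear_zero[OF p] by (intro q_ge) (auto simp: minus_eq_smult)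
  next
    fix t :: real and x assume t: "t > 0" and x: "x \<in> carrier E"
    have "q (complex_of_real t \<odot> x) / t \<le> q x"
    proof (rule q_ge[OF x])
      fix s :: real assume s: "s \<ge> 0"
      have "complex_of_real t \<odot> x \<oplus> complex_of_real (t * s) \<odot> y
          = complex_of_real t \<odot> (x \<oplus> complex_of_real s \<odot> y)"
        using x y by (simp add: smult_add_right smult_smult)
      then have "c (complex_of_real t \<odot> x) (t * s) = t * c x s"
        using sublinear_smult[OF p, of t "x \<oplus> complex_of_real s \<odot> y"] t x y
        unfolding c_def by (simp add: algebra_simps)
      then show "q (complex_of_real t \<odot> x) / t \<le> c x s"
        using q_le[of "complex_of_real t \<odot> x" "t * s"] t s x by (simp add: field_simps)
    qed
    then show "q (complex_of_real t \<odot> x) \<le> t * q x" using t by (simp add: field_simps)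
  qed (simp add: q_def)
  moreover have "q \<le> p"
  proof (rule le_funI)
    show "q x \<le> p x" for x
      using q_le[of x 0] y sublinear_outside[OF p, of x]
      by (cases "x \<in> carrier E") (auto simp: c_def q_def)
  qed
  moreover have "q x \<le> p (x \<oplus> y) - p y" if "x \<in> carrier E" for x
    using q_le[OF that, of 1] y by (simp add: c_def)
  ultimately show ?thesis by (rule that)
qed

text \<open>Zorn's lemma, for the reversed order, gives a minimal sublinear functional
  \<open>u\<close> below \<open>p0\<close>. The functional \<open>q\<close> of
  \<open>sublinear_shift\<close> must equal \<open>u\<close>, which makes \<open>u\<close>
  superadditive and hence additive.\<close>

lemma sublinear_dominates_linear:
  assumes p0: "sublinear p0"
  obtains u where "\<And>x y. x \<in> carrier E \<Longrightarrow> y \<in> carrier E \<Longrightarrow> u (x \<oplus> y) = u x + u y"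
    "\<And>t x. x \<in> carrier E \<Longrightarrow> u (complex_of_real t \<odot> x) = t * u x"
    "\<And>x. x \<in> carrier E \<Longrightarrow> u x \<le> p0 x"
proof -
  define A where "A = {p. sublinear p \<and> p \<le> p0}"
  have "\<exists>u\<in>A. \<forall>q\<in>A. q \<le> u \<longrightarrow> q = u"
  proof (rule predicate_Zorn)
    show "partial_order_on A (relation_of (\<lambda>u q. q \<le> u) A)"
      by (auto simp: partial_order_on_def preorder_on_def refl_on_def trans_def antisym_def relation_of_def)
    fix C assume C: "C \<in> Chains (relation_of (\<lambda>u q. q \<le> u) A)"
    show "\<exists>u\<in>A. \<forall>a\<in>C. u \<le> a"
    proof (cases "C = {}")
      case True then show ?thesis using p0 by (auto simp: A_def)
    next
      case False
      have CA: "p \<in> A" if "p \<in> C" for p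
        using C that by (auto simp: Chains_def relation_of_def)
      have ch: "p \<le> q \<or> q \<le> p" if "p \<in> C" "q \<in> C" for p q
        using C that by (auto simp: Chains_def relation_of_def)
      define r where "r = (\<lambda>x. INF p\<in>C. p x)"
      have r: "sublinear r" "\<And>p. p \<in> C \<Longrightarrow> r \<le> p"
        unfolding r_def by (rule sublinear_Inf_chain[OF False _ ch, of p0]; use CA in \<open>auto simp: A_def\<close>)+
      obtain p where "p \<in> C" using False by blast
      then have "r \<le> p0" using r(2) CA unfolding A_def by (blast intro: order.trans)
      with r show ?thesis unfolding A_def by blast
    qed
  qed
  then obtain u where u: "sublinear u" "u \<le> p0" "\<And>q. sublinear q \<Longrightarrow> q \<le> u \<Longrightarrow> q = u"
    unfolding A_def by (auto intro: order.trans)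
  have super: "u x + u y \<le> u (x \<oplus> y)" if xy: "x \<in> carrier E" "y \<in> carrier E" for x y
  proof -
    obtain q where "sublinear q" "q \<le> u" "\<And>x. x \<in> carrier E \<Longrightarrow> q x \<le> u (x \<oplus> y) - u y"
      using sublinear_shift[OF u(1) xy(2)] by blast
    with u(3)[of q] xy show ?thesis by fastforce
  qed
  have add: "u (x \<oplus> y) = u x + u y" if xy: "x \<in> carrier E" "y \<in> carrier E" for x y
    using super[OF xy] sublinear_add[OF u(1) xy] by simp
  have neg: "u (\<ominus> x) = - u x" if "x \<in> carrier E" for x
    using add[OF that, of "\<ominus> x"] that sublinear_zero[OF u(1)] by (simp add: M.r_neg)
  have "u (complex_of_real t \<odot> x) = t * u x" if x: "x \<in> carrier E" for t x
  proof (cases "t \<ge> 0")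
    case True then show ?thesis using sublinear_smult[OF u(1)] x by simp
  next
    case False
    have "complex_of_real t \<odot> x = \<ominus> (complex_of_real (- t) \<odot> x)"
      using x by (subst minus_eq_smult) (auto simp: smult_smult)
    then show ?thesis using neg sublinear_smult[OF u(1), of "- t" x] x False by simp
  qed
  with that[of u] add u(2) show ?thesis by (simp add: le_fun_def)
qed

text \<open>Multiplication by \<open>cnj z / cmod z\<close> turns \<open>z\<close> into its modulus,
  and this scalar lies in \<open>K\<close> for both fields. Bounds on real parts, which are all that
  a real-linear functional provides, thus become bounds on moduli.\<close>

lemma cmod_le_if_Re_rotations_le:
  assumes z: "z \<in> K" and le: "\<And>a. a \<in> K \<Longrightarrow> cmod a = 1 \<Longrightarrow> Re (a * z) \<le> r"
  shows "cmod z \<le> r"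
proof (cases "z = 0")
  case True then show ?thesis using le[of 1] by simp
next
  case False
  define a where "a = cnj z / cmod z"
  have "a * z = cmod z"
    using False by (simp add: a_def complex_norm_square[symmetric] power2_eq_square mult.commute)
  moreover have "a \<in> K" "cmod a = 1" using z False unfolding a_def by (auto simp: norm_divide)
  ultimately show ?thesis using le[of a] by simp
qed

text \<open>
  Besides extension of functionals (\<open>Q = 0\<close>, \<open>L\<close> an inclusion) this covers separation and
  splitting: a functional dominated by a sum of two seminorms is the sum of two functionals, each
  dominated by one of them.
\<close>

theorem hahn_banach:
  fixes L :: "'i \<Rightarrow> 'a" and \<psi> :: "'i \<Rightarrow> complex" and Q :: "'i \<Rightarrow> real"
  assumes ne: "I \<noteq> {}" and C: "0 \<le> C"
    and L: "\<And>i. i \<in> I \<Longrightarrow> L i \<in> carrier E" and \<psi>: "\<And>i. i \<in> I \<Longrightarrow> \<psi> i \<in> K"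
    and add: "\<And>i j. i \<in> I \<Longrightarrow> j \<in> I \<Longrightarrow>
      \<exists>k\<in>I. L k = L i \<oplus> L j \<and> \<psi> k = \<psi> i + \<psi> j \<and> Q k \<le> Q i + Q j"
    and smult: "\<And>a i. a \<in> K \<Longrightarrow> i \<in> I \<Longrightarrow>
      \<exists>k\<in>I. L k = a \<odot> L i \<and> \<psi> k = a * \<psi> i \<and> Q k \<le> cmod a * Q i"
    and le: "\<And>i. i \<in> I \<Longrightarrow> cmod (\<psi> i) \<le> C * nrm E (L i) + Q i"
  obtains f where "f \<in> dual K E" "\<And>x. x \<in> carrier E \<Longrightarrow> cmod (f x) \<le> C * nrm E x"
    "\<And>i. i \<in> I \<Longrightarrow> cmod (f (L i) - \<psi> i) \<le> Q i"
proof -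
  \<comment> \<open>\<open>p\<close> is an infimal convolution. A linear \<open>u \<le> p\<close>
    satisfies \<open>u (L i) - Re (\<psi> i) \<le> Q i\<close> (take \<open>x = L i\<close>) and
    \<open>u x \<le> C * nrm E x\<close> (take an index scaled by 0). The domination hypothesis
    \<open>le\<close> keeps the infimum finite.\<close>
  define c where "c x i = C * nrm E (x \<ominus> L i) + Re (\<psi> i) + Q i" for x i
  define p where "p x = (if x \<in> carrier E then INF i\<in>I. c x i else 0)" for x
  have cge: "- (C * nrm E x) \<le> c x i" if x: "x \<in> carrier E" and i: "i \<in> I" for x i
  proof -
    have "- Re (\<psi> i) \<le> C * nrm E (L i) + Q i"
      using le[OF i] complex_Re_le_cmod[of "- \<psi> i"] by simp
    moreover have "C * nrm E (L i) \<le> C * (nrm E (x \<ominus> L i) + nrm E x)"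
      using nrm_le_diff[of "L i" x] L[OF i] x C nrm_diff_swap[of x "L i"] by (intro mult_left_mono) auto
    ultimately show ?thesis unfolding c_def by (simp add: algebra_simps)
  qed
  have p_le: "p x \<le> c x i" if "x \<in> carrier E" "i \<in> I" for x i
    using that cge[OF that(1)] unfolding p_def
    by (auto intro!: cINF_lower bdd_belowI[of _ "- (C * nrm E x)"])
  have p_ge: "b \<le> p x" if "x \<in> carrier E" "\<And>i. i \<in> I \<Longrightarrow> b \<le> c x i" for b x
    using that ne unfolding p_def by (auto intro: cINF_greatest)
  have "sublinear p"
  proof (rule sublinearI)
    fix x y assume x: "x \<in> carrier E" "y \<in> carrier E"
    have "p (x \<oplus> y) \<le> c x i + c y j" if ij: "i \<in> I" "j \<in> I" for i j
    proof -
      obtain k where k: "k \<in> I" "L k = L i \<oplus> L j" "\<psi> k = \<psi> i + \<psi> j" "Q k \<le> Q i + Q j"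
        using add[OF ij] by blast
      have "nrm E ((x \<oplus> y) \<ominus> L k) \<le> nrm E (x \<ominus> L i) + nrm E (y \<ominus> L j)"
        using k(2) x L ij nrm_triangle[of "x \<ominus> L i" "y \<ominus> L j"] by (simp add: add_diff_add)
      then have "C * nrm E ((x \<oplus> y) \<ominus> L k) \<le> C * (nrm E (x \<ominus> L i) + nrm E (y \<ominus> L j))"
        using C by (rule mult_left_mono)
      then have "c (x \<oplus> y) k \<le> c x i + c y j"
        using k unfolding c_def by (simp add: algebra_simps)
      with p_le[of "x \<oplus> y" k] k x show ?thesis by simp
    qed
    then have "p (x \<oplus> y) - c y j \<le> p x" if "j \<in> I" for j
      using that x by (intro p_ge) (auto simp: algebra_simps)
    then have "p (x \<oplus> y) - p x \<le> p y"
      using x by (intro p_ge) (auto simp: algebra_simps)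
    then show "p (x \<oplus> y) \<le> p x + p y" by simp
  next
    show "0 \<le> p \<zero>" using cge[of \<zero>] by (intro p_ge) auto
  next
    fix t :: real and x assume t: "t > 0" and x: "x \<in> carrier E"
    have "p (complex_of_real t \<odot> x) / t \<le> p x"
    proof (rule p_ge[OF x])
      fix i assume i: "i \<in> I"
      obtain k where k: "k \<in> I" "L k = complex_of_real t \<odot> L i" "\<psi> k = t * \<psi> i" "Q k \<le> t * Q i"
        using smult[of "complex_of_real t" i] i t by auto
      have "nrm E (complex_of_real t \<odot> x \<ominus> L k) = t * nrm E (x \<ominus> L i)"
        using k(2) x L[OF i] t nrm_smult[of "complex_of_real t" "x \<ominus> L i"] by (simp add: smult_diff_right)
      then have "c (complex_of_real t \<odot> x) k \<le> t * c x i"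
        using k unfolding c_def by (simp add: algebra_simps)
      with p_le[of "complex_of_real t \<odot> x" k] k x
      have "p (complex_of_real t \<odot> x) \<le> t * c x i" by simp
      then show "p (complex_of_real t \<odot> x) / t \<le> c x i" using t by (simp add: field_simps)
    qed
    then show "p (complex_of_real t \<odot> x) \<le> t * p x" using t by (simp add: field_simps)
  qed (simp add: p_def)
  then obtain u where u_add: "\<And>x y. x \<in> carrier E \<Longrightarrow> y \<in> carrier E \<Longrightarrow> u (x \<oplus> y) = u x + u y"
    and u_smult: "\<And>t x. x \<in> carrier E \<Longrightarrow> u (complex_of_real t \<odot> x) = t * u x"
    and u_le: "\<And>x. x \<in> carrier E \<Longrightarrow> u x \<le> p x"
    using sublinear_dominates_linear[of p] by blast
  have u_le_nrm: "u x \<le> C * nrm E x" if x: "x \<in> carrier E" for x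
  proof -
    obtain i where "i \<in> I" using ne by blast
    from smult[OF K_closed(1) this] obtain k where "k \<in> I" "L k = \<zero>" "\<psi> k = 0" "Q k \<le> 0"
      using L[OF \<open>i \<in> I\<close>] by auto
    then have "c x k \<le> C * nrm E x" using x unfolding c_def by simp
    with p_le[OF x \<open>k \<in> I\<close>] u_le[OF x] show ?thesis by simp
  qed
  have u_le_Q: "u (L i) - Re (\<psi> i) \<le> Q i" if i: "i \<in> I" for i
    using u_le[OF L[OF i]] p_le[OF L[OF i] i] L[OF i] unfolding c_def by simp
  \<comment> \<open>The usual complexification with imaginary part
    \<open>- u (\<i> \<odot> x)\<close>; for real scalars \<open>u\<close> itself is kept.\<close>
  define f where "f x = (if K = UNIV then Complex (u x) (- u (\<i> \<odot> x)) else complex_of_real (u x))" for x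
  have Re_f: "Re (f x) = u x" for x by (simp add: f_def)
  have f_K: "f x \<in> K" for x using real_or_complex by (auto simp: f_def)
  have f_add: "f (x \<oplus> y) = f x + f y" if "x \<in> carrier E" "y \<in> carrier E" for x y
    using that by (auto simp: f_def u_add smult_add_right complex_eq_iff)
  have f_smult: "f (a \<odot> x) = a * f x" if a: "a \<in> K" and x: "x \<in> carrier E" for a x
  proof (cases "K = UNIV")
    case True
    have u_cmul: "u (b \<odot> y) = Re b * u y + Im b * u (\<i> \<odot> y)" if y: "y \<in> carrier E" for b y
    proof -
      have "b = complex_of_real (Re b) + complex_of_real (Im b) * \<i>" by (simp add: complex_eq_iff)
      then have "b \<odot> y = complex_of_real (Re b) \<odot> y \<oplus> complex_of_real (Im b) \<odot> (\<i> \<odot> y)"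
        using y True by (metis UNIV_I smult_add_left smult_smult)
      then show ?thesis using y True by (simp add: u_add u_smult)
    qed
    have "u (\<i> \<odot> (a \<odot> x)) = - Im a * u x + Re a * u (\<i> \<odot> x)"
      using x True u_cmul[OF x, of "\<i> * a"] by (simp add: smult_smult)
    then show ?thesis using True u_cmul[OF x, of a] by (simp add: f_def complex_eq_iff)
  next
    case False
    then have "a = complex_of_real (Re a)" using a real_or_complex by (simp add: complex_is_Real_iff complex_eq_iff)
    then show ?thesis using False u_smult[OF x, of "Re a"] by (simp add: f_def)
  qed
  have f_bound: "cmod (f x) \<le> C * nrm E x" if x: "x \<in> carrier E" for x
  proof (rule cmod_le_if_Re_rotations_le[OF f_K])
    fix a assume a: "a \<in> K" "cmod a = 1"
    then show "Re (a * f x) \<le> C * nrm E x"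
      using u_le_nrm[of "a \<odot> x"] x Re_f[of "a \<odot> x"] by (simp add: f_smult nrm_smult)
  qed
  have f_Q: "cmod (f (L i) - \<psi> i) \<le> Q i" if i: "i \<in> I" for i
  proof (rule cmod_le_if_Re_rotations_le)
    fix a assume a: "a \<in> K" "cmod a = 1"
    obtain k where k: "k \<in> I" "L k = a \<odot> L i" "\<psi> k = a * \<psi> i" "Q k \<le> Q i"
      using smult[OF a(1) i] a by auto
    have "Re (a * (f (L i) - \<psi> i)) = u (L k) - Re (\<psi> k)"
      using k a L[OF i] Re_f[of "L k"] by (simp add: f_smult right_diff_distrib)
    with u_le_Q[OF k(1)] k(4) show "Re (a * (f (L i) - \<psi> i)) \<le> Q i" by simp
  qed (use f_K \<psi> i in auto)
  have "restrict f (carrier E) \<in> dual K E"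
    by (rule dualI[OF f_K f_add f_smult f_bound])
  with that[of "restrict f (carrier E)"] show ?thesis using f_bound f_Q L by simp
qed

section \<open>Norming and separating functionals\<close>

lemma norming_functional:
  assumes x: "x \<in> carrier E"
  obtains f where "f \<in> dual K E" "\<And>y. y \<in> carrier E \<Longrightarrow> cmod (f y) \<le> nrm E y"
    "f x = complex_of_real (nrm E x)"
\<comment> \<open>The indices are the scalars, standing for the line through \<open>x\<close>;
  \<open>Q = 0\<close> turns approximation into extension.\<close>
proof (rule hahn_banach[where I = K and C = 1 and L = "\<lambda>t. t \<odot> x" and \<psi> = "\<lambda>t. t * nrm E x" and Q = "\<lambda>t. 0"])
  show "\<exists>k\<in>K. k \<odot> x = i \<odot> x \<oplus> j \<odot> x \<and> k * nrm E x = i * nrm E x + j * nrm E x \<and> (0::real) \<le> 0 + 0"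
    if "i \<in> K" "j \<in> K" for i j
    using that x by (intro bexI[of _ "i + j"]) (auto simp: smult_add_left algebra_simps)
  show "\<exists>k\<in>K. k \<odot> x = a \<odot> (i \<odot> x) \<and> k * nrm E x = a * (i * nrm E x) \<and> 0 \<le> cmod a * 0"
    if "a \<in> K" "i \<in> K" for i a
    using that x by (intro bexI[of _ "a * i"]) (auto simp: smult_smult)
  fix f assume f: "f \<in> dual K E" "\<And>y. y \<in> carrier E \<Longrightarrow> cmod (f y) \<le> 1 * nrm E y"
    "\<And>t. t \<in> K \<Longrightarrow> cmod (f (t \<odot> x) - t * nrm E x) \<le> 0"
  then show thesis using that[of f] f(3)[of 1] x by simp
qed (use x in \<open>auto simp: nrm_smult norm_mult nrm_nonneg\<close>)

lemma nrm_leI: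
  assumes x: "x \<in> carrier E"
    and le: "\<And>f. f \<in> dual K E \<Longrightarrow> (\<And>y. y \<in> carrier E \<Longrightarrow> cmod (f y) \<le> nrm E y) \<Longrightarrow> cmod (f x) \<le> b"
  shows "nrm E x \<le> b"
proof -
  obtain f where f: "f \<in> dual K E" "\<And>y. y \<in> carrier E \<Longrightarrow> cmod (f y) \<le> nrm E y"
    "f x = complex_of_real (nrm E x)" using norming_functional[OF x] by blast
  then show ?thesis using le[of f] nrm_nonneg[OF x] by simp
qed

lemma dual_separates:
  assumes "x \<in> carrier E" "y \<in> carrier E" "\<And>f. f \<in> dual K E \<Longrightarrow> f x = f y"
  shows "x = y"
proof -
  have "nrm E (x \<ominus> y) \<le> 0" using assms by (intro nrm_leI) (auto simp: dual_diff)
  then have "x \<ominus> y = \<zero>" using assms nrm_nonneg[of "x \<ominus> y"] nrm_eq_0[of "x \<ominus> y"] by simp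
  then show ?thesis using assms diff_eq_zero_iff by simp
qed

end

section \<open>Bounded scalar sequences\<close>

text \<open>Target of the maps sending a functional \<open>h\<close> to its values along a bounded
  sequence of points. Functionals on dual spaces are studied by factoring them through these
  maps.\<close>

definition linfty :: "complex set \<Rightarrow> (nat \<Rightarrow> complex) normed_module" where
  "linfty K = \<lparr>carrier = {x. range x \<subseteq> K \<and> bounded (range x)}, mult = undefined, one = undefined,
     zero = (\<lambda>n. 0), add = (\<lambda>x y n. x n + y n), smult = (\<lambda>a x n. a * x n),
     nrm = (\<lambda>x. SUP n. cmod (x n))\<rparr>"

lemma linfty_simps [simp]:
  "\<zero>\<^bsub>linfty K\<^esub> = (\<lambda>n. 0)" "x \<oplus>\<^bsub>linfty K\<^esub> y = (\<lambda>n. x n + y n)"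
  "a \<odot>\<^bsub>linfty K\<^esub> x = (\<lambda>n. a * x n)"
  by (simp_all add: linfty_def)

lemma linfty_iff: "x \<in> carrier (linfty K) \<longleftrightarrow> (\<forall>n. x n \<in> K) \<and> (\<exists>b. \<forall>n. cmod (x n) \<le> b)"
  by (auto simp: linfty_def bounded_iff)

lemma linfty_in_K: "x \<in> carrier (linfty K) \<Longrightarrow> x n \<in> K"
  by (simp add: linfty_iff)

lemma cmod_le_nrm_linfty: "x \<in> carrier (linfty K) \<Longrightarrow> cmod (x n) \<le> nrm (linfty K) x"
  unfolding linfty_iff by (auto simp: linfty_def intro!: cSUP_upper bdd_aboveI2)

lemma nrm_linfty_le: "(\<And>n. cmod (x n) \<le> b) \<Longrightarrow> nrm (linfty K) x \<le> b"
  by (auto simp: linfty_def intro: cSUP_least)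

lemma (in normed_space) linfty_scaleI:
  assumes "a \<in> K" "x \<in> carrier (linfty K)" shows "(\<lambda>n. a * x n) \<in> carrier (linfty K)"
proof -
  obtain b where "\<And>n. cmod (x n) \<le> b" using assms unfolding linfty_iff by blast
  then have "cmod (a * x n) \<le> cmod a * b" for n by (simp add: norm_mult mult_left_mono)
  then show ?thesis using assms unfolding linfty_iff by blast
qed

lemma (in normed_space) normed_space_linfty: "normed_space K (linfty K)"
proof (rule normed_spaceI[OF normed_space_axioms], goal_cases)
  case 1
  show ?case
  proof (rule abelian_groupI, goal_cases)
    case (1 x y)
    then obtain b c where "\<And>n. cmod (x n) \<le> b" "\<And>n. cmod (y n) \<le> c"
      unfolding linfty_iff by blast
    then have "cmod (x n + y n) \<le> b + c" for n by (meson norm_triangle_mono)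
    with 1 show ?case unfolding linfty_iff by auto
  next
    case (6 x)
    show ?case using linfty_scaleI[OF _ 6, of "-1"] by (intro bexI[of _ "\<lambda>n. - 1 * x n"]) auto
  qed (auto simp: linfty_iff algebra_simps intro!: exI[of _ 0])
next
  case (2 a x)
  then show ?case by (simp add: linfty_scaleI)
next
  case (7 x)
  have "cmod (x n) \<le> 0" for n using cmod_le_nrm_linfty[OF 7(1), of n] 7(2) by linarith
  then show ?case by auto
next
  case (8 a x)
  have le: "nrm (linfty K) (\<lambda>n. a * x n) \<le> cmod a * nrm (linfty K) x"
    if "x \<in> carrier (linfty K)" for a x
    by (rule nrm_linfty_le) (use that in \<open>auto simp: norm_mult intro!: mult_left_mono cmod_le_nrm_linfty\<close>)
  have sm: "(\<lambda>n. a * x n) \<in> carrier (linfty K)"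
    using 8 by (rule linfty_scaleI)
  show ?case
  proof (cases "a = 0")
    case True then show ?thesis by (simp add: linfty_def)
  next
    case False
    have "nrm (linfty K) x \<le> cmod (inverse a) * nrm (linfty K) (\<lambda>n. a * x n)"
      using le[OF sm, of "inverse a"] False by (simp add: mult.assoc[symmetric])
    then show ?thesis using le[OF 8(2), of a] False by (simp add: norm_divide field_simps)
  qed
next
  case (9 x y)
  then show ?case
    using norm_triangle_mono[OF cmod_le_nrm_linfty[OF 9(1)] cmod_le_nrm_linfty[OF 9(2)]]
    by (auto intro!: nrm_linfty_le)
qed (auto simp: algebra_simps)

section \<open>Separability and weak compactness\<close>

context normed_space
begin

text \<open>A Banach limit of \<open>h (z n)\<close>, as a functional of \<open>h\<close>, is represented by a point.\<close>

lemma reflexive_limit_point: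
  assumes refl: "reflexive_space K E"
    and z: "\<And>n. z n \<in> carrier E" "\<And>n. nrm E (z n) \<le> b"
  obtains y where "y \<in> carrier E" "\<And>h c. h \<in> dual K E \<Longrightarrow> (\<lambda>n. h (z n)) \<longlonglongrightarrow> c \<Longrightarrow> h y = c"
proof -
  interpret V: normed_space K "linfty K" by (rule normed_space_linfty)
  interpret D: normed_space K "dual_space K E" by (rule normed_space_dual)
  \<comment> \<open>An index is a convergent sequence with its limit. With \<open>Q = 0\<close> and
    \<open>C = 1\<close> the limit extends to a functional of norm at most 1 on all bounded
    sequences.\<close>
  define I where "I = {(x, c). x \<in> carrier (linfty K) \<and> x \<longlonglongrightarrow> c}"
  obtain \<Lambda> where \<Lambda>: "\<Lambda> \<in> dual K (linfty K)"
    "\<And>x. x \<in> carrier (linfty K) \<Longrightarrow> cmod (\<Lambda> x) \<le> 1 * nrm (linfty K) x"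
    "\<And>i. i \<in> I \<Longrightarrow> cmod (\<Lambda> (fst i) - snd i) \<le> 0"
  proof (rule V.hahn_banach[where I = I and L = fst and \<psi> = snd and Q = "\<lambda>_. 0" and C = 1])
    show "I \<noteq> {}" using V.M.zero_closed by (auto simp: I_def)
    show "snd i \<in> K" if "i \<in> I" for i
      using that Lim_in_closed_set[OF K_closed_set, of "fst i" sequentially]
      by (auto simp: I_def linfty_in_K)
    show "\<exists>k\<in>I. fst k = fst i \<oplus>\<^bsub>linfty K\<^esub> fst j \<and> snd k = snd i + snd j \<and> (0::real) \<le> 0 + 0"
      if "i \<in> I" "j \<in> I" for i j
      using that V.add_closed[of "fst i" "fst j"]
      by (intro bexI[of _ "(fst i \<oplus>\<^bsub>linfty K\<^esub> fst j, snd i + snd j)"]) (auto simp: I_def intro: tendsto_add)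
    show "\<exists>k\<in>I. fst k = a \<odot>\<^bsub>linfty K\<^esub> fst i \<and> snd k = a * snd i \<and> 0 \<le> cmod a * 0"
      if "a \<in> K" "i \<in> I" for a i
      using that V.smult_in_carrier[of a "fst i"]
      by (intro bexI[of _ "(a \<odot>\<^bsub>linfty K\<^esub> fst i, a * snd i)"]) (auto simp: I_def intro: tendsto_mult)
    show "cmod (snd i) \<le> 1 * nrm (linfty K) (fst i) + 0" if "i \<in> I" for i
      using that Lim_norm_ubound[of sequentially "fst i" "snd i" "nrm (linfty K) (fst i)"]
      by (auto simp: I_def cmod_le_nrm_linfty)
  qed (auto simp: I_def)
  have seq: "(\<lambda>n. h (z n)) \<in> carrier (linfty K)" "nrm (linfty K) (\<lambda>n. h (z n)) \<le> \<bar>b\<bar> * dnorm h"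
    if h: "h \<in> dual K E" for h
  proof -
    have le: "cmod (h (z n)) \<le> \<bar>b\<bar> * dnorm h" for n
    proof -
      have "nrm E (z n) \<le> \<bar>b\<bar>" using z(2)[of n] by linarith
      then show ?thesis
        using dual_le_dnorm[OF h z(1)[of n]] mult_left_mono[OF _ dnorm_nonneg[OF h]]
        by (fastforce simp: mult.commute intro: order.trans)
    qed
    show "(\<lambda>n. h (z n)) \<in> carrier (linfty K)"
      unfolding linfty_iff using h z(1) le by blast
    show "nrm (linfty K) (\<lambda>n. h (z n)) \<le> \<bar>b\<bar> * dnorm h" by (rule nrm_linfty_le[OF le])
  qed
  \<comment> \<open>Boundedness of \<open>z\<close> puts this into the bidual, where reflexivity
    turns it into evaluation at a point.\<close>
  let ?\<phi> = "\<lambda>h\<in>dual K E. \<Lambda> (\<lambda>n. h (z n))"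
  have "?\<phi> \<in> dual K (dual_space K E)"
  proof (rule D.dualI[where B = "\<bar>b\<bar>"])
    show "cmod (\<Lambda> (\<lambda>n. h (z n))) \<le> \<bar>b\<bar> * nrm (dual_space K E) h" if "h \<in> dual K E" for h
      using \<Lambda>(2)[OF seq(1)[OF that]] seq(2)[OF that] by simp
    show "\<Lambda> (\<lambda>n. (f \<oplus>\<^bsub>dual_space K E\<^esub> g) (z n)) = \<Lambda> (\<lambda>n. f (z n)) + \<Lambda> (\<lambda>n. g (z n))"
      if "f \<in> dual K E" "g \<in> dual K E" for f g
      using V.dual_add[OF \<Lambda>(1) seq(1) seq(1)] that z(1) by simp
    show "\<Lambda> (\<lambda>n. (a \<odot>\<^bsub>dual_space K E\<^esub> f) (z n)) = a * \<Lambda> (\<lambda>n. f (z n))"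
      if "a \<in> K" "f \<in> dual K E" for a f
      using V.dual_smult[OF \<Lambda>(1) _ seq(1)] that z(1) by simp
  qed (use V.dual_in_K[OF \<Lambda>(1) seq(1)] in auto)
  then obtain y where y: "y \<in> carrier E" "\<And>f. f \<in> dual K E \<Longrightarrow> ?\<phi> f = f y"
    using refl unfolding reflexive_space_iff by blast
  show ?thesis
  proof (rule that[OF y(1)])
    fix h c assume h: "h \<in> dual K E" "(\<lambda>n. h (z n)) \<longlonglongrightarrow> c"
    then have "\<Lambda> (\<lambda>n. h (z n)) = c" using \<Lambda>(3)[of "(\<lambda>n. h (z n), c)"] seq(1) by (simp add: I_def)
    with y(2)[OF h(1)] h(1) show "h y = c" by simp
  qed
qed

text \<open>A countable substitute for the span. The single operation
  \<open>d \<oplus> q \<odot> e\<close> covers sums (\<open>q = 1\<close>) and multiples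
  (\<open>d = \<zero>\<close>). The stages of the construction increase, so any two elements lie in
  a common stage.\<close>

lemma countable_combinations:
  assumes x: "\<And>n::nat. x n \<in> carrier E" and Q: "countable Q" "Q \<subseteq> K"
  obtains D where "countable D" "D \<subseteq> carrier E" "\<zero> \<in> D" "range x \<subseteq> D"
    "\<forall>q\<in>Q. \<forall>d\<in>D. \<forall>e\<in>D. d \<oplus> q \<odot> e \<in> D"
proof -
  define step where "step A = A \<union> (\<lambda>(q, d, e). d \<oplus> q \<odot> e) ` (Q \<times> A \<times> A)" for A
  define D where "D n = (step ^^ n) (insert \<zero> (range x))" for n
  have D_Suc: "D (Suc n) = step (D n)" for n by (simp add: D_def)
  have mono: "D m \<subseteq> D n" if "m \<le> n" for m n
    using that by (rule lift_Suc_mono_le[rotated]) (auto simp: D_Suc step_def)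
  have "countable (D n)" for n
    by (induction n) (use Q(1) in \<open>auto simp: D_Suc step_def D_def[of 0]\<close>)
  moreover have "D n \<subseteq> carrier E" for n
  proof (induction n)
    case 0 then show ?case using x by (auto simp: D_def)
  next
    case (Suc n) then show ?case using Q(2) by (force simp: D_Suc step_def subset_iff)
  qed
  moreover have "d \<oplus> q \<odot> e \<in> (\<Union>n. D n)"
    if q: "q \<in> Q" and de: "d \<in> (\<Union>n. D n)" "e \<in> (\<Union>n. D n)" for q d e
  proof -
    obtain m n where "d \<in> D m" "e \<in> D n" using de by blast
    then have "d \<in> D (max m n)" "e \<in> D (max m n)"
      using mono[of m "max m n"] mono[of n "max m n"] by auto
    then have "d \<oplus> q \<odot> e \<in> D (Suc (max m n))"
      using q by (force simp: D_Suc step_def)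
    then show ?thesis by blast
  qed
  moreover have "insert \<zero> (range x) \<subseteq> (\<Union>n. D n)"
    using UN_upper[of 0 UNIV D] by (simp add: D_def[of 0])
  ultimately show ?thesis by (intro that[of "\<Union>n. D n"]) auto
qed

text \<open>The closed linear span of a sequence, described by duality.\<close>

definition closed_span :: "(nat \<Rightarrow> 'a) \<Rightarrow> 'a set" where
  "closed_span x = {y \<in> carrier E. \<forall>f\<in>dual K E. (\<forall>n. f (x n) = 0) \<longrightarrow> f y = 0}"

text \<open>Take norming functionals of a countable set whose closure contains the closed span. If
  all of them vanish at \<open>y\<close>, then for \<open>d m\<close> close to \<open>y\<close> the
  norm of \<open>d m\<close> equals \<open>cmod (t m (d m \<ominus> y))\<close>, which is at most
  the distance from \<open>y\<close>; hence \<open>y\<close> is arbitrarily small.\<close>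

lemma separating_functionals:
  assumes x: "\<And>n. x n \<in> carrier E"
  obtains t :: "nat \<Rightarrow> 'a \<Rightarrow> complex" where "\<forall>m. t m \<in> dual K E"
    "\<forall>m. \<forall>y\<in>carrier E. cmod (t m y) \<le> nrm E y"
    "\<forall>y\<in>closed_span x. (\<forall>m. t m y = 0) \<longrightarrow> y = \<zero>"
proof -
  obtain Q0 where Q0: "countable Q0" "Q0 \<subseteq> K" "K \<subseteq> closure Q0"
    using separable by blast
  define Q where "Q = insert 1 Q0"
  have Q: "countable Q" "Q \<subseteq> K" using Q0 unfolding Q_def by auto
  obtain D where D: "countable D" "D \<subseteq> carrier E" "\<zero> \<in> D" "range x \<subseteq> D"
    and "\<forall>q\<in>Q. \<forall>d\<in>D. \<forall>e\<in>D. d \<oplus> q \<odot> e \<in> D"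
    by (rule countable_combinations[OF x Q])
  then have comb: "\<And>q d e. q \<in> Q \<Longrightarrow> d \<in> D \<Longrightarrow> e \<in> D \<Longrightarrow> d \<oplus> q \<odot> e \<in> D"
    by blast
  \<comment> \<open>\<open>D\<close> admits only scalars from the countable set \<open>Q\<close>;
    its norm closure \<open>S\<close> is a subspace over all of \<open>K\<close>, as the Hahn-Banach
    theorem requires.\<close>
  define S where "S = {z \<in> carrier E. \<forall>e>0. \<exists>d\<in>D. nrm E (z \<ominus> d) < e}"
  have DS: "D \<subseteq> S" using D(2) by (force simp: S_def)
  have S_add: "z \<oplus> w \<in> S" if zw: "z \<in> S" "w \<in> S" for z w
    unfolding S_def
  proof (intro CollectI conjI allI impI)
    fix e :: real assume "e > 0"
    then have "e / 2 > 0" by simp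
    then obtain d d' where d: "d \<in> D" "nrm E (z \<ominus> d) < e / 2" "d' \<in> D" "nrm E (w \<ominus> d') < e / 2"
      using zw unfolding S_def by blast
    have c: "z \<in> carrier E" "w \<in> carrier E" "d \<in> carrier E" "d' \<in> carrier E"
      using zw d D unfolding S_def by auto
    have "d \<oplus> d' \<in> D" using comb[of 1 d d'] d c by (simp add: Q_def)
    moreover have "nrm E ((z \<oplus> w) \<ominus> (d \<oplus> d')) < e"
      using nrm_triangle[of "z \<ominus> d" "w \<ominus> d'"] d c by (simp add: add_diff_add)
    ultimately show "\<exists>d\<in>D. nrm E ((z \<oplus> w) \<ominus> d) < e" by blast
  qed (use zw in \<open>auto simp: S_def\<close>)
  have S_smult: "a \<odot> z \<in> S" if a: "a \<in> K" and z: "z \<in> S" for a z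
    unfolding S_def
  proof (intro CollectI conjI allI impI)
    fix e :: real assume e: "e > 0"
    have zc: "z \<in> carrier E" using z by (simp add: S_def)
    \<comment> \<open>The \<open>+ 1\<close> here and in the choice of \<open>q\<close> below guards
      against division by zero.\<close>
    define \<eta> where "\<eta> = e / (2 * (cmod a + 1))"
    have "\<eta> > 0" using e by (simp add: \<eta>_def add_nonneg_pos)
    then obtain d where d: "d \<in> D" "nrm E (z \<ominus> d) < \<eta>" using z unfolding S_def by blast
    have dc: "d \<in> carrier E" using d D by auto
    have "e / (2 * (nrm E d + 1)) > 0" using e nrm_nonneg[OF dc] by (simp add: add_nonneg_pos)
    then obtain q where q: "q \<in> Q0" "cmod (q - a) < e / (2 * (nrm E d + 1))"
      using a Q0(3) by (metis closure_approachable dist_norm subsetD)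
    have qK: "q \<in> Q" "q \<in> K" using q Q0 by (auto simp: Q_def)
    have "q \<odot> d \<in> D" using comb[OF qK(1) D(3) d(1)] dc qK by simp
    moreover have "nrm E (a \<odot> z \<ominus> q \<odot> d) < e"
    proof -
      have "a \<odot> z \<ominus> a \<odot> d = a \<odot> (z \<ominus> d)" using a zc dc by (simp add: smult_diff_right)
      moreover have "a \<odot> d \<ominus> q \<odot> d = (a - q) \<odot> d"
        using a qK dc smult_add_left[of a "- q" d] by (simp add: diff_eq_smult smult_smult)
      ultimately have "nrm E (a \<odot> z \<ominus> q \<odot> d) \<le> cmod a * nrm E (z \<ominus> d) + cmod (q - a) * nrm E d"
        using nrm_diff_triangle[of "a \<odot> z" "a \<odot> d" "q \<odot> d"] a zc dc qK
        by (simp add: nrm_smult norm_minus_commute)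
      moreover have "cmod a * nrm E (z \<ominus> d) \<le> cmod a * \<eta>" using d by (intro mult_left_mono) auto
      moreover have "cmod a * \<eta> < e / 2"
      proof -
        have "cmod a / (cmod a + 1) < 1" by (simp add: divide_less_eq add_nonneg_pos)
        then have "e / 2 * (cmod a / (cmod a + 1)) < e / 2 * 1"
          using e by (intro mult_strict_left_mono) auto
        then show ?thesis by (simp add: \<eta>_def mult.commute)
      qed
      moreover have "cmod (q - a) * nrm E d \<le> e / (2 * (nrm E d + 1)) * nrm E d"
        using q nrm_nonneg[OF dc] by (intro mult_right_mono) auto
      moreover have "e / (2 * (nrm E d + 1)) * nrm E d \<le> e / 2"
        using e nrm_nonneg[OF dc] by (simp add: field_simps)
      ultimately show ?thesis by linarith
    qed
    ultimately show "\<exists>d\<in>D. nrm E (a \<odot> z \<ominus> d) < e" by blast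
  qed (use a z in \<open>auto simp: S_def\<close>)
  \<comment> \<open>A point at distance at least \<open>e\<close> from \<open>D\<close> would be
    separated from \<open>S\<close> by a functional that kills every \<open>x n\<close> but not
    \<open>y\<close>, against the definition of \<open>closed_span\<close>.\<close>
  have sep: "\<exists>d\<in>D. nrm E (y \<ominus> d) < e"
    if y: "y \<in> closed_span x" and e: "e > 0" for y e
  proof (rule ccontr)
    have yc: "y \<in> carrier E" using y by (simp add: closed_span_def)
    assume "\<not> (\<exists>d\<in>D. nrm E (y \<ominus> d) < e)"
    then have far: "e \<le> nrm E (y \<ominus> d)" if "d \<in> D" for d using that by force
    have farS: "e \<le> nrm E (y \<ominus> z)" if z: "z \<in> S" for z
    proof (rule field_le_epsilon)
      fix \<eta> :: real assume "\<eta> > 0"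
      then obtain d where d: "d \<in> D" "nrm E (z \<ominus> d) < \<eta>" using z unfolding S_def by blast
      with nrm_diff_triangle[of y z d] far[of d] yc z D(2) show "e \<le> nrm E (y \<ominus> z) + \<eta>"
        by (auto simp: S_def)
    qed
    have le: "cmod t \<le> 1 / e * nrm E (t \<odot> y \<oplus> z)" if t: "t \<in> K" and z: "z \<in> S" for t z
    proof (cases "t = 0")
      case True
      then show ?thesis using t z yc e nrm_nonneg[of z] by (auto simp: S_def)
    next
      case False
      have zc: "z \<in> carrier E" using z by (simp add: S_def)
      let ?w = "(- inverse t) \<odot> z"
      have "t \<odot> y \<oplus> z = t \<odot> (y \<ominus> ?w)"
        using False t zc yc by (simp add: diff_eq_smult smult_add_right smult_smult)
      then have "nrm E (t \<odot> y \<oplus> z) = cmod t * nrm E (y \<ominus> ?w)"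
        using t zc yc by (simp add: nrm_smult)
      moreover have "cmod t * e \<le> cmod t * nrm E (y \<ominus> ?w)"
        using farS[of ?w] S_smult[of "- inverse t" z] t z by (intro mult_left_mono) auto
      ultimately show ?thesis using e by (simp add: field_simps)
    qed
    \<comment> \<open>The pair \<open>(a, z)\<close> represents
      \<open>a \<odot> y \<oplus> z\<close> and prescribes the value \<open>a\<close>; the distance
      \<open>e\<close> of \<open>y\<close> from \<open>S\<close> accounts for the constant
      \<open>1 / e\<close>.\<close>
    obtain f where f: "f \<in> dual K E"
      "\<And>i. i \<in> K \<times> S \<Longrightarrow> cmod (f (fst i \<odot> y \<oplus> snd i) - fst i) \<le> 0"
    proof (rule hahn_banach[where I = "K \<times> S" and L = "\<lambda>i. fst i \<odot> y \<oplus> snd i" and \<psi> = fst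
          and Q = "\<lambda>_. 0" and C = "1 / e"])
      show "K \<times> S \<noteq> {}" using D(3) DS by auto
      show "\<exists>k\<in>K \<times> S. fst k \<odot> y \<oplus> snd k = (fst i \<odot> y \<oplus> snd i) \<oplus> (fst j \<odot> y \<oplus> snd j) \<and>
          fst k = fst i + fst j \<and> (0::real) \<le> 0 + 0" if "i \<in> K \<times> S" "j \<in> K \<times> S" for i j
        using that yc S_add
        by (intro bexI[of _ "(fst i + fst j, snd i \<oplus> snd j)"]) (auto simp: S_def smult_add_left M.a_ac)
      show "\<exists>k\<in>K \<times> S. fst k \<odot> y \<oplus> snd k = a \<odot> (fst i \<odot> y \<oplus> snd i) \<and>
          fst k = a * fst i \<and> 0 \<le> cmod a * 0" if "a \<in> K" "i \<in> K \<times> S" for a i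
        using that yc S_smult
        by (intro bexI[of _ "(a * fst i, a \<odot> snd i)"]) (auto simp: S_def smult_add_right smult_smult)
    qed (use e le yc in \<open>auto simp: S_def\<close>)
    have "f (x n) = 0" for n
    proof -
      have "x n \<in> S" using D(4) DS by blast
      then show ?thesis using f(2)[of "(0, x n)"] yc x by simp
    qed
    with y f(1) have "f y = 0" unfolding closed_span_def by blast
    moreover have "f y = 1" using f(2)[of "(1, \<zero>)"] D(3) DS yc by auto
    ultimately show False by simp
  qed
  define d where "d = from_nat_into D"
  have dD: "d m \<in> D" and dc: "d m \<in> carrier E" for m
    using D from_nat_into[of D] unfolding d_def by blast+
  have "\<forall>m. \<exists>f\<in>dual K E. (\<forall>y\<in>carrier E. cmod (f y) \<le> nrm E y) \<and> f (d m) = complex_of_real (nrm E (d m))"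
    using norming_functional[OF dc] by metis
  then obtain t where t: "\<And>m. t m \<in> dual K E" "\<And>m y. y \<in> carrier E \<Longrightarrow> cmod (t m y) \<le> nrm E y"
    "\<And>m. t m (d m) = complex_of_real (nrm E (d m))" by metis
  have "y = \<zero>" if y: "y \<in> closed_span x" and ty: "\<And>m. t m y = 0" for y
  proof -
    have yc: "y \<in> carrier E" using y by (simp add: closed_span_def)
    have "nrm E y \<le> 0 + e" if e: "e > 0" for e
    proof -
      have "\<exists>d\<in>D. nrm E (y \<ominus> d) < e / 2" by (rule sep) (use y e in auto)
      then obtain d' where d': "d' \<in> D" "nrm E (y \<ominus> d') < e / 2" by blast
      then obtain m where m: "d' = d m"
        unfolding d_def using D(1) from_nat_into_surj by metis
      have "nrm E (d m) = cmod (t m (d m \<ominus> y))"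
        using t(1,3)[of m] ty[of m] dc yc nrm_nonneg[OF dc] by (simp add: dual_diff)
      also have "\<dots> \<le> nrm E (y \<ominus> d m)" using t(2)[of "d m \<ominus> y" m] dc yc nrm_diff_swap by simp
      finally show ?thesis using nrm_le_diff[OF yc dc, of m] d' m by simp
    qed
    then have "nrm E y \<le> 0" by (rule field_le_epsilon)
    then show ?thesis using nrm_eq_0[OF yc] nrm_nonneg[OF yc] by simp
  qed
  with t(1,2) show ?thesis by (intro that[of t]) auto
qed

text \<open>Compactness of a product of discs gives a subsequence along which every
  \<open>t m\<close> converges. Its limit point \<open>y\<close> is the weak limit: if some
  \<open>f\<close> stayed away from \<open>f y\<close>, a further subsequence would have a limit
  point \<open>y'\<close> with \<open>f y' \<noteq> f y\<close> but with the same values under all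
  \<open>t m\<close>. The difference \<open>y \<ominus> y'\<close> lies in the closed span, so it
  would vanish.\<close>

lemma reflexive_weakly_compact:
  assumes refl: "reflexive_space K E"
    and x: "\<And>n. x n \<in> carrier E" "\<And>n. nrm E (x n) \<le> b"
  obtains r y where "strict_mono (r :: nat \<Rightarrow> nat)" "y \<in> carrier E" "weakly_tendsto K E (x \<circ> r) y"
proof -
  obtain t :: "nat \<Rightarrow> 'a \<Rightarrow> complex" where t_all: "\<forall>m. t m \<in> dual K E"
    "\<forall>m. \<forall>y\<in>carrier E. cmod (t m y) \<le> nrm E y"
    and sep: "\<forall>y\<in>closed_span x. (\<forall>m. t m y = 0) \<longrightarrow> y = \<zero>"
    by (rule separating_functionals[OF x(1)])
  then have t: "\<And>m. t m \<in> dual K E" "\<And>m y. y \<in> carrier E \<Longrightarrow> cmod (t m y) \<le> nrm E y"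
    by blast+
  define X where "X n = (\<lambda>m. t m (x n))" for n
  have "compact (PiE UNIV (\<lambda>m::nat. cball (0::complex) b))"
    using compactin_PiE[of "\<lambda>m::nat. euclidean :: complex topology" UNIV "\<lambda>m. cball 0 b"]
    by (simp add: euclidean_product_topology)
  moreover have "\<forall>n. X n \<in> PiE UNIV (\<lambda>m. cball 0 b)"
    using order.trans[OF t(2)[OF x(1)] x(2)] by (auto simp: X_def)
  ultimately obtain l r where r: "strict_mono r" "(X \<circ> r) \<longlonglongrightarrow> l"
    by (metis compact_imp_seq_compact seq_compactE)
  have conv: "(\<lambda>n. t m (x (r n))) \<longlonglongrightarrow> l m" for m
    using continuous_on_tendsto_compose[OF continuous_on_product_coordinates r(2), of m]
    by (simp add: X_def o_def)
  obtain y where y: "y \<in> carrier E" "\<And>h c. h \<in> dual K E \<Longrightarrow> (\<lambda>n. h ((x \<circ> r) n)) \<longlonglongrightarrow> c \<Longrightarrow> h y = c"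
    using reflexive_limit_point[OF refl, of "x \<circ> r" b] x by auto
  have "(\<lambda>n. f ((x \<circ> r) n)) \<longlonglongrightarrow> f y" if f: "f \<in> dual K E" for f
  proof (rule ccontr)
    assume "\<not> (\<lambda>n. f ((x \<circ> r) n)) \<longlonglongrightarrow> f y"
    then obtain e where e: "e > 0" "\<And>N. \<exists>n\<ge>N. dist (f ((x \<circ> r) n)) (f y) \<ge> e"
      unfolding lim_sequentially by (metis not_le)
    then have "infinite {n. dist (f ((x \<circ> r) n)) (f y) \<ge> e}"
      unfolding infinite_nat_iff_unbounded_le by auto
    from infinite_enumerate[OF this] obtain s :: "nat \<Rightarrow> nat"
      where s: "strict_mono s" "\<forall>n. dist (f ((x \<circ> r) (s n))) (f y) \<ge> e"
      by auto
    have "bounded (range (\<lambda>n. f (x (r (s n)))))"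
    proof (rule boundedI)
      fix w assume "w \<in> range (\<lambda>n. f (x (r (s n))))"
      then obtain n where "w = f (x (r (s n)))" by blast
      then show "norm w \<le> dnorm f * b"
        using dual_le_dnorm[OF f x(1)[of "r (s n)"]] mult_left_mono[OF x(2)[of "r (s n)"] dnorm_nonneg[OF f]]
        by simp
    qed
    then obtain c s' where s': "strict_mono s'" "((\<lambda>n. f (x (r (s n)))) \<circ> s') \<longlonglongrightarrow> c"
      using bounded_imp_convergent_subsequence by blast
    obtain y' where y': "y' \<in> carrier E"
      "\<And>h c. h \<in> dual K E \<Longrightarrow> (\<lambda>n. h ((x \<circ> r \<circ> s \<circ> s') n)) \<longlonglongrightarrow> c \<Longrightarrow> h y' = c"
      using reflexive_limit_point[OF refl, of "x \<circ> r \<circ> s \<circ> s'" b] x by auto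
    have "y \<ominus> y' = \<zero>"
    proof (rule sep[rule_format])
      \<comment> \<open>A functional that vanishes on all \<open>x n\<close> vanishes at both limit
        points.\<close>
      have "g (y \<ominus> y') = 0" if "g \<in> dual K E" "\<And>n. g (x n) = 0" for g
        using y(2)[OF that(1), of 0] y'(2)[OF that(1), of 0] that y(1) y'(1) by (simp add: dual_diff)
      then show "y \<ominus> y' \<in> closed_span x" using y(1) y'(1) by (auto simp: closed_span_def)
      show "t m (y \<ominus> y') = 0" for m
      proof -
        have "(\<lambda>n. t m (x (r (s (s' n))))) \<longlonglongrightarrow> l m"
          using LIMSEQ_subseq_LIMSEQ[OF conv strict_mono_o[OF s(1) s'(1)], of m] by (simp add: o_def)
        then show ?thesis
          using y(2)[OF t(1), of m "l m"] y'(2)[OF t(1), of m "l m"] conv[of m] t(1) y(1) y'(1)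
          by (simp add: dual_diff)
      qed
    qed
    then have "y = y'" using y y' diff_eq_zero_iff by simp
    moreover have "f y' = c" using y'(2)[OF f] s'(2) by (simp add: o_def)
    moreover have "e \<le> dist c (f y)"
    proof (rule Lim_bounded2)
      show "(\<lambda>n. dist (f (x (r (s (s' n))))) (f y)) \<longlonglongrightarrow> dist c (f y)"
        using s'(2) by (intro tendsto_intros) (simp add: o_def)
    qed (use s(2) in auto)
    ultimately show False using e(1) by simp
  qed
  with that[OF r(1) y(1)] show ?thesis unfolding weakly_tendsto_def by blast
qed

end

section \<open>The Schur property implies the weak maximizing property\<close>

lemma (in normed_pair) Schur_imp_attains_norm:
  assumes refl: "reflexive_space K E" and Schur: "Schur_property K F"
    and T: "bounded_operator K E F T" and max: "maximizing_sequence E F T x"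
  shows "attains_norm E F T"
proof -
  note Tc = op_closed[OF T]
  have x: "x n \<in> carrier E" "nrm E (x n) = 1" for n
    using max by (auto simp: maximizing_sequence_def unit_sphere_def)
  have lim: "(\<lambda>n. nrm F (T (x n))) \<longlonglongrightarrow> operator_norm E F T"
    using max by (simp add: maximizing_sequence_def)
  obtain r y where r: "strict_mono (r :: nat \<Rightarrow> nat)" and y: "y \<in> carrier E"
    and weak: "\<And>f. f \<in> dual K E \<Longrightarrow> (\<lambda>n. f (x (r n))) \<longlonglongrightarrow> f y"
    using E.reflexive_weakly_compact[OF refl, of x 1] x
    unfolding weakly_tendsto_def o_def by (metis order_refl)
  have y1: "nrm E y \<le> 1"
  proof (rule E.nrm_leI[OF y])
    fix f assume f: "f \<in> dual K E" "\<And>z. z \<in> carrier E \<Longrightarrow> cmod (f z) \<le> nrm E z"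
    show "cmod (f y) \<le> 1"
      using Lim_norm_ubound[OF _ weak[OF f(1)], of 1] f(2)[OF x(1)] x(2) by simp
  qed
  have comp: "(\<lambda>z\<in>carrier E. g (T z)) \<in> dual K E" if g: "g \<in> dual K F" for g
  proof (rule E.dualI[where B = "F.dnorm g * operator_norm E F T"])
    show "cmod (g (T z)) \<le> F.dnorm g * operator_norm E F T * nrm E z" if z: "z \<in> carrier E" for z
      using F.dual_le_dnorm[OF g Tc[OF z]]
        mult_left_mono[OF op_le_operator_norm[OF T z] F.dnorm_nonneg[OF g]] by (simp add: mult.assoc)
  qed (use g in \<open>auto simp: op_add[OF T] op_smult[OF T] Tc F.dual_add F.dual_smult\<close>)
  have weakT: "(\<lambda>n. g (T (x (r n)))) \<longlonglongrightarrow> g (T y)" if g: "g \<in> dual K F" for g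
    using weak[OF comp[OF g]] x(1) y by simp
  then have "weakly_tendsto K F (\<lambda>n. T (x (r n))) (T y)" unfolding weakly_tendsto_def by blast
  then obtain l where l: "l \<in> carrier F" "(\<lambda>n. nrm F (T (x (r n)) \<ominus>\<^bsub>F\<^esub> l)) \<longlonglongrightarrow> 0"
    using Schur[unfolded Schur_property_def, rule_format, of "\<lambda>n. T (x (r n))"] Tc x(1) y by blast
  \<comment> \<open>The Schur property supplies some norm limit \<open>l\<close>; it is also a weak
    limit, and functionals separate points.\<close>
  have "l = T y"
  proof (rule F.dual_separates)
    fix g assume g: "g \<in> dual K F"
    have "(\<lambda>n. g (T (x (r n))) - g l) \<longlonglongrightarrow> 0"
    proof (rule Lim_null_comparison)
      show "(\<lambda>n. F.dnorm g * nrm F (T (x (r n)) \<ominus>\<^bsub>F\<^esub> l)) \<longlonglongrightarrow> 0"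
        using tendsto_mult_right_zero[OF l(2)] .
      have "norm (g (T (x (r n))) - g l) \<le> F.dnorm g * nrm F (T (x (r n)) \<ominus>\<^bsub>F\<^esub> l)" for n
        using F.dual_le_dnorm[OF g, of "T (x (r n)) \<ominus>\<^bsub>F\<^esub> l"] g Tc[OF x(1)] l(1) by (simp add: F.dual_diff)
      then show "\<forall>\<^sub>F n in sequentially. norm (g (T (x (r n))) - g l) \<le> F.dnorm g * nrm F (T (x (r n)) \<ominus>\<^bsub>F\<^esub> l)"
        by simp
    qed
    then show "g l = g (T y)"
      using LIMSEQ_unique[OF weakT[OF g]] LIM_zero_cancel by metis
  qed (use l y Tc in auto)
  have "(\<lambda>n. nrm F (T (x (r n))) - nrm F (T y)) \<longlonglongrightarrow> 0"
    by (rule Lim_null_comparison[OF _ l(2)])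
      (use \<open>l = T y\<close> F.abs_nrm_diff_le Tc x(1) y in auto)
  then have "nrm F (T y) = operator_norm E F T"
    using LIMSEQ_unique[OF LIMSEQ_subseq_LIMSEQ[OF lim r]] LIM_zero_cancel unfolding o_def by metis
  \<comment> \<open>The weak limit is only known to lie in the unit ball. A positive operator norm
    forces it onto the sphere; if the operator norm is 0, every unit vector attains it, in
    particular \<open>x 0\<close>.\<close>
  moreover have "nrm E y = 1" if "operator_norm E F T > 0"
  proof -
    have "operator_norm E F T * 1 \<le> operator_norm E F T * nrm E y"
      using op_le_operator_norm[OF T y] calculation by simp
    then show ?thesis using that y1 by simp
  qed
  moreover have "nrm F (T (x 0)) = 0" if "operator_norm E F T = 0"
    using op_le_operator_norm[OF T x(1)[of 0]] F.nrm_nonneg[OF Tc[OF x(1)[of 0]]] that by simp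
  ultimately show ?thesis
    using operator_norm_nonneg[OF T] x y unfolding attains_norm_def unit_sphere_def
    by (metis (mono_tags, lifting) less_eq_real_def mem_Collect_eq)
qed

section \<open>Seminorms given by families of functionals\<close>

text \<open>Minkowski's inequality for series, obtained by bounding partial sums through its finite
  form. It is stated for a sequence \<open>c\<close> merely dominated by \<open>a + b\<close>,
  because gauges are subadditive and not additive.\<close>

lemma l2_triangle:
  fixes a b c :: "nat \<Rightarrow> real"
  assumes a: "summable (\<lambda>k. (a k)\<^sup>2)" and b: "summable (\<lambda>k. (b k)\<^sup>2)"
    and c: "\<And>k. 0 \<le> c k" "\<And>k. c k \<le> a k + b k" and nonneg: "\<And>k. 0 \<le> a k" "\<And>k. 0 \<le> b k"
  shows "summable (\<lambda>k. (c k)\<^sup>2)" "sqrt (\<Sum>k. (c k)\<^sup>2) \<le> sqrt (\<Sum>k. (a k)\<^sup>2) + sqrt (\<Sum>k. (b k)\<^sup>2)"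
proof -
  define r where "r = sqrt (\<Sum>k. (a k)\<^sup>2) + sqrt (\<Sum>k. (b k)\<^sup>2)"
  have r: "r \<ge> 0" using suminf_nonneg[OF a] suminf_nonneg[OF b] by (simp add: r_def)
  have part: "(\<Sum>k<m. (c k)\<^sup>2) \<le> r\<^sup>2" for m
  proof -
    have "L2_set c {..<m} \<le> L2_set (\<lambda>k. a k + b k) {..<m}"
      by (rule L2_set_mono) (use c in auto)
    also have "\<dots> \<le> L2_set a {..<m} + L2_set b {..<m}" by (rule L2_set_triangle_ineq)
    also have "\<dots> \<le> r"
      unfolding r_def L2_set_def
      by (intro add_mono real_sqrt_le_mono sum_le_suminf a b) auto
    finally have "(L2_set c {..<m})\<^sup>2 \<le> r\<^sup>2" by (intro power_mono) (auto simp: L2_set_nonneg)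
    then show ?thesis by (simp add: L2_set_def sum_nonneg)
  qed
  show sc: "summable (\<lambda>k. (c k)\<^sup>2)"
    by (rule bounded_imp_summable[where B = "r\<^sup>2"]) (use part[of "Suc n" for n] in \<open>auto simp: lessThan_Suc_atMost\<close>)
  have "(\<Sum>k. (c k)\<^sup>2) \<le> r\<^sup>2" by (rule suminf_le_const[OF sc part])
  then have "sqrt (\<Sum>k. (c k)\<^sup>2) \<le> sqrt (r\<^sup>2)" by (rule real_sqrt_le_mono)
  with r show "sqrt (\<Sum>k. (c k)\<^sup>2) \<le> sqrt (\<Sum>k. (a k)\<^sup>2) + sqrt (\<Sum>k. (b k)\<^sup>2)"
    by (simp add: r_def)
qed

definition sup_seminorm :: "('a \<Rightarrow> complex) set \<Rightarrow> 'a \<Rightarrow> real" where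
  "sup_seminorm D y = (SUP f\<in>D. cmod (f y))"

context normed_space
begin

lemma diff_diff_cancel:
  assumes "x \<in> carrier E" "y \<in> carrier E" "z \<in> carrier E"
  shows "(x \<ominus> y) \<ominus> (x \<ominus> z) = z \<ominus> y"
proof -
  have "x \<ominus> y = (z \<ominus> y) \<oplus> (x \<ominus> z)"
    using assms diff_add_diff[of x z y] by (simp add: M.a_comm)
  then show ?thesis using assms by (simp add: a_minus_def M.a_assoc M.r_neg)
qed

text \<open>Nonemptiness and the common bound are what make \<open>sup_seminorm D\<close> a genuine
  supremum of real numbers.\<close>

definition equicontinuous :: "real \<Rightarrow> ('a \<Rightarrow> complex) set \<Rightarrow> bool" where
  "equicontinuous C D \<longleftrightarrow> D \<noteq> {} \<and> D \<subseteq> dual K E \<and> (\<forall>f\<in>D. \<forall>x\<in>carrier E. cmod (f x) \<le> C * nrm E x)"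

context
  fixes C D assumes D: "equicontinuous C D"
begin

lemma sup_seminorm_upper: "x \<in> carrier E \<Longrightarrow> f \<in> D \<Longrightarrow> cmod (f x) \<le> sup_seminorm D x"
  using D unfolding sup_seminorm_def equicontinuous_def
  by (intro cSUP_upper bdd_aboveI2[of _ _ "C * nrm E x"]) auto

lemma sup_seminorm_least: "(\<And>f. f \<in> D \<Longrightarrow> cmod (f x) \<le> b) \<Longrightarrow> sup_seminorm D x \<le> b"
  using D unfolding sup_seminorm_def equicontinuous_def by (intro cSUP_least) auto

lemma sup_seminorm_le: "x \<in> carrier E \<Longrightarrow> sup_seminorm D x \<le> C * nrm E x"
  using D unfolding equicontinuous_def by (intro sup_seminorm_least) auto

lemma sup_seminorm_nonneg: 
  assumes "x \<in> carrier E" shows "0 \<le> sup_seminorm D x"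
proof -
  obtain f where "f \<in> D" using D unfolding equicontinuous_def by blast
  then show ?thesis using sup_seminorm_upper[OF assms] norm_ge_zero order.trans by blast
qed

lemma sup_seminorm_add:
  assumes "x \<in> carrier E" "y \<in> carrier E"
  shows "sup_seminorm D (x \<oplus> y) \<le> sup_seminorm D x + sup_seminorm D y"
proof (rule sup_seminorm_least)
  fix f assume f: "f \<in> D"
  then have "f (x \<oplus> y) = f x + f y" using D assms unfolding equicontinuous_def by (blast intro: dual_add)
  then show "cmod (f (x \<oplus> y)) \<le> sup_seminorm D x + sup_seminorm D y"
    using norm_triangle_mono[OF sup_seminorm_upper[OF _ f] sup_seminorm_upper[OF _ f]] assms by simp
qed

lemma sup_seminorm_smult:
  assumes "a \<in> K" "x \<in> carrier E"
  shows "sup_seminorm D (a \<odot> x) = cmod a * sup_seminorm D x"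
proof -
  have le: "sup_seminorm D (b \<odot> y) \<le> cmod b * sup_seminorm D y" if "b \<in> K" "y \<in> carrier E" for b y
  proof (rule sup_seminorm_least)
    fix f assume f: "f \<in> D"
    then have "f (b \<odot> y) = b * f y" using D that unfolding equicontinuous_def by (blast intro: dual_smult)
    then show "cmod (f (b \<odot> y)) \<le> cmod b * sup_seminorm D y"
      using sup_seminorm_upper[OF that(2) f] by (simp add: norm_mult mult_left_mono)
  qed
  show ?thesis
  proof (cases "a = 0")
    case True
    then show ?thesis using le[of 0 x] sup_seminorm_nonneg[of "0 \<odot> x"] assms by simp
  next
    case False
    have "sup_seminorm D x \<le> cmod (inverse a) * sup_seminorm D (a \<odot> x)"
      using le[of "inverse a" "a \<odot> x"] assms False by (simp add: smult_smult)
    then show ?thesis using le[OF assms] False by (simp add: norm_divide field_simps)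
  qed
qed

lemma sup_seminorm_le_diff:
  "x \<in> carrier E \<Longrightarrow> y \<in> carrier E \<Longrightarrow> sup_seminorm D x \<le> sup_seminorm D (x \<ominus> y) + sup_seminorm D y"
  using sup_seminorm_add[of "x \<ominus> y" y] by (simp add: diff_add_cancel)

lemma sup_seminorm_tendsto:
  assumes x: "\<And>n. x n \<in> carrier E" and l: "l \<in> carrier E" and lim: "(\<lambda>n. nrm E (x n \<ominus> l)) \<longlonglongrightarrow> 0"
  shows "(\<lambda>n. sup_seminorm D (x n)) \<longlonglongrightarrow> sup_seminorm D l"
proof (rule LIM_zero_cancel, rule Lim_null_comparison)
  show "(\<lambda>n. C * nrm E (x n \<ominus> l)) \<longlonglongrightarrow> 0" by (rule tendsto_mult_right_zero[OF lim])
  have swap: "nrm E (l \<ominus> x n) = nrm E (x n \<ominus> l)" for n using nrm_diff_swap x l by blast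
  have "\<bar>sup_seminorm D (x n) - sup_seminorm D l\<bar> \<le> C * nrm E (x n \<ominus> l)" for n
    using sup_seminorm_le_diff[OF x l, of n] sup_seminorm_le_diff[OF l x, of n]
      sup_seminorm_le[of "x n \<ominus> l"] sup_seminorm_le[of "l \<ominus> x n"] x l by (auto simp: swap)
  then show "\<forall>\<^sub>F n in sequentially. norm (sup_seminorm D (x n) - sup_seminorm D l) \<le> C * nrm E (x n \<ominus> l)"
    by simp
qed

end
end

section \<open>The interpolation space of a weakly null sequence\<close>

locale weakly_null_sequence = banach_space K F
  for K and F :: "'a normed_module" (structure) +
  fixes u :: "nat \<Rightarrow> 'a" and t :: "nat \<Rightarrow> 'a \<Rightarrow> complex"
  assumes u_closed: "u n \<in> carrier F" and nrm_u: "nrm F (u n) = 1"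
    and weakly_null: "f \<in> dual K F \<Longrightarrow> (\<lambda>n. f (u n)) \<longlonglongrightarrow> 0"
    and t_dual: "t m \<in> dual K F" and t_le: "x \<in> carrier F \<Longrightarrow> cmod (t m x) \<le> nrm F x"
    and t_separates: "y \<in> closed_span u \<Longrightarrow> (\<And>m. t m y = 0) \<Longrightarrow> y = \<zero>"
begin

text \<open>The exponent starts at 1 so that the squares of \<open>1 / wt k\<close> sum to at most
  1, which gives \<open>l2_norm (u n) \<le> 1\<close>. Starting at 0 the same sum would be 4/3, and
  \<open>N (u n)\<close> might fail to tend to 1.\<close>

definition wt :: "nat \<Rightarrow> real" where "wt k = 2 ^ Suc k"

lemma wt_pos [simp]: "wt k > 0" by (simp add: wt_def)

lemma wt_nonzero [simp]: "wt k \<noteq> 0" by (simp add: wt_def)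

lemma wt_ge_1: "wt k \<ge> 1" unfolding wt_def by (rule one_le_power) simp

text \<open>
  Up to the shift of \<open>k\<close> this is the polar of \<open>2\<^sup>k W \<union> 2\<^sup>-\<^sup>k B\<close>, where \<open>W\<close> is the absolutely convex
  hull of the sequence and \<open>B\<close> the unit ball of \<open>F\<close>.
\<close>

definition polar :: "nat \<Rightarrow> ('a \<Rightarrow> complex) set" where
  "polar k = {f \<in> dual K F. (\<forall>x\<in>carrier F. cmod (f x) \<le> wt k * nrm F x) \<and> (\<forall>n. cmod (f (u n)) \<le> 1 / wt k)}"

text \<open>By the bipolar theorem this is, within a factor 2, the Minkowski gauge of the sum
  \<open>wt k W + B / wt k\<close> used in the classical interpolation. As a supremum over an
  equicontinuous set it is a continuous seminorm at once.\<close>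

abbreviation gauge :: "nat \<Rightarrow> 'a \<Rightarrow> real" where "gauge k \<equiv> sup_seminorm (polar k)"

lemma equicontinuous_polar: "equicontinuous (wt k) (polar k)"
proof -
  have "(\<lambda>x\<in>carrier F. 0) \<in> polar k"
    using dual_zeroI nrm_nonneg u_closed by (auto simp: polar_def less_imp_le intro!: mult_nonneg_nonneg)
  then show ?thesis unfolding equicontinuous_def polar_def by blast
qed

lemmas gauge_upper = sup_seminorm_upper[OF equicontinuous_polar]
  and gauge_least = sup_seminorm_least[OF equicontinuous_polar]
  and gauge_le = sup_seminorm_le[OF equicontinuous_polar]
  and gauge_nonneg = sup_seminorm_nonneg[OF equicontinuous_polar]
  and gauge_add = sup_seminorm_add[OF equicontinuous_polar]
  and gauge_smult = sup_seminorm_smult[OF equicontinuous_polar]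
  and gauge_tendsto = sup_seminorm_tendsto[OF equicontinuous_polar]

text \<open>The factor is chosen so that \<open>f\<close> divided by it meets both bounds defining
  \<open>polar k\<close>. All lower bounds on gauges come from here: small values of
  \<open>f\<close> on \<open>u\<close> are paid with the large weight, its norm with the small
  one.\<close>

lemma functional_le_gauge:
  assumes f: "f \<in> dual K F" and y: "y \<in> carrier F"
    and \<alpha>: "\<And>n. cmod (f (u n)) \<le> \<alpha>" and \<beta>: "\<And>x. x \<in> carrier F \<Longrightarrow> cmod (f x) \<le> \<beta> * nrm F x"
  shows "cmod (f y) \<le> (wt k * \<alpha> + \<beta> / wt k) * gauge k y"
proof -
  define c where "c = wt k * \<alpha> + \<beta> / wt k"
  have \<alpha>0: "\<alpha> \<ge> 0" using \<alpha>[of 0] norm_ge_zero order.trans by blast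
  have \<beta>0: "\<beta> \<ge> 0" using order.trans[OF norm_ge_zero \<beta>[OF u_closed[of 0]]] by (simp add: nrm_u)
  show ?thesis
  proof (cases "c = 0")
    case True
    then have "\<beta> / wt k = 0" using \<alpha>0 \<beta>0 wt_pos[of k]
      by (metis add_nonneg_eq_0_iff c_def divide_nonneg_pos less_imp_le mult_nonneg_nonneg)
    then have "\<beta> = 0" by simp
    then show ?thesis using \<beta>[OF y] \<alpha>0 wt_pos[of k] gauge_nonneg[OF y] by (simp add: less_imp_le)
  next
    case False
    then have c: "c > 0" using \<alpha>0 \<beta>0 wt_pos[of k] by (simp add: c_def less_le)
    define g where "g = (\<lambda>x\<in>carrier F. complex_of_real (1 / c) * f x)"
    have g: "cmod (g x) = cmod (f x) / c" if "x \<in> carrier F" for x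
      using that c by (simp add: g_def norm_mult norm_divide)
    have "wt k * c = wt k * wt k * \<alpha> + \<beta>"
      using wt_pos[of k] by (simp add: c_def distrib_left)
    then have "\<beta> \<le> wt k * c" using \<alpha>0 wt_pos[of k] by simp
    then have "\<beta> / c \<le> wt k" using c by (simp add: pos_divide_le_eq)
    have 1: "cmod (g x) \<le> wt k * nrm F x" if x: "x \<in> carrier F" for x
    proof -
      have "cmod (g x) \<le> \<beta> / c * nrm F x" using \<beta>[OF x] c by (simp add: g[OF x] divide_right_mono)
      also have "\<dots> \<le> wt k * nrm F x" using \<open>\<beta> / c \<le> wt k\<close> nrm_nonneg[OF x] by (rule mult_right_mono)
      finally show ?thesis .
    qed
    have 2: "cmod (g (u n)) \<le> 1 / wt k" for n
    proof -
      have "cmod (g (u n)) \<le> \<alpha> / c" using \<alpha>[of n] c by (simp add: g[OF u_closed] divide_right_mono)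
      also have "wt k * \<alpha> \<le> c" using \<beta>0 wt_pos[of k] by (simp add: c_def less_imp_le)
      then have "\<alpha> / c \<le> 1 / wt k" using c wt_pos[of k] by (simp add: field_simps)
      finally show ?thesis .
    qed
    have "g \<in> dual K F" unfolding g_def by (rule dual_scaleI[OF f]) auto
    with 1 2 have "g \<in> polar k" by (simp add: polar_def)
    then have "cmod (f y) / c \<le> gauge k y" using gauge_upper[OF y] g[OF y] by metis
    then have "cmod (f y) \<le> c * gauge k y" using c by (simp add: pos_divide_le_eq mult.commute)
    then show ?thesis unfolding c_def .
  qed
qed

lemma gauge_u: "gauge k (u n) \<le> 1 / wt k"
  by (rule gauge_least) (simp add: polar_def)

text \<open>A functional of norm at most 1 has modulus at most 1 on the unit vectors
  \<open>u n\<close>, so \<open>\<alpha> = \<beta> = 1\<close> is admissible;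
  \<open>wt k \<ge> 1\<close> absorbs \<open>1 / wt k\<close>.\<close>

lemma nrm_le_gauge: 
  assumes y: "y \<in> carrier F" shows "nrm F y \<le> 2 * wt k * gauge k y"
proof (rule nrm_leI[OF y])
  fix f assume f: "f \<in> dual K F" "\<And>y. y \<in> carrier F \<Longrightarrow> cmod (f y) \<le> nrm F y"
  have "cmod (f y) \<le> (wt k * 1 + 1 / wt k) * gauge k y"
    by (rule functional_le_gauge[OF f(1) y]) (use f(2)[OF u_closed] nrm_u f(2) in auto)
  also have "\<dots> \<le> 2 * wt k * gauge k y"
  proof -
    have "1 / wt k \<le> wt k" using wt_ge_1[of k] by (simp add: divide_le_eq mult_ge1_I order.trans)
    then show ?thesis using gauge_nonneg[OF y] by (intro mult_right_mono) auto
  qed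
  finally show "cmod (f y) \<le> 2 * wt k * gauge k y" .
qed

section \<open>The interpolation space and its norm\<close>

definition interp :: "'a set" where
  "interp = {y \<in> carrier F. summable (\<lambda>k. (gauge k y)\<^sup>2)}"

definition l2_norm :: "'a \<Rightarrow> real" where
  "l2_norm y = sqrt (\<Sum>k. (gauge k y)\<^sup>2)"

lemma interp_closed: "y \<in> interp \<Longrightarrow> y \<in> carrier F"
  by (simp add: interp_def)

lemma l2_norm_nonneg: "y \<in> interp \<Longrightarrow> 0 \<le> l2_norm y"
  by (simp add: l2_norm_def interp_def suminf_nonneg)

lemma sum_gauge_le: "y \<in> interp \<Longrightarrow> (\<Sum>k<m. (gauge k y)\<^sup>2) \<le> (l2_norm y)\<^sup>2"
  by (simp add: l2_norm_def interp_def suminf_nonneg sum_le_suminf)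

text \<open>Each bound on a partial sum involves finitely many gauges and therefore passes to limits
  in \<open>F\<close>. Membership in the space is established in this way for completeness and for
  reflexivity.\<close>

lemma interpI:
  assumes y: "y \<in> carrier F" and b: "\<And>m. (\<Sum>k<m. (gauge k y)\<^sup>2) \<le> b\<^sup>2" "0 \<le> b"
  shows "y \<in> interp" "l2_norm y \<le> b"
proof -
  have s: "summable (\<lambda>k. (gauge k y)\<^sup>2)"
    by (rule bounded_imp_summable[where B = "b\<^sup>2"]) (use b(1)[of "Suc n" for n] in \<open>auto simp: lessThan_Suc_atMost\<close>)
  then show "y \<in> interp" using y by (simp add: interp_def)
  have "(\<Sum>k. (gauge k y)\<^sup>2) \<le> b\<^sup>2" by (rule suminf_le_const[OF s b(1)])
  then show "l2_norm y \<le> b" unfolding l2_norm_def using b(2) by (simp add: real_le_lsqrt)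
qed

lemma gauge_le_l2_norm:
  assumes y: "y \<in> interp" shows "gauge k y \<le> l2_norm y"
proof -
  have "(gauge k y)\<^sup>2 \<le> (\<Sum>j<Suc k. (gauge j y)\<^sup>2)" by (simp add: sum_nonneg)
  with sum_gauge_le[OF y, of "Suc k"] have "(gauge k y)\<^sup>2 \<le> (l2_norm y)\<^sup>2" by linarith
  then show ?thesis using l2_norm_nonneg[OF y] by (rule power2_le_imp_le)
qed

lemma nrm_le_l2_norm: "y \<in> interp \<Longrightarrow> nrm F y \<le> 4 * l2_norm y"
  using nrm_le_gauge[OF interp_closed, of y 0] gauge_le_l2_norm[of y 0] by (simp add: wt_def)

lemma interp_add:
  assumes "x \<in> interp" "y \<in> interp"
  shows "x \<oplus> y \<in> interp" "l2_norm (x \<oplus> y) \<le> l2_norm x + l2_norm y"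
proof -
  have "summable (\<lambda>k. (gauge k x)\<^sup>2)" "summable (\<lambda>k. (gauge k y)\<^sup>2)" "x \<in> carrier F" "y \<in> carrier F"
    using assms by (auto simp: interp_def)
  note l2_triangle[OF this(1,2), of "\<lambda>k. gauge k (x \<oplus> y)"]
  then show "x \<oplus> y \<in> interp" "l2_norm (x \<oplus> y) \<le> l2_norm x + l2_norm y"
    using assms unfolding l2_norm_def interp_def by (auto simp: gauge_nonneg gauge_add)
qed

lemma interp_smult:
  assumes "a \<in> K" "x \<in> interp"
  shows "a \<odot> x \<in> interp" "l2_norm (a \<odot> x) = cmod a * l2_norm x"
proof -
  have x: "summable (\<lambda>k. (gauge k x)\<^sup>2)" "x \<in> carrier F" using assms by (auto simp: interp_def)
  have eq: "(gauge k (a \<odot> x))\<^sup>2 = (cmod a)\<^sup>2 * (gauge k x)\<^sup>2" for k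
    using assms(1) x by (simp add: gauge_smult power_mult_distrib)
  show "a \<odot> x \<in> interp" using x assms(1) summable_mult[OF x(1)] by (simp add: interp_def eq)
  show "l2_norm (a \<odot> x) = cmod a * l2_norm x"
    using suminf_mult[OF x(1), of "(cmod a)\<^sup>2"] by (simp add: l2_norm_def eq real_sqrt_mult)
qed

lemma zero_in_interp: "\<zero> \<in> interp"
  by (rule interpI[where b = 0]) (use gauge_smult[of 0 \<zero>] in auto)

lemma interp_diff: "x \<in> interp \<Longrightarrow> y \<in> interp \<Longrightarrow> x \<ominus> y \<in> interp"
  using interp_add(1) interp_smult(1)[of "-1" y] by (simp add: diff_eq_smult interp_closed)

lemma u_in_interp: "u n \<in> interp" and l2_norm_u: "l2_norm (u n) \<le> 1"
proof -
  have "(\<Sum>k<m. (gauge k (u n))\<^sup>2) \<le> 1\<^sup>2" for m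
  proof -
    have "(gauge k (u n))\<^sup>2 \<le> (1/2) ^ Suc k" for k
    proof -
      have "(gauge k (u n))\<^sup>2 \<le> (1 / wt k)\<^sup>2"
        using gauge_u gauge_nonneg[OF u_closed] by (intro power_mono)
      also have "\<dots> = (1 / wt k) * (1 / wt k)" by (simp add: power2_eq_square)
      also have "\<dots> \<le> 1 / wt k" using wt_ge_1[of k] by (intro mult_left_le) auto
      also have "\<dots> = (1/2) ^ Suc k" by (simp add: wt_def power_divide)
      finally show ?thesis .
    qed
    then have "(\<Sum>k<m. (gauge k (u n))\<^sup>2) \<le> (\<Sum>k<m. (1/2) ^ Suc k)" by (rule sum_mono)
    also have "\<dots> = 1 - (1/2) ^ m" by (induction m) auto
    finally show ?thesis by (simp add: order.trans)
  qed
  from interpI[OF u_closed this] show "u n \<in> interp" "l2_norm (u n) \<le> 1" by auto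
qed

text \<open>For a functional vanishing on \<open>u\<close> one may take \<open>\<alpha> = 0\<close>
  in \<open>functional_le_gauge\<close>; what remains is of order \<open>1 / wt k\<close> and tends
  to 0. This makes the functionals \<open>t m\<close> separate the points of the space.\<close>

lemma interp_in_closed_span:
  assumes y: "y \<in> interp" shows "y \<in> closed_span u"
  unfolding closed_span_def
proof (intro CollectI conjI ballI impI)
  show yc: "y \<in> carrier F" by (rule interp_closed[OF y])
  fix f assume f: "f \<in> dual K F" "\<forall>n. f (u n) = 0"
  have "cmod (f y) \<le> dnorm f * l2_norm y * (1/2) ^ Suc k" for k
  proof -
    have "cmod (f y) \<le> (wt k * 0 + dnorm f / wt k) * gauge k y"
      by (rule functional_le_gauge[OF f(1) yc]) (use f dual_le_dnorm in auto)
    also have "\<dots> \<le> dnorm f / wt k * l2_norm y"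
      using gauge_le_l2_norm[OF y] dnorm_nonneg[OF f(1)] by (simp add: mult_left_mono divide_right_mono less_imp_le)
    finally show ?thesis by (simp add: wt_def power_divide)
  qed
  moreover have "(\<lambda>k. dnorm f * l2_norm y * (1/2) ^ Suc k) \<longlonglongrightarrow> 0"
    by (intro tendsto_mult_right_zero LIMSEQ_Suc LIMSEQ_power_zero) auto
  ultimately have "cmod (f y) \<le> 0" using LIMSEQ_le_const by blast
  then show "f y = 0" by simp
qed

text \<open>The sequences \<open>t m (u n)\<close> tend to 0 in \<open>n\<close> at speeds depending
  on \<open>m\<close>. The weights make their supremum tend to 0 as well, without affecting the
  separation of points.\<close>

definition small :: "'a \<Rightarrow> real" where
  "small = sup_seminorm (range (\<lambda>m. \<lambda>x\<in>carrier F. (1/2)^m * t m x))"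

lemma equicontinuous_small: "equicontinuous 1 (range (\<lambda>m. \<lambda>x\<in>carrier F. (1/2)^m * t m x))"
  unfolding equicontinuous_def
proof (intro conjI ballI)
  have K: "(1/2 :: complex) ^ m \<in> K" for m
    using K_closed(3)[of "(1/2)^m"] by simp
  show "range (\<lambda>m. \<lambda>x\<in>carrier F. (1/2)^m * t m x) \<subseteq> dual K F"
    using dual_scaleI[OF t_dual K] by blast
  fix f x assume "f \<in> range (\<lambda>m. \<lambda>x\<in>carrier F. (1/2)^m * t m x)" and x: "x \<in> carrier F"
  then obtain m where "f x = (1/2)^m * t m x" by auto
  then have "cmod (f x) = (1/2)^m * cmod (t m x)" by (simp add: norm_mult norm_power norm_divide)
  also have "\<dots> \<le> 1 * nrm F x" by (intro mult_mono t_le x) (auto simp: power_le_one)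
  finally show "cmod (f x) \<le> 1 * nrm F x" .
qed auto

lemmas small_upper = sup_seminorm_upper[OF equicontinuous_small, folded small_def]
  and small_least = sup_seminorm_least[OF equicontinuous_small, folded small_def]
  and small_le = sup_seminorm_le[OF equicontinuous_small, folded small_def]
  and small_nonneg = sup_seminorm_nonneg[OF equicontinuous_small, folded small_def]
  and small_add = sup_seminorm_add[OF equicontinuous_small, folded small_def]
  and small_smult = sup_seminorm_smult[OF equicontinuous_small, folded small_def]

lemma small_pos:
  assumes y: "y \<in> interp" "y \<noteq> \<zero>" shows "small y > 0"
proof -
  have yc: "y \<in> carrier F" by (rule interp_closed[OF y(1)])
  obtain m where m: "t m y \<noteq> 0" using t_separates[OF interp_in_closed_span[OF y(1)]] y(2) by blast
  have "0 < cmod ((\<lambda>x\<in>carrier F. (1/2)^m * t m x) y)" using m yc by simp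
  also have "\<dots> \<le> small y" by (rule small_upper[OF yc]) blast
  finally show ?thesis .
qed

lemma small_u: "(\<lambda>n. small (u n)) \<longlonglongrightarrow> 0"
proof (rule LIMSEQ_I)
  fix e :: real assume e: "e > 0"
  \<comment> \<open>From \<open>M\<close> on the weight alone is below \<open>e / 2\<close>; for the
    finitely many smaller \<open>m\<close> weak nullity of \<open>u\<close> is used.\<close>
  obtain M :: nat where M: "(1/2 :: real) ^ M < e / 2"
    using real_arch_pow_inv[of "e/2" "1/2"] e by auto
  have "\<forall>\<^sub>F n in sequentially. \<forall>m\<in>{..<M}. cmod (t m (u n)) < e / 2"
  proof (rule eventually_ball_finite)
    show "\<forall>m\<in>{..<M}. \<forall>\<^sub>F n in sequentially. cmod (t m (u n)) < e / 2"
      using order_tendstoD(2)[OF tendsto_norm_zero[OF weakly_null[OF t_dual]], of "e/2"] e by auto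
  qed simp
  then obtain N where N: "\<And>n m. n \<ge> N \<Longrightarrow> m < M \<Longrightarrow> cmod (t m (u n)) < e / 2"
    unfolding eventually_sequentially by blast
  have "small (u n) \<le> e / 2" if n: "n \<ge> N" for n
  proof (rule small_least)
    fix f assume "f \<in> range (\<lambda>m. \<lambda>x\<in>carrier F. (1/2)^m * t m x)"
    then obtain m where "f (u n) = (1/2)^m * t m (u n)" using u_closed by auto
    then have f: "cmod (f (u n)) = (1/2)^m * cmod (t m (u n))" by (simp add: norm_mult norm_power norm_divide)
    show "cmod (f (u n)) \<le> e / 2"
    proof (cases "m < M")
      case True
      have "(1/2)^m * cmod (t m (u n)) \<le> 1 * cmod (t m (u n))"
        by (intro mult_right_mono) (auto simp: power_le_one)
      with N[OF n True] f show ?thesis by simp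
    next
      case False
      then have "(1/2 :: real)^m \<le> (1/2)^M" by (intro power_decreasing) auto
      moreover have "(1/2)^m * cmod (t m (u n)) \<le> (1/2)^m * 1"
        using t_le[OF u_closed, of m n] nrm_u by (intro mult_left_mono) auto
      ultimately show ?thesis using f M by linarith
    qed
  qed
  then show "\<exists>N. \<forall>n\<ge>N. norm (small (u n) - 0) < e"
    using e small_nonneg[OF u_closed] by (intro exI[of _ N]) force
qed

text \<open>The maximum, not a sum, keeps \<open>N (u n)\<close> close to 1:
  \<open>l2_norm (u n) \<le> 1\<close>, so the first entry wins and equals
  \<open>1 + small (u n)\<close>. The second entry makes \<open>N\<close> equivalent to
  \<open>l2_norm\<close>, and \<open>small\<close> makes it strictly larger than the norm of
  \<open>F\<close>.\<close>

definition N :: "'a \<Rightarrow> real" where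
  "N y = max (nrm F y + small y) (l2_norm y)"

text \<open>Both \<open>nrm F\<close> and \<open>small\<close> are at most
  \<open>4 * l2_norm\<close>, with \<open>4 = 2 * wt 0\<close>; hence the 8.\<close>

lemma N_le: "y \<in> interp \<Longrightarrow> N y \<le> 8 * l2_norm y"
  using nrm_le_l2_norm[of y] small_le[OF interp_closed, of y] l2_norm_nonneg[of y] unfolding N_def by auto

lemma l2_norm_le_N: "l2_norm y \<le> N y"
  by (simp add: N_def)

lemma nrm_le_N: "y \<in> interp \<Longrightarrow> nrm F y \<le> N y"
  using small_nonneg[OF interp_closed, of y] by (simp add: N_def)

lemma nrm_less_N: "y \<in> interp \<Longrightarrow> y \<noteq> \<zero> \<Longrightarrow> nrm F y < N y"
  using small_pos[of y] by (auto simp: N_def)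

lemma N_u: "(\<lambda>n. N (u n)) \<longlonglongrightarrow> 1"
proof -
  have "N (u n) = 1 + small (u n)" for n
    using l2_norm_u[of n] small_nonneg[OF u_closed, of n] by (simp add: N_def nrm_u)
  then show ?thesis using tendsto_add[OF tendsto_const small_u, of 1] by simp
qed

section \<open>The interpolation space with the norm \<open>N\<close>\<close>

definition R :: "'a normed_module" where
  "R = F\<lparr>carrier := interp, nrm := N\<rparr>"

lemma R_simps [simp]:
  "carrier R = interp" "nrm R = N" "x \<oplus>\<^bsub>R\<^esub> y = x \<oplus> y" "\<zero>\<^bsub>R\<^esub> = \<zero>" "a \<odot>\<^bsub>R\<^esub> x = a \<odot> x"
  by (simp_all add: R_def)

lemma normed_space_R: "normed_space K R"
proof (rule normed_spaceI[OF normed_space_axioms], goal_cases)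
  case 1
  show ?case
  proof (rule abelian_groupI, goal_cases)
    case (6 x)
    then have x: "x \<in> interp" by simp
    then have "(-1) \<odot> x \<oplus> x = \<zero>"
      using smult_add_left[of "-1" 1 x] interp_closed by simp
    with interp_smult(1)[of "-1" x] x show ?case by (intro bexI[of _ "(-1) \<odot> x"]) auto
  qed (auto simp: interp_add zero_in_interp interp_closed M.a_ac)
next
  case (7 x)
  then have "nrm F x \<le> 0" using nrm_le_N[of x] by simp
  then show ?case using 7 interp_closed nrm_eq_0 nrm_nonneg[of x] by force
next
  case (8 a x)
  then show ?case
    by (simp add: N_def nrm_smult small_smult interp_smult interp_closed max_mult_distrib_left
        distrib_left[symmetric])
next
  case (9 x y)
  then show ?case
    using nrm_triangle[of x y] small_add[of x y] interp_add(2)[of x y] interp_closed[of x] interp_closed[of y]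
    by (auto simp: N_def)
qed (auto simp: interp_closed interp_smult smult_add_left smult_add_right smult_smult)

lemma R_diff: "x \<in> interp \<Longrightarrow> y \<in> interp \<Longrightarrow> x \<ominus>\<^bsub>R\<^esub> y = x \<ominus> y"
  using normed_space.diff_eq_smult[OF normed_space_R, of x y] by (simp add: diff_eq_smult interp_closed)

text \<open>A Cauchy sequence converges in \<open>F\<close> because \<open>N\<close> dominates the
  norm of \<open>F\<close>. The gauges are continuous on \<open>F\<close>, so bounds on partial sums
  of squared gauges of \<open>x n \<ominus> x m\<close> survive the limit in \<open>m\<close>, and
  convergence holds for \<open>l2_norm\<close> and hence for \<open>N\<close>.\<close>

lemma banach_space_R: "banach_space K R"
proof -
  interpret R: normed_space K R by (rule normed_space_R)
  have lim: "\<exists>l\<in>carrier R. (\<lambda>n. nrm R (x n \<ominus>\<^bsub>R\<^esub> l)) \<longlonglongrightarrow> 0"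
    if x: "\<And>n. x n \<in> carrier R"
      and C: "\<And>e. e > 0 \<Longrightarrow> \<exists>M. \<forall>m\<ge>M. \<forall>n\<ge>M. nrm R (x m \<ominus>\<^bsub>R\<^esub> x n) < e" for x
  proof -
    have xi: "x n \<in> interp" and xc: "x n \<in> carrier F" for n
      using x[of n] interp_closed by auto
    have C': "\<exists>M. \<forall>m\<ge>M. \<forall>n\<ge>M. N (x m \<ominus> x n) < e" if "e > 0" for e
      using C[OF that] by (simp add: R_diff xi)
    have CF: "\<exists>M. \<forall>m\<ge>M. \<forall>n\<ge>M. nrm F (x m \<ominus> x n) < e" if "e > 0" for e
      using C'[OF that] nrm_le_N[OF interp_diff[OF xi xi]] by (meson le_less_trans)
    obtain l where l: "l \<in> carrier F" "(\<lambda>n. nrm F (x n \<ominus> l)) \<longlonglongrightarrow> 0"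
      by (rule Cauchy_limit[OF xc CF])
    have bound: "\<exists>M. \<forall>n\<ge>M. x n \<ominus> l \<in> interp \<and> N (x n \<ominus> l) \<le> 8 * e" if e: "e > 0" for e
    proof -
      obtain M where M: "\<And>m n. m \<ge> M \<Longrightarrow> n \<ge> M \<Longrightarrow> N (x m \<ominus> x n) < e" using C'[OF e] by blast
      have "x n \<ominus> l \<in> interp \<and> l2_norm (x n \<ominus> l) \<le> e" if n: "n \<ge> M" for n
      proof -
        have "nrm F ((x n \<ominus> x m) \<ominus> (x n \<ominus> l)) = nrm F (x m \<ominus> l)" for m
          using xc l(1) nrm_diff_swap by (simp add: diff_diff_cancel)
        then have lim: "(\<lambda>m. gauge k (x n \<ominus> x m)) \<longlonglongrightarrow> gauge k (x n \<ominus> l)" for k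
          using l xc by (intro gauge_tendsto) auto
        have "(\<Sum>k<j. (gauge k (x n \<ominus> l))\<^sup>2) \<le> e\<^sup>2" for j
        proof (rule LIMSEQ_le_const2)
          show "(\<lambda>m. \<Sum>k<j. (gauge k (x n \<ominus> x m))\<^sup>2) \<longlonglongrightarrow> (\<Sum>k<j. (gauge k (x n \<ominus> l))\<^sup>2)"
            by (intro tendsto_sum tendsto_power lim)
          have "(\<Sum>k<j. (gauge k (x n \<ominus> x m))\<^sup>2) \<le> e\<^sup>2" if "m \<ge> M" for m
          proof -
            have i: "x n \<ominus> x m \<in> interp" by (rule interp_diff[OF xi xi])
            have "l2_norm (x n \<ominus> x m) \<le> e" using M[OF n that] l2_norm_le_N[of "x n \<ominus> x m"] by simp
            then have "(l2_norm (x n \<ominus> x m))\<^sup>2 \<le> e\<^sup>2" using l2_norm_nonneg[OF i] by (rule power_mono)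
            with sum_gauge_le[OF i, of j] show ?thesis by simp
          qed
          then show "\<exists>M. \<forall>m\<ge>M. (\<Sum>k<j. (gauge k (x n \<ominus> x m))\<^sup>2) \<le> e\<^sup>2" by blast
        qed
        from interpI[OF _ this] show ?thesis using xc l e by auto
      qed
      then show ?thesis using N_le by (intro exI[of _ M]) force
    qed
    obtain M where "x M \<ominus> l \<in> interp" using bound[of 1] by auto
    then have "x M \<ominus> (x M \<ominus> l) \<in> interp" using interp_diff xi by blast
    moreover have "x M \<ominus> (x M \<ominus> l) = l"
      using diff_diff_cancel[of "x M" \<zero> l] xc l(1) by simp
    ultimately have li: "l \<in> interp" by simp
    have "(\<lambda>n. N (x n \<ominus> l)) \<longlonglongrightarrow> 0"
    proof (rule LIMSEQ_I)
      fix e :: real assume e: "e > 0"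
      obtain M where M: "\<forall>n\<ge>M. x n \<ominus> l \<in> interp \<and> N (x n \<ominus> l) \<le> 8 * (e / 16)"
        using bound[of "e / 16"] e by auto
      have nn: "0 \<le> N (x n \<ominus> l)" for n
        using nrm_le_N[OF interp_diff[OF xi li]] nrm_nonneg[OF diff_closed[OF xc l(1)]] order.trans by blast
      have "norm (N (x n \<ominus> l) - 0) < e" if "n \<ge> M" for n
        using M that e nn[of n] by auto
      then show "\<exists>M. \<forall>n\<ge>M. norm (N (x n \<ominus> l) - 0) < e" by blast
    qed
    with li show ?thesis by (intro bexI[of _ l]) (auto simp: R_diff xi)
  qed
  show ?thesis
  proof (intro banach_space.intro banach_space_axioms.intro normed_space_R)
    show "Metric_space.mcomplete (carrier R) (ndist R)"
      unfolding R.mcomplete_iff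
    proof (intro ballI impI)
      fix x :: "nat \<Rightarrow> 'a" assume "x \<in> UNIV \<rightarrow> carrier R"
        "\<forall>e>0. \<exists>M. \<forall>m\<ge>M. \<forall>n\<ge>M. nrm R (x m \<ominus>\<^bsub>R\<^esub> x n) < e"
      then show "\<exists>l\<in>carrier R. (\<lambda>n. nrm R (x n \<ominus>\<^bsub>R\<^esub> l)) \<longlonglongrightarrow> 0"
        by (intro lim) (blast intro: funcset_mem)+
    qed
  qed
qed

end

section \<open>Reflexivity of the interpolation space\<close>

text \<open>The duality between \<open>c0\<close> and absolutely summable sequences: the
  coefficients are the values at unit sequences, testing on phases makes them summable, and
  truncations approximate a null sequence uniformly.\<close>

lemma (in normed_space) linfty_functional_on_c0:
  assumes \<Lambda>: "\<Lambda> \<in> dual K (linfty K)"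
  obtains b where "\<forall>n. b n \<in> K" "summable (\<lambda>n. cmod (b n))"
    "\<forall>x\<in>carrier (linfty K). x \<longlonglongrightarrow> 0 \<longrightarrow> (\<lambda>m. \<Sum>n<m. b n * x n) \<longlonglongrightarrow> \<Lambda> x"
proof -
  interpret V: normed_space K "linfty K" by (rule normed_space_linfty)
  define e where "e n = (\<lambda>i. if i = n then 1 else 0 :: complex)" for n :: nat
  define b where "b n = \<Lambda> (e n)" for n
  define trunc where "trunc m x = (\<lambda>i. if i < m then x i else 0 :: complex)" for m :: nat and x
  have trunc: "trunc m x \<in> carrier (linfty K)" if x: "\<And>n. x n \<in> K" for m x
  proof -
    have "cmod (trunc m x n) \<le> (\<Sum>i<m. cmod (x i))" for n
      by (auto simp: trunc_def sum_nonneg intro: member_le_sum)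
    moreover have "trunc m x n \<in> K" for n using x by (simp add: trunc_def)
    ultimately show ?thesis unfolding linfty_iff by blast
  qed
  have e: "e n \<in> carrier (linfty K)" for n
    by (auto simp: linfty_iff e_def intro!: exI[of _ 1])
  have \<Lambda>_trunc: "\<Lambda> (trunc m x) = (\<Sum>n<m. b n * x n)" if x: "\<And>n. x n \<in> K" for m x
  proof (induction m)
    case 0
    have "trunc 0 x = \<zero>\<^bsub>linfty K\<^esub>" by (simp add: trunc_def)
    then show ?case using V.dual_zero[OF \<Lambda>] by simp
  next
    case (Suc m)
    have "trunc (Suc m) x = trunc m x \<oplus>\<^bsub>linfty K\<^esub> (x m \<odot>\<^bsub>linfty K\<^esub> e m)"
      by (auto simp: trunc_def e_def less_Suc_eq)
    then have "\<Lambda> (trunc (Suc m) x) = \<Lambda> (trunc m x \<oplus>\<^bsub>linfty K\<^esub> (x m \<odot>\<^bsub>linfty K\<^esub> e m))"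
      by (rule arg_cong)
    also have "\<dots> = \<Lambda> (trunc m x) + \<Lambda> (x m \<odot>\<^bsub>linfty K\<^esub> e m)"
      by (rule V.dual_add[OF \<Lambda> trunc[OF x] V.smult_in_carrier[OF x e]])
    also have "\<Lambda> (x m \<odot>\<^bsub>linfty K\<^esub> e m) = x m * \<Lambda> (e m)"
      by (rule V.dual_smult[OF \<Lambda> x e])
    finally have "\<Lambda> (trunc (Suc m) x) = \<Lambda> (trunc m x) + x m * \<Lambda> (e m)" .
    with Suc show ?case by (simp add: b_def mult.commute)
  qed
  have bK: "b n \<in> K" for n using V.dual_in_K[OF \<Lambda> e] by (simp add: b_def)
  have "summable (\<lambda>n. cmod (b n))"
  proof (rule bounded_imp_summable)
    fix m
    \<comment> \<open>The phase of \<open>b n\<close>; where \<open>b n = 0\<close> the division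
      yields 0, which serves as well.\<close>
    define c where "c n = cnj (b n) / cmod (b n)" for n
    have cK: "c n \<in> K" for n using bK by (auto simp: c_def)
    have bc: "b n * c n = cmod (b n)" for n
      by (cases "b n = 0") (auto simp: c_def complex_norm_square[symmetric] power2_eq_square)
    have "cmod (c n) \<le> 1" for n by (cases "b n = 0") (auto simp: c_def norm_divide)
    then have "nrm (linfty K) (trunc (Suc m) c) \<le> 1"
      by (intro nrm_linfty_le) (auto simp: trunc_def)
    have "complex_of_real (\<Sum>n\<le>m. cmod (b n)) = \<Lambda> (trunc (Suc m) c)"
      using \<Lambda>_trunc[OF cK] by (simp add: bc lessThan_Suc_atMost)
    then have "(\<Sum>n\<le>m. cmod (b n)) = cmod (\<Lambda> (trunc (Suc m) c))"
      by (metis abs_of_nonneg norm_ge_zero norm_of_real sum_nonneg)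
    also have "\<dots> \<le> V.dnorm \<Lambda> * nrm (linfty K) (trunc (Suc m) c)"
      by (rule V.dual_le_dnorm[OF \<Lambda> trunc[OF cK]])
    also have "\<dots> \<le> V.dnorm \<Lambda>"
      using \<open>nrm (linfty K) (trunc (Suc m) c) \<le> 1\<close> V.dnorm_nonneg[OF \<Lambda>] by (rule mult_left_le)
    finally show "(\<Sum>n\<le>m. cmod (b n)) \<le> V.dnorm \<Lambda>" .
  qed simp
  moreover have "(\<lambda>m. \<Sum>n<m. b n * x n) \<longlonglongrightarrow> \<Lambda> x" if x: "x \<in> carrier (linfty K)" and lim: "x \<longlonglongrightarrow> 0" for x
  proof (rule LIMSEQ_I)
    fix r :: real assume r: "r > 0"
    have xK: "x n \<in> K" for n using x by (rule linfty_in_K)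
    define \<eta> where "\<eta> = r / (2 * (V.dnorm \<Lambda> + 1))"
    have \<eta>: "\<eta> > 0" using r V.dnorm_nonneg[OF \<Lambda>] by (simp add: \<eta>_def)
    then obtain M where M: "\<forall>n\<ge>M. cmod (x n) < \<eta>" using LIMSEQ_D[OF lim \<eta>] by auto
    have "cmod ((\<Sum>n<m. b n * x n) - \<Lambda> x) < r" if m: "m \<ge> M" for m
    proof -
      have eq: "x \<ominus>\<^bsub>linfty K\<^esub> trunc m x = (\<lambda>i. if i < m then 0 else x i)"
        using V.diff_eq_smult[OF x trunc[OF xK]] by (auto simp: trunc_def)
      have "nrm (linfty K) (x \<ominus>\<^bsub>linfty K\<^esub> trunc m x) \<le> \<eta>"
        unfolding eq using M m \<eta> by (intro nrm_linfty_le) (auto simp: less_imp_le)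
      then have "V.dnorm \<Lambda> * nrm (linfty K) (x \<ominus>\<^bsub>linfty K\<^esub> trunc m x) \<le> V.dnorm \<Lambda> * \<eta>"
        using V.dnorm_nonneg[OF \<Lambda>] by (rule mult_left_mono)
      moreover have "cmod (\<Lambda> x - \<Lambda> (trunc m x)) \<le> V.dnorm \<Lambda> * nrm (linfty K) (x \<ominus>\<^bsub>linfty K\<^esub> trunc m x)"
        using V.dual_le_dnorm[OF \<Lambda> V.diff_closed[OF x trunc[OF xK]]] V.dual_diff[OF \<Lambda> x trunc[OF xK]] by simp
      moreover have "V.dnorm \<Lambda> * \<eta> < r"
      proof -
        have "V.dnorm \<Lambda> * \<eta> \<le> (V.dnorm \<Lambda> + 1) * \<eta>" using \<eta> by simp
        also have "\<dots> = r / 2" using V.dnorm_nonneg[OF \<Lambda>] by (simp add: \<eta>_def field_simps)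
        finally show ?thesis using r by simp
      qed
      ultimately show ?thesis using \<Lambda>_trunc[OF xK, of m] by (simp add: norm_minus_commute)
    qed
    then show "\<exists>M. \<forall>m\<ge>M. norm ((\<Sum>n<m. b n * x n) - \<Lambda> x) < r" by auto
  qed
  ultimately show ?thesis using bK by (intro that[of b]) auto
qed

context weakly_null_sequence
begin

interpretation R: banach_space K R by (rule banach_space_R)

text \<open>
  In \<open>R\<close> a bounded sequence that tends to \<open>0\<close> in \<open>F\<close> behaves, after passing to a subsequence, like
  an orthogonal sequence.
\<close>

lemma l2_norm_add_almost_orthogonal:
  assumes s: "s \<in> interp"
  obtains \<eta> where "\<eta> > 0" "\<forall>y\<in>interp. l2_norm y \<le> 1 \<longrightarrow> nrm F y \<le> \<eta> \<longrightarrow>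
    (l2_norm (s \<oplus> y))\<^sup>2 \<le> (l2_norm s)\<^sup>2 + 2"
proof -
  have sc: "s \<in> carrier F" and summ: "summable (\<lambda>k. (gauge k s)\<^sup>2)" using s by (auto simp: interp_def)
  have "(\<lambda>m. \<Sum>k<m. (gauge k s)\<^sup>2) \<longlonglongrightarrow> (l2_norm s)\<^sup>2"
    using summable_LIMSEQ[OF summ] by (simp add: l2_norm_def suminf_nonneg summ)
  \<comment> \<open>Beyond \<open>M\<close> the gauges of \<open>s\<close> have square sum at most
    1/16, so the tail of the cross terms is at most 1/4; \<open>\<eta>\<close> makes the head at
    most 1/4. Twice the cross sum is thus at most 1, and the squares of \<open>y\<close> add another
    1: this is the 2 in the claim.\<close>
  from LIMSEQ_D[OF this, of "1/16"]
  obtain M where "\<forall>n\<ge>M. norm ((\<Sum>k<n. (gauge k s)\<^sup>2) - (l2_norm s)\<^sup>2) < 1/16" by auto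
  then have "\<bar>(\<Sum>k<M. (gauge k s)\<^sup>2) - (l2_norm s)\<^sup>2\<bar> < 1/16" by auto
  then have M: "(l2_norm s)\<^sup>2 - (\<Sum>k<M. (gauge k s)\<^sup>2) \<le> 1/16" by linarith
  define S where "S = (\<Sum>k<M. gauge k s * wt k)"
  have S: "S \<ge> 0" unfolding S_def using gauge_nonneg[OF sc] by (intro sum_nonneg mult_nonneg_nonneg) (auto simp: less_imp_le)
  define \<eta> where "\<eta> = 1 / (4 * (S + 1))"
  have "(l2_norm (s \<oplus> y))\<^sup>2 \<le> (l2_norm s)\<^sup>2 + 2"
    if y: "y \<in> interp" and y1: "l2_norm y \<le> 1" and small: "nrm F y \<le> \<eta>" for y
  proof -
    have yc: "y \<in> carrier F" using y by (rule interp_closed)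
    have ynn: "0 \<le> gauge k y" and snn: "0 \<le> gauge k s" for k using gauge_nonneg yc sc by auto
    have y_sum: "(\<Sum>k<j. (gauge k y)\<^sup>2) \<le> 1" for j
      using sum_gauge_le[OF y, of j] power_mono[OF y1 l2_norm_nonneg[OF y], of 2] by simp
    have cross: "(\<Sum>k<j. gauge k s * gauge k y) \<le> 1/2" for j
    proof -
      have "(\<Sum>k<j. gauge k s * gauge k y) \<le> (\<Sum>k\<in>{..<M} \<union> {M..<j}. gauge k s * gauge k y)"
        using ynn snn by (intro sum_mono2) auto
      also have "\<dots> = (\<Sum>k<M. gauge k s * gauge k y) + (\<Sum>k=M..<j. gauge k s * gauge k y)"
        by (intro sum.union_disjoint) auto
      also have "\<dots> \<le> 1/4 + 1/4"
      proof (rule add_mono)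
        have "(\<Sum>k<M. gauge k s * gauge k y) \<le> (\<Sum>k<M. gauge k s * (wt k * nrm F y))"
          using gauge_le[OF yc] snn by (intro sum_mono mult_left_mono)
        also have "\<dots> = S * nrm F y" by (simp add: S_def sum_distrib_right mult.assoc)
        also have "\<dots> \<le> S * \<eta>" using small S by (rule mult_left_mono)
        also have "\<dots> \<le> 1/4" using S by (simp add: \<eta>_def field_simps)
        finally show "(\<Sum>k<M. gauge k s * gauge k y) \<le> 1/4" .
      next
        have sub: "(\<Sum>k=M..<j. (f k)\<^sup>2) + (\<Sum>k<M. (f k)\<^sup>2) \<le> (\<Sum>k<max M j. (f k)\<^sup>2)" for f :: "nat \<Rightarrow> real"
          by (subst sum.union_disjoint[symmetric]) (auto intro!: sum_mono2)
        have "(\<Sum>k=M..<j. (gauge k s)\<^sup>2) \<le> (1/4)\<^sup>2"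
          using sub[of "\<lambda>k. gauge k s"] sum_gauge_le[OF s, of "max M j"] M by (simp add: power2_eq_square)
        then have a: "L2_set (\<lambda>k. gauge k s) {M..<j} \<le> 1/4"
          unfolding L2_set_def by (intro real_le_lsqrt) (auto intro: sum_nonneg)
        have "(\<Sum>k=M..<j. (gauge k y)\<^sup>2) \<le> 1\<^sup>2"
          using sub[of "\<lambda>k. gauge k y"] y_sum[of "max M j"] sum_nonneg[of "{..<M}" "\<lambda>k. (gauge k y)\<^sup>2"] by simp
        then have b: "L2_set (\<lambda>k. gauge k y) {M..<j} \<le> 1"
          unfolding L2_set_def by (intro real_le_lsqrt) (auto intro: sum_nonneg)
        have "(\<Sum>k=M..<j. gauge k s * gauge k y) \<le> L2_set (\<lambda>k. gauge k s) {M..<j} * L2_set (\<lambda>k. gauge k y) {M..<j}"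
          using L2_set_mult_ineq[of "\<lambda>k. gauge k s" "\<lambda>k. gauge k y" "{M..<j}"] ynn snn by simp
        also have "\<dots> \<le> 1/4 * 1" by (intro mult_mono a b) (auto simp: L2_set_nonneg)
        finally show "(\<Sum>k=M..<j. gauge k s * gauge k y) \<le> 1/4" by simp
      qed
      finally show ?thesis by simp
    qed
    have part: "(\<Sum>k<j. (gauge k (s \<oplus> y))\<^sup>2) \<le> (sqrt ((l2_norm s)\<^sup>2 + 2))\<^sup>2" for j
    proof -
      have "(\<Sum>k<j. (gauge k (s \<oplus> y))\<^sup>2) \<le> (\<Sum>k<j. (gauge k s + gauge k y)\<^sup>2)"
        using gauge_add[OF sc yc] gauge_nonneg[OF add_closed[OF sc yc]] by (intro sum_mono power_mono)
      also have "\<dots> = (\<Sum>k<j. (gauge k s)\<^sup>2) + (\<Sum>k<j. (gauge k y)\<^sup>2) + 2 * (\<Sum>k<j. gauge k s * gauge k y)"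
        by (simp add: power2_sum sum.distrib sum_distrib_left mult.assoc)
      also have "\<dots> \<le> (l2_norm s)\<^sup>2 + 1 + 2 * (1/2)"
        by (intro add_mono mult_left_mono sum_gauge_le[OF s] y_sum cross) auto
      finally show ?thesis by simp
    qed
    have "l2_norm (s \<oplus> y) \<le> sqrt ((l2_norm s)\<^sup>2 + 2)"
      by (rule interpI(2)[OF _ part]) (use sc yc in auto)
    then have "(l2_norm (s \<oplus> y))\<^sup>2 \<le> (sqrt ((l2_norm s)\<^sup>2 + 2))\<^sup>2"
      using l2_norm_nonneg[OF interp_add(1)[OF s y]] by (rule power_mono)
    then show ?thesis by simp
  qed
  moreover have "\<eta> > 0" using S by (simp add: \<eta>_def)
  ultimately show ?thesis by (intro that[of \<eta>]) auto
qed

text \<open>A gliding hump argument. If the bound fails for every \<open>C\<close>, there are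
  vectors with \<open>l2_norm\<close> at most 1, arbitrarily small norm in \<open>F\<close> and
  \<open>Re (g y) \<ge> e\<close>. Adding \<open>j\<close> of them almost orthogonally gives
  \<open>l2_norm\<close> at most \<open>sqrt (2 * j)\<close> but
  \<open>Re (g s) \<ge> j * e\<close>, impossible for bounded \<open>g\<close>.\<close>

lemma functional_le_nrm_plus:
  assumes g: "g \<in> dual K R" and e: "e > 0"
  shows "\<exists>C\<ge>0. \<forall>y\<in>interp. cmod (g y) \<le> C * nrm F y + e * N y"
proof (rule ccontr)
  assume contr: "\<not> ?thesis"
  have ex: "\<exists>y\<in>interp. cmod (g y) > C * nrm F y + e * N y" if "C \<ge> 0" for C
    using contr that by (meson not_le)
  define B where "B = 8 * R.dnorm g"
  have B0: "B \<ge> 0" using R.dnorm_nonneg[OF g] by (simp add: B_def)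
  have gB: "cmod (g y) \<le> B * l2_norm y" if y: "y \<in> interp" for y
    using R.dual_le_dnorm[OF g, of y] y mult_left_mono[OF N_le[OF y] R.dnorm_nonneg[OF g]]
    by (simp add: B_def mult.assoc mult.left_commute)
  have hump: "\<exists>y\<in>interp. l2_norm y \<le> 1 \<and> nrm F y \<le> \<eta> \<and> e \<le> Re (g y)" if \<eta>: "\<eta> > 0" for \<eta>
  proof -
    \<comment> \<open>With this \<open>C\<close> the vector satisfies
      \<open>B / \<eta> * nrm F y \<le> cmod (g y) \<le> B * l2_norm y\<close>, so after division by
      \<open>l2_norm y\<close> its norm in \<open>F\<close> is at most \<open>\<eta>\<close>. The
      term \<open>e * N y\<close> keeps the value of \<open>g\<close>, rotated to be positive, at
      least \<open>e\<close>.\<close>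
    obtain y where y: "y \<in> interp" "cmod (g y) > B / \<eta> * nrm F y + e * N y"
      using ex[of "B / \<eta>"] B0 \<eta> by auto
    have yc: "y \<in> carrier F" using y(1) by (rule interp_closed)
    have "B / \<eta> * nrm F y \<ge> 0" using B0 \<eta> nrm_nonneg[OF yc] by simp
    moreover have "e * l2_norm y \<le> e * N y" using l2_norm_le_N[of y] e by simp
    moreover have "e * l2_norm y \<ge> 0" using e l2_norm_nonneg[OF y(1)] by simp
    ultimately have gy: "cmod (g y) > 0" "e * l2_norm y \<le> cmod (g y)" "B / \<eta> * nrm F y \<le> cmod (g y)"
      using y(2) by linarith+
    have l2: "l2_norm y > 0"
      using gB[OF y(1)] gy(1) l2_norm_nonneg[OF y(1)] by (cases "l2_norm y = 0") auto
    have B: "B > 0" using gB[OF y(1)] gy(1) B0 by (cases "B = 0") auto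
    define a where "a = cnj (g y) / complex_of_real (cmod (g y) * l2_norm y)"
    have gK: "g y \<in> K" using R.dual_in_K[OF g] y(1) by simp
    have a: "a \<in> K" using gK unfolding a_def by blast
    have a_norm: "cmod a = 1 / l2_norm y"
      using gy(1) l2 by (simp add: a_def norm_divide norm_mult)
    have "g (a \<odot> y) = a * g y" using R.dual_smult[OF g a, of y] y(1) by simp
    also have "\<dots> = complex_of_real (cmod (g y) / l2_norm y)"
      using gy(1) by (simp add: a_def complex_norm_square[symmetric] power2_eq_square mult.commute)
    finally have "Re (g (a \<odot> y)) = cmod (g y) / l2_norm y" by simp
    then have "e \<le> Re (g (a \<odot> y))" using gy(2) l2 by (simp add: pos_le_divide_eq)
    moreover have "nrm F (a \<odot> y) \<le> \<eta>"
    proof -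
      have "B / \<eta> * nrm F y \<le> B * l2_norm y" using gy(3) gB[OF y(1)] by linarith
      then have "nrm F y / l2_norm y \<le> \<eta>" using B \<eta> l2 by (simp add: field_simps)
      then show ?thesis using a a_norm yc by (simp add: nrm_smult)
    qed
    moreover have "l2_norm (a \<odot> y) \<le> 1" using interp_smult(2)[OF a y(1)] a_norm l2 by simp
    ultimately show ?thesis using interp_smult(1)[OF a y(1)] by blast
  qed
  have sums: "\<exists>s\<in>interp. (l2_norm s)\<^sup>2 \<le> 2 * real j \<and> real j * e \<le> Re (g s)" for j
  proof (induction j)
    case 0
    have "l2_norm \<zero> = 0" using interp_smult(2)[of 0 \<zero>] zero_in_interp by simp
    then show ?case using zero_in_interp R.dual_zero[OF g] by (intro bexI[of _ \<zero>]) auto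
  next
    case (Suc j)
    then obtain s where s: "s \<in> interp" "(l2_norm s)\<^sup>2 \<le> 2 * real j" "real j * e \<le> Re (g s)" by blast
    obtain \<eta> where \<eta>: "\<eta> > 0" "\<forall>y\<in>interp. l2_norm y \<le> 1 \<longrightarrow> nrm F y \<le> \<eta> \<longrightarrow>
        (l2_norm (s \<oplus> y))\<^sup>2 \<le> (l2_norm s)\<^sup>2 + 2"
      by (rule l2_norm_add_almost_orthogonal[OF s(1)])
    obtain y where y: "y \<in> interp" "l2_norm y \<le> 1" "nrm F y \<le> \<eta>" "e \<le> Re (g y)" using hump[OF \<eta>(1)] by blast
    have "(l2_norm (s \<oplus> y))\<^sup>2 \<le> (l2_norm s)\<^sup>2 + 2" using \<eta>(2) y by blast
    moreover have "g (s \<oplus> y) = g s + g y" using R.dual_add[OF g, of s y] s(1) y(1) by simp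
    ultimately show ?case
      using s y interp_add(1)[OF s(1) y(1)] by (intro bexI[of _ "s \<oplus> y"]) (auto simp: distrib_right)
  qed
  \<comment> \<open>Beyond this threshold \<open>j * e\<close> exceeds
    \<open>B * sqrt (2 * j)\<close>.\<close>
  obtain j :: nat where j: "real j > 2 * B\<^sup>2 / e\<^sup>2" using reals_Archimedean2 by blast
  have "2 * B\<^sup>2 / e\<^sup>2 \<ge> 0" by simp
  with j have j0: "real j > 0" by linarith
  obtain s where s: "s \<in> interp" "(l2_norm s)\<^sup>2 \<le> 2 * real j" "real j * e \<le> Re (g s)" using sums by blast
  have "real j * e \<le> B * l2_norm s" using s(3) gB[OF s(1)] complex_Re_le_cmod[of "g s"] by linarith
  then have "(real j * e)\<^sup>2 \<le> (B * l2_norm s)\<^sup>2" using e by (intro power_mono) auto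
  also have "\<dots> \<le> B\<^sup>2 * (2 * real j)" using s(2) by (simp add: power_mult_distrib mult_left_mono)
  finally have "real j * (real j * e\<^sup>2) \<le> real j * (2 * B\<^sup>2)"
    by (simp add: power2_eq_square algebra_simps)
  then have "real j * e\<^sup>2 \<le> 2 * B\<^sup>2" using j0 by (rule mult_left_le_imp_le)
  with j e show False by (simp add: pos_divide_less_eq)
qed

text \<open>In the bound of \<open>functional_le_nrm_plus\<close> the Hahn-Banach theorem assigns
  \<open>C * nrm F y\<close> to the functional \<open>f\<close> and \<open>e * N y\<close> to the
  error \<open>Q\<close>. Functionals on \<open>R\<close> are thus controlled by those on
  \<open>F\<close>.\<close>

lemma dense_restrictions:
  assumes g: "g \<in> dual K R" and e: "e > 0"
  obtains f where "f \<in> dual K F" "\<forall>y\<in>interp. cmod (f y - g y) \<le> e * N y"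
proof -
  note result = that
  obtain C where C: "C \<ge> 0" "\<forall>y\<in>interp. cmod (g y) \<le> C * nrm F y + e * N y"
    using functional_le_nrm_plus[OF g e] by blast
  have N_add: "N (x \<oplus> y) \<le> N x + N y" and g_add: "g (x \<oplus> y) = g x + g y"
    if "x \<in> interp" "y \<in> interp" for x y
    using R.nrm_triangle[of x y] R.dual_add[OF g, of x y] that by auto
  have N_smult: "N (a \<odot> x) = cmod a * N x" and g_smult: "g (a \<odot> x) = a * g x"
    if "x \<in> interp" "a \<in> K" for x a
    using R.nrm_smult[of a x] R.dual_smult[OF g, of a x] that by auto
  show ?thesis
  proof (rule hahn_banach[where I = interp and L = "\<lambda>y. y" and \<psi> = g and Q = "\<lambda>y. e * N y" and C = C])
    show "interp \<noteq> {}" using zero_in_interp by blast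
    show "\<exists>k\<in>interp. k = i \<oplus> j \<and> g k = g i + g j \<and> e * N k \<le> e * N i + e * N j"
      if "i \<in> interp" "j \<in> interp" for i j
      using that N_add[of i j] g_add[of i j] interp_add(1)[of i j] e by (simp flip: distrib_left)
    show "\<exists>k\<in>interp. k = a \<odot> i \<and> g k = a * g i \<and> e * N k \<le> cmod a * (e * N i)"
      if "a \<in> K" "i \<in> interp" for a i
      using that N_smult[of i a] g_smult[of i a] interp_smult(1)[of a i] by simp
    show "thesis" if "f \<in> dual K F" "\<And>y. y \<in> interp \<Longrightarrow> cmod (f y - g y) \<le> e * N y" for f
      using that by (intro result) auto
  qed (use C R.dual_in_K[OF g] interp_closed in auto)
qed

lemma restrict_dual:
  assumes f: "f \<in> dual K F" shows "restrict f interp \<in> dual K R"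
proof -
  have "restrict f (carrier R) \<in> dual K R"
  proof (rule R.dualI[where B = "dnorm f"])
    show "cmod (f y) \<le> dnorm f * nrm R y" if "y \<in> carrier R" for y
      using that dual_le_dnorm[OF f, of y] mult_left_mono[OF nrm_le_N dnorm_nonneg[OF f], of y] interp_closed[of y] by simp
  qed (use f in \<open>auto simp: interp_closed dual_add dual_smult\<close>)
  then show ?thesis by simp
qed

text \<open>Let \<open>\<psi>\<close> be the restriction of \<open>\<phi>\<close> to functionals on
  \<open>F\<close>. At each level \<open>k\<close> it splits into a part depending only on the
  values \<open>f (u n)\<close> and a remainder of order \<open>1 / wt k\<close>. As
  \<open>f (u n)\<close> is a null sequence, the first part is a series in \<open>u\<close> and
  nearly evaluation at a point of \<open>F\<close>. These points form a Cauchy sequence, its limit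
  \<open>z\<close> represents \<open>\<psi>\<close> and belongs to \<open>R\<close>, and density of
  restrictions extends the representation to \<open>\<phi>\<close>.\<close>

lemma reflexive_R: "reflexive_space K R"
  unfolding R.reflexive_space_iff
proof
  fix \<phi> assume \<phi>: "\<phi> \<in> dual K (dual_space K R)"
  interpret D: normed_space K "dual_space K R" by (rule R.normed_space_dual)
  interpret DF: normed_space K "dual_space K F" by (rule normed_space_dual)
  interpret V: normed_space K "linfty K" by (rule normed_space_linfty)
  define B where "B = D.dnorm \<phi>"
  have B0: "B \<ge> 0" using D.dnorm_nonneg[OF \<phi>] by (simp add: B_def)
  have \<phi>_le: "cmod (\<phi> h) \<le> B * b" if h: "h \<in> dual K R" "R.dnorm h \<le> b" for h b
    using D.dual_le_dnorm[OF \<phi> h(1)] mult_left_mono[OF h(2) B0] unfolding B_def by simp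
  define \<psi> where "\<psi> f = \<phi> (restrict f interp)" for f
  have \<psi>_le: "cmod (\<psi> f) \<le> B * b"
    if f: "f \<in> dual K F" and b: "b \<ge> 0" "\<And>y. y \<in> interp \<Longrightarrow> cmod (f y) \<le> b * N y" for f b
    unfolding \<psi>_def using b by (intro \<phi>_le restrict_dual f R.dnorm_le) auto
  have \<psi>_add: "\<psi> (\<lambda>x\<in>carrier F. f x + g x) = \<psi> f + \<psi> g" if "f \<in> dual K F" "g \<in> dual K F" for f g
  proof -
    have "restrict (\<lambda>x\<in>carrier F. f x + g x) interp = restrict f interp \<oplus>\<^bsub>dual_space K R\<^esub> restrict g interp"
      by (auto simp: interp_closed)
    then show ?thesis unfolding \<psi>_def using D.dual_add[OF \<phi> restrict_dual restrict_dual, OF that] by (simp only:)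
  qed
  have \<psi>_smult: "\<psi> (\<lambda>x\<in>carrier F. a * f x) = a * \<psi> f" if "a \<in> K" "f \<in> dual K F" for a f
  proof -
    have "restrict (\<lambda>x\<in>carrier F. a * f x) interp = a \<odot>\<^bsub>dual_space K R\<^esub> restrict f interp"
      by (auto simp: interp_closed)
    then show ?thesis unfolding \<psi>_def using D.dual_smult[OF \<phi> that(1) restrict_dual[OF that(2)]] by (simp only:)
  qed
  have seq: "(\<lambda>n. f (u n)) \<in> carrier (linfty K)" if f: "f \<in> dual K F" for f
    using dual_in_K[OF f u_closed] dual_le_dnorm[OF f u_closed] unfolding linfty_iff nrm_u by auto
  have approx: "\<exists>z\<in>carrier F. \<forall>f\<in>dual K F. cmod (\<psi> f - f z) \<le> (B + 1) / wt k * dnorm f" for k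
  proof -
    \<comment> \<open>\<open>functional_le_gauge\<close> with the supremum of
      \<open>cmod (f (u n))\<close> as \<open>\<alpha>\<close> and \<open>dnorm f\<close> as
      \<open>\<beta>\<close>, combined with \<open>gauge k y \<le> N y\<close>.\<close>
    have dom: "cmod (\<psi> f) \<le> B * wt k * nrm (linfty K) (\<lambda>n. f (u n)) + B / wt k * dnorm f"
      if f: "f \<in> dual K F" for f
    proof -
      let ?c = "wt k * nrm (linfty K) (\<lambda>n. f (u n)) + dnorm f / wt k"
      have c: "?c \<ge> 0" using dnorm_nonneg[OF f] V.nrm_nonneg[OF seq[OF f]] by (simp add: less_imp_le)
      have "cmod (f y) \<le> ?c * N y" if y: "y \<in> interp" for y
      proof -
        have "cmod (f y) \<le> ?c * gauge k y"
          by (rule functional_le_gauge[OF f interp_closed[OF y]])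
            (use dual_le_dnorm[OF f] cmod_le_nrm_linfty[OF seq[OF f]] in auto)
        also have "\<dots> \<le> ?c * N y"
          using order.trans[OF gauge_le_l2_norm[OF y] l2_norm_le_N] c by (rule mult_left_mono)
        finally show ?thesis .
      qed
      then have "cmod (\<psi> f) \<le> B * ?c" by (rule \<psi>_le[OF f c])
      then show ?thesis by (simp add: distrib_left mult.assoc)
    qed
    have Bk: "0 \<le> B / wt k" using B0 by (simp add: less_imp_le)
    \<comment> \<open>The splitting: the first summand of the bound is carried by a functional of
      the sequence \<open>f (u n)\<close>, the second becomes the error.\<close>
    obtain \<Lambda> where \<Lambda>: "\<Lambda> \<in> dual K (linfty K)"
      "\<forall>f\<in>dual K F. cmod (\<Lambda> (\<lambda>n. f (u n)) - \<psi> f) \<le> B / wt k * dnorm f"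
    proof (rule V.hahn_banach[where I = "dual K F" and L = "\<lambda>f n. f (u n)" and \<psi> = \<psi>
          and Q = "\<lambda>f. B / wt k * dnorm f" and C = "B * wt k"])
      show "dual K F \<noteq> {}" using dual_zeroI by blast
      show "0 \<le> B * wt k" using B0 by (simp add: less_imp_le)
      show "\<psi> f \<in> K" if "f \<in> dual K F" for f
        using D.dual_in_K[OF \<phi> restrict_dual[OF that]] by (simp add: \<psi>_def)
      show "\<exists>h\<in>dual K F. (\<lambda>n. h (u n)) = (\<lambda>n. f (u n)) \<oplus>\<^bsub>linfty K\<^esub> (\<lambda>n. g (u n)) \<and>
          \<psi> h = \<psi> f + \<psi> g \<and> B / wt k * dnorm h \<le> B / wt k * dnorm f + B / wt k * dnorm g"
        if fg: "f \<in> dual K F" "g \<in> dual K F" for f g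
      proof (intro bexI conjI)
        have "dnorm (\<lambda>x\<in>carrier F. f x + g x) \<le> dnorm f + dnorm g"
          using DF.nrm_triangle[OF fg] by simp
        from mult_left_mono[OF this Bk]
        show "B / wt k * dnorm (\<lambda>x\<in>carrier F. f x + g x) \<le> B / wt k * dnorm f + B / wt k * dnorm g"
          by (simp only: distrib_left)
        show "\<psi> (\<lambda>x\<in>carrier F. f x + g x) = \<psi> f + \<psi> g" by (rule \<psi>_add[OF fg])
        show "(\<lambda>x\<in>carrier F. f x + g x) \<in> dual K F" by (rule dual_addI[OF fg])
      qed (simp add: u_closed)
      show "\<exists>h\<in>dual K F. (\<lambda>n. h (u n)) = a \<odot>\<^bsub>linfty K\<^esub> (\<lambda>n. f (u n)) \<and>
          \<psi> h = a * \<psi> f \<and> B / wt k * dnorm h \<le> cmod a * (B / wt k * dnorm f)"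
        if af: "a \<in> K" "f \<in> dual K F" for a f
      proof (intro bexI conjI)
        show "B / wt k * dnorm (\<lambda>x\<in>carrier F. a * f x) \<le> cmod a * (B / wt k * dnorm f)"
          using DF.nrm_smult[OF af] by (simp add: mult.left_commute)
        show "\<psi> (\<lambda>x\<in>carrier F. a * f x) = a * \<psi> f" by (rule \<psi>_smult[OF af])
        show "(\<lambda>x\<in>carrier F. a * f x) \<in> dual K F" by (rule dual_scaleI[OF af(2,1)])
      qed (simp add: u_closed)
    qed (use seq dom in auto)
    obtain b where b: "\<forall>n. b n \<in> K" "summable (\<lambda>n. cmod (b n))"
      "\<forall>x\<in>carrier (linfty K). x \<longlonglongrightarrow> 0 \<longrightarrow> (\<lambda>m. \<Sum>n<m. b n * x n) \<longlonglongrightarrow> \<Lambda> x"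
      by (rule linfty_functional_on_c0[OF \<Lambda>(1)])
    \<comment> \<open>Partial sums of the series with terms \<open>b n \<odot> u n\<close>. Stopping
      where the tail of \<open>cmod (b n)\<close> is below \<open>1 / wt k\<close> adds this to the
      error, hence \<open>B + 1\<close> in the bound.\<close>
    define z where "z = rec_nat \<zero> (\<lambda>n z. z \<oplus> b n \<odot> u n)"
    have zc: "z m \<in> carrier F" for m
      by (induction m) (use b(1) u_closed in \<open>auto simp: z_def\<close>)
    have fz: "f (z m) = (\<Sum>n<m. b n * f (u n))" if f: "f \<in> dual K F" for f m
    proof (induction m)
      case (Suc m)
      have "z (Suc m) = z m \<oplus> b m \<odot> u m" by (simp add: z_def)
      then show ?case using Suc b(1) zc u_closed f by (simp add: dual_add dual_smult)
    qed (use f in \<open>simp add: z_def\<close>)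
    have "summable (\<lambda>n. complex_of_real (cmod (b n)))" using b(2) by (rule summable_of_real)
    then have "\<exists>m. \<forall>m'. cmod (\<Sum>n=m..<m'. complex_of_real (cmod (b n))) < 1 / wt k"
      unfolding summable_Cauchy by (metis order_refl wt_pos zero_less_divide_1_iff)
    then obtain m where m: "\<And>m'. cmod (\<Sum>n=m..<m'. complex_of_real (cmod (b n))) < 1 / wt k"
      by blast
    show ?thesis
    proof (intro bexI ballI)
      fix f assume f: "f \<in> dual K F"
      \<comment> \<open>Weak nullity of \<open>u\<close> enters here: the series is known to
        represent \<open>\<Lambda>\<close> on null sequences.\<close>
      have lim: "(\<lambda>m'. f (z m')) \<longlonglongrightarrow> \<Lambda> (\<lambda>n. f (u n))"
        unfolding fz[OF f] using b(3) seq[OF f] weakly_null[OF f] by blast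
      have "cmod (\<Lambda> (\<lambda>n. f (u n)) - f (z m)) \<le> 1 / wt k * dnorm f"
      proof (rule LIMSEQ_le_const2)
        show "(\<lambda>m'. cmod (f (z m') - f (z m))) \<longlonglongrightarrow> cmod (\<Lambda> (\<lambda>n. f (u n)) - f (z m))"
          by (intro tendsto_intros lim)
        have "cmod (f (z m') - f (z m)) \<le> 1 / wt k * dnorm f" if "m' \<ge> m" for m'
        proof -
          have "{..<m'} = {..<m} \<union> {m..<m'}" using that by auto
          then have "f (z m') - f (z m) = (\<Sum>n=m..<m'. b n * f (u n))"
            unfolding fz[OF f] by (simp add: sum.union_disjoint ivl_disj_int)
          also have "cmod \<dots> \<le> (\<Sum>n=m..<m'. cmod (b n) * dnorm f)"
            using dual_le_dnorm[OF f u_closed]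
            by (intro sum_norm_le) (auto simp: norm_mult nrm_u intro: mult_left_mono)
          also have "\<dots> = cmod (\<Sum>n=m..<m'. complex_of_real (cmod (b n))) * dnorm f"
            by (simp add: sum_nonneg flip: of_real_sum sum_distrib_right)
          also have "\<dots> \<le> 1 / wt k * dnorm f"
            using m[of m'] dnorm_nonneg[OF f] by (intro mult_right_mono) auto
          finally show ?thesis .
        qed
        then show "\<exists>M. \<forall>m'\<ge>M. cmod (f (z m') - f (z m)) \<le> 1 / wt k * dnorm f" by blast
      qed
      moreover have "cmod (\<psi> f - \<Lambda> (\<lambda>n. f (u n))) \<le> B / wt k * dnorm f"
        using \<Lambda>(2) f by (simp add: norm_minus_commute)
      ultimately have "cmod (\<psi> f - f (z m)) \<le> B / wt k * dnorm f + 1 / wt k * dnorm f"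
        using norm_triangle_ineq[of "\<psi> f - \<Lambda> (\<lambda>n. f (u n))" "\<Lambda> (\<lambda>n. f (u n)) - f (z m)"] by simp
      then show "cmod (\<psi> f - f (z m)) \<le> (B + 1) / wt k * dnorm f"
        by (simp add: distrib_right add_divide_distrib)
    qed (rule zc)
  qed
  obtain Z where Z: "\<And>k. Z k \<in> carrier F"
    "\<And>k f. f \<in> dual K F \<Longrightarrow> cmod (\<psi> f - f (Z k)) \<le> (B + 1) / wt k * dnorm f"
    using approx by metis
  have wt_lim: "(\<lambda>k. c / wt k) \<longlonglongrightarrow> 0" for c :: real
  proof -
    have "(\<lambda>k. c * (1/2) ^ Suc k) \<longlonglongrightarrow> 0"
      by (intro tendsto_mult_right_zero LIMSEQ_Suc LIMSEQ_power_zero) auto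
    then show ?thesis by (simp add: wt_def power_divide)
  qed
  have Cauchy: "\<exists>M. \<forall>m\<ge>M. \<forall>n\<ge>M. nrm F (Z m \<ominus> Z n) < e" if e: "e > 0" for e
  proof -
    obtain M where M: "\<And>k. k \<ge> M \<Longrightarrow> (B + 1) / wt k < e / 2"
      using order_tendstoD(2)[OF wt_lim, of "e / 2" "B + 1"] e unfolding eventually_sequentially by auto
    have close: "nrm F (Z m \<ominus> Z n) \<le> (B + 1) / wt m + (B + 1) / wt n" for m n
    proof (rule nrm_leI)
      fix f assume f: "f \<in> dual K F" "\<And>y. y \<in> carrier F \<Longrightarrow> cmod (f y) \<le> nrm F y"
      have f1: "dnorm f \<le> 1" using f by (intro dnorm_le) auto
      have le: "cmod (\<psi> f - f (Z k)) \<le> (B + 1) / wt k" for k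
        using Z(2)[OF f(1), of k] mult_left_le[OF f1, of "(B + 1) / wt k"] B0 by (simp add: less_imp_le)
      have "cmod ((\<psi> f - f (Z n)) - (\<psi> f - f (Z m))) \<le> (B + 1) / wt n + (B + 1) / wt m"
        by (rule order.trans[OF norm_triangle_ineq4 add_mono[OF le le]])
      then show "cmod (f (Z m \<ominus> Z n)) \<le> (B + 1) / wt m + (B + 1) / wt n"
        using f(1) Z(1) by (simp add: dual_diff add.commute)
    qed (use Z(1) in auto)
    have "nrm F (Z m \<ominus> Z n) < e" if "m \<ge> M" "n \<ge> M" for m n
      using M[OF that(1)] M[OF that(2)] close[of m n] by linarith
    then show ?thesis by blast
  qed
  obtain z where z: "z \<in> carrier F" "(\<lambda>n. nrm F (Z n \<ominus> z)) \<longlonglongrightarrow> 0"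
    by (rule Cauchy_limit[OF Z(1) Cauchy])
  have \<psi>_eq: "\<psi> f = f z" if f: "f \<in> dual K F" for f
  proof -
    have "cmod (\<psi> f - f z) \<le> (B + 1) / wt k * dnorm f + dnorm f * nrm F (Z k \<ominus> z)" for k
    proof -
      have "cmod (f (Z k) - f z) \<le> dnorm f * nrm F (Z k \<ominus> z)"
        using dual_le_dnorm[OF f, of "Z k \<ominus> z"] f z(1) Z(1) by (simp add: dual_diff)
      then show ?thesis
        using Z(2)[OF f, of k] norm_triangle_ineq[of "\<psi> f - f (Z k)" "f (Z k) - f z"] by simp
    qed
    moreover have "(\<lambda>k. (B + 1) / wt k * dnorm f + dnorm f * nrm F (Z k \<ominus> z)) \<longlonglongrightarrow> 0 * dnorm f + dnorm f * 0"
      by (intro tendsto_intros wt_lim z(2))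
    ultimately have "cmod (\<psi> f - f z) \<le> 0 * dnorm f + dnorm f * 0"
      using LIMSEQ_le_const by blast
    then show ?thesis by simp
  qed
  have "z \<in> interp"
  proof (rule interpI(1)[OF z(1), where b = "2 * B"])
    fix m
    \<comment> \<open>The supremum need not be attained, but half of it is reached. If the gauge is
      0, any member of the polar will do.\<close>
    have "\<exists>f\<in>polar k. gauge k z / 2 \<le> cmod (f z)" for k
    proof (rule ccontr)
      assume no: "\<not> ?thesis"
      then have "gauge k z \<le> gauge k z / 2" by (intro gauge_least) force
      then have "gauge k z = 0" using gauge_nonneg[OF z(1), of k] by simp
      with no equicontinuous_polar[of k] show False by (auto simp: equicontinuous_def)
    qed
    then obtain f where f: "\<And>k. f k \<in> polar k" "\<And>k. gauge k z / 2 \<le> cmod (f k z)" by metis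
    have fd: "f k \<in> dual K F" for k using f(1)[of k] by (simp add: polar_def)
    define S where "S = (\<Sum>k<m. (cmod (f k z))\<^sup>2)"
    have S0: "S \<ge> 0" by (simp add: S_def sum_nonneg)
    \<comment> \<open>A test functional with \<open>h z = S\<close>. By Cauchy-Schwarz its norm on
      \<open>R\<close> is at most \<open>sqrt S\<close>, so \<open>S \<le> B * sqrt S\<close>; the
      factor 2 in \<open>2 * B\<close> comes from the halved gauges.\<close>
    define h where "h = (\<lambda>x\<in>carrier F. \<Sum>k<m. (\<lambda>x\<in>carrier F. cnj (f k z) * f k x) x)"
    have h: "h \<in> dual K F" unfolding h_def
    proof (rule dual_sumI)
      show "(\<lambda>x\<in>carrier F. cnj (f k z) * f k x) \<in> dual K F" for k
        by (rule dual_scaleI[OF fd]) (use fd z(1) in auto)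
    qed simp
    have hz: "h z = complex_of_real S"
      using z(1) by (simp add: h_def S_def complex_norm_square mult.commute del: of_real_power)
    have "cmod (h y) \<le> sqrt S * N y" if y: "y \<in> interp" for y
    proof -
      have yc: "y \<in> carrier F" using y by (rule interp_closed)
      have "cmod (h y) \<le> (\<Sum>k<m. \<bar>cmod (f k z)\<bar> * \<bar>gauge k y\<bar>)"
        using yc gauge_upper[OF yc f(1)] gauge_nonneg[OF yc]
        by (auto simp: h_def norm_mult intro!: sum_norm_le mult_left_mono)
      also have "\<dots> \<le> L2_set (\<lambda>k. cmod (f k z)) {..<m} * L2_set (\<lambda>k. gauge k y) {..<m}"
        by (rule L2_set_mult_ineq)
      also have "\<dots> \<le> sqrt S * l2_norm y"
      proof (intro mult_mono)
        show "L2_set (\<lambda>k. gauge k y) {..<m} \<le> l2_norm y"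
          unfolding L2_set_def using sum_gauge_le[OF y] l2_norm_nonneg[OF y]
          by (intro real_le_lsqrt) auto
      qed (auto simp: S_def L2_set_def sum_nonneg)
      also have "\<dots> \<le> sqrt S * N y" using l2_norm_le_N S0 by (simp add: mult_left_mono)
      finally show ?thesis .
    qed
    then have "cmod (\<psi> h) \<le> B * sqrt S" using S0 by (intro \<psi>_le[OF h]) auto
    then have SB: "sqrt S * sqrt S \<le> B * sqrt S" using \<psi>_eq[OF h] hz S0 by simp
    have "sqrt S \<le> B"
    proof (cases "S = 0")
      case False
      with S0 have "sqrt S > 0" by simp
      with SB show ?thesis by (rule mult_right_le_imp_le)
    qed (use B0 in simp)
    then have "S \<le> B\<^sup>2" using S0 by (simp add: sqrt_le_D)
    have "(gauge k z)\<^sup>2 \<le> 4 * (cmod (f k z))\<^sup>2" for k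
      using power_mono[OF f(2)[of k], of 2] gauge_nonneg[OF z(1), of k] by (simp add: power_divide)
    then have "(\<Sum>k<m. (gauge k z)\<^sup>2) \<le> 4 * S" unfolding S_def sum_distrib_left by (intro sum_mono)
    with \<open>S \<le> B\<^sup>2\<close> show "(\<Sum>k<m. (gauge k z)\<^sup>2) \<le> (2 * B)\<^sup>2" by (simp add: power_mult_distrib)
  qed (use B0 in simp)
  \<comment> \<open>Replacing \<open>g\<close> by a restriction within \<open>e\<close> changes
    \<open>\<phi>\<close> by at most \<open>B * e\<close> and the evaluation at \<open>z\<close> by
    at most \<open>e * N z\<close>.\<close>
  have "\<phi> g = g z" if g: "g \<in> dual K R" for g
  proof -
    have "cmod (\<phi> g - g z) \<le> 0 + r" if r: "r > 0" for r
    proof -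
      define e where "e = r / (B + N z + 1)"
      have Nz: "N z \<ge> 0" using R.nrm_nonneg[of z] \<open>z \<in> interp\<close> by simp
      have e: "e > 0" using r B0 Nz by (simp add: e_def)
      obtain f where f: "f \<in> dual K F" "\<forall>y\<in>interp. cmod (f y - g y) \<le> e * N y"
        by (rule dense_restrictions[OF g e])
      let ?d = "restrict f interp \<ominus>\<^bsub>dual_space K R\<^esub> g"
      have d: "?d \<in> dual K R" using restrict_dual[OF f(1)] g by (rule D.diff_closed)
      have "?d y = f y - g y" if "y \<in> interp" for y
        using that D.diff_eq_smult[OF restrict_dual[OF f(1)] g] by simp
      then have "R.dnorm ?d \<le> e" using f(2) e by (intro R.dnorm_le[OF d]) auto
      then have "cmod (\<phi> ?d) \<le> B * e" by (rule \<phi>_le[OF d])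
      moreover have "\<phi> ?d = f z - \<phi> g"
        using D.dual_diff[OF \<phi> restrict_dual[OF f(1)] g] \<psi>_eq[OF f(1)] by (simp add: \<psi>_def)
      moreover have "cmod (f z - g z) \<le> e * N z" using f(2) \<open>z \<in> interp\<close> by blast
      ultimately have "cmod (\<phi> g - g z) \<le> B * e + e * N z"
        using norm_triangle_ineq4[of "f z - g z" "f z - \<phi> g"] by simp
      also have "\<dots> \<le> (B + N z + 1) * e" using e by (simp add: algebra_simps)
      also have "\<dots> = r" using B0 Nz by (simp add: e_def)
      finally show ?thesis by simp
    qed
    then have "cmod (\<phi> g - g z) \<le> 0" by (rule field_le_epsilon)
    then show ?thesis by simp
  qed
  with \<open>z \<in> interp\<close> show "\<exists>x\<in>carrier R. \<forall>f\<in>dual K R. \<phi> f = f x" by auto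
qed

end

section \<open>Adding a one-dimensional summand\<close>

text \<open>
  The \<open>\<ell>\<^sub>\<infinity>\<close>-sum of the scalar field and \<open>R\<close>, transported along an injection
  \<open>j\<close> of its elements into another type.
\<close>

definition scalar_sum ::
    "complex set \<Rightarrow> 'a normed_module \<Rightarrow> (complex \<times> 'a \<Rightarrow> 'e) \<Rightarrow> 'e normed_module" where
  "scalar_sum K R j = (let h = inv_into (K \<times> carrier R) j in
     \<lparr>carrier = j ` (K \<times> carrier R), mult = undefined, one = undefined,
      zero = j (0, \<zero>\<^bsub>R\<^esub>),
      add = (\<lambda>x y. j (fst (h x) + fst (h y), snd (h x) \<oplus>\<^bsub>R\<^esub> snd (h y))),
      smult = (\<lambda>a x. j (a * fst (h x), a \<odot>\<^bsub>R\<^esub> snd (h x))),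
      nrm = (\<lambda>x. max (cmod (fst (h x))) (nrm R (snd (h x))))\<rparr>)"

text \<open>Injectivity is asked on the carrier only, because the whole type \<open>'a\<close> may
  be larger than \<open>'e\<close>.\<close>

locale scalar_sum_space = R: banach_space K R
  for K and R :: "'a normed_module" +
  fixes j :: "complex \<times> 'a \<Rightarrow> 'e"
  assumes inj: "inj_on j (K \<times> carrier R)"
begin

definition E :: "'e normed_module" where "E = scalar_sum K R j"

definition coord :: "'e \<Rightarrow> complex" where "coord x = fst (inv_into (K \<times> carrier R) j x)"

definition proj :: "'e \<Rightarrow> 'a" where "proj x = snd (inv_into (K \<times> carrier R) j x)"

lemma coord_j [simp]: "a \<in> K \<Longrightarrow> y \<in> carrier R \<Longrightarrow> coord (j (a, y)) = a"
  and proj_j [simp]: "a \<in> K \<Longrightarrow> y \<in> carrier R \<Longrightarrow> proj (j (a, y)) = y"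
  using inv_into_f_f[OF inj] by (simp_all add: coord_def proj_def)

lemma E_simps:
  "carrier E = j ` (K \<times> carrier R)" "\<zero>\<^bsub>E\<^esub> = j (0, \<zero>\<^bsub>R\<^esub>)"
  "x \<oplus>\<^bsub>E\<^esub> y = j (coord x + coord y, proj x \<oplus>\<^bsub>R\<^esub> proj y)"
  "a \<odot>\<^bsub>E\<^esub> x = j (a * coord x, a \<odot>\<^bsub>R\<^esub> proj x)"
  "nrm E x = max (cmod (coord x)) (nrm R (proj x))"
  by (simp_all add: E_def scalar_sum_def Let_def coord_def proj_def)

lemma j_closed: "a \<in> K \<Longrightarrow> y \<in> carrier R \<Longrightarrow> j (a, y) \<in> carrier E"
  by (simp add: E_simps)

lemma E_cases:
  assumes "x \<in> carrier E" obtains a y where "a \<in> K" "y \<in> carrier R" "x = j (a, y)"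
  using assms by (auto simp: E_simps)

lemma coord_in_K [simp]: "x \<in> carrier E \<Longrightarrow> coord x \<in> K"
  and proj_closed [simp]: "x \<in> carrier E \<Longrightarrow> proj x \<in> carrier R"
  and j_coord_proj: "x \<in> carrier E \<Longrightarrow> j (coord x, proj x) = x"
  by (auto elim: E_cases)

lemma E_eqI: "x \<in> carrier E \<Longrightarrow> y \<in> carrier E \<Longrightarrow> coord x = coord y \<Longrightarrow> proj x = proj y \<Longrightarrow> x = y"
  using j_coord_proj by metis

lemma add_E: "x \<in> carrier E \<Longrightarrow> y \<in> carrier E \<Longrightarrow> x \<oplus>\<^bsub>E\<^esub> y \<in> carrier E"
    "x \<in> carrier E \<Longrightarrow> y \<in> carrier E \<Longrightarrow> coord (x \<oplus>\<^bsub>E\<^esub> y) = coord x + coord y"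
    "x \<in> carrier E \<Longrightarrow> y \<in> carrier E \<Longrightarrow> proj (x \<oplus>\<^bsub>E\<^esub> y) = proj x \<oplus>\<^bsub>R\<^esub> proj y"
  and smult_E: "a \<in> K \<Longrightarrow> x \<in> carrier E \<Longrightarrow> a \<odot>\<^bsub>E\<^esub> x \<in> carrier E"
    "a \<in> K \<Longrightarrow> x \<in> carrier E \<Longrightarrow> coord (a \<odot>\<^bsub>E\<^esub> x) = a * coord x"
    "a \<in> K \<Longrightarrow> x \<in> carrier E \<Longrightarrow> proj (a \<odot>\<^bsub>E\<^esub> x) = a \<odot>\<^bsub>R\<^esub> proj x"
  and zero_E: "\<zero>\<^bsub>E\<^esub> \<in> carrier E" "coord \<zero>\<^bsub>E\<^esub> = 0" "proj \<zero>\<^bsub>E\<^esub> = \<zero>\<^bsub>R\<^esub>"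
  by (simp_all add: E_simps(2-4) j_closed)

lemma normed_space_E: "normed_space K E"
proof (rule normed_spaceI[OF R.normed_space_axioms], goal_cases)
  case 1
  show ?case
  proof (rule abelian_groupI, goal_cases)
    case (3 x y z)
    then show ?case by (intro E_eqI) (auto simp: add_E add.assoc R.M.a_assoc)
  next
    case (4 x y)
    then show ?case by (intro E_eqI) (auto simp: add_E add.commute R.M.a_comm)
  next
    case (5 x)
    then show ?case by (intro E_eqI) (auto simp: add_E zero_E)
  next
    case (6 x)
    have "(-1) \<odot>\<^bsub>E\<^esub> x \<oplus>\<^bsub>E\<^esub> x = \<zero>\<^bsub>E\<^esub>"
      using 6 R.smult_add_left[of "-1" 1 "proj x"] by (intro E_eqI) (auto simp: add_E smult_E zero_E)
    then show ?case using smult_E(1)[of "-1" x] 6 by auto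
  qed (auto simp: add_E zero_E)
next
  case (3 a b x)
  then show ?case by (intro E_eqI) (auto simp: add_E smult_E distrib_right R.smult_add_left)
next
  case (4 a x y)
  then show ?case by (intro E_eqI) (auto simp: add_E smult_E distrib_left R.smult_add_right)
next
  case (5 a b x)
  then show ?case by (intro E_eqI) (auto simp: add_E smult_E R.smult_smult)
next
  case (6 x)
  then show ?case by (intro E_eqI) (auto simp: smult_E)
next
  case (7 x)
  then have "cmod (coord x) \<le> 0" "nrm R (proj x) \<le> 0" by (auto simp: E_simps(5))
  then show ?case using 7 R.nrm_nonneg[of "proj x"] R.nrm_eq_0[of "proj x"]
    by (intro E_eqI) (auto simp: zero_E)
next
  case (8 a x)
  then show ?case by (simp add: E_simps(5) smult_E norm_mult R.nrm_smult max_mult_distrib_left)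
next
  case (9 x y)
  then show ?case
    using R.nrm_triangle[of "proj x" "proj y"] norm_triangle_ineq[of "coord x" "coord y"]
    by (auto simp: E_simps(5) add_E)
qed (auto simp: smult_E)

interpretation E: normed_space K E by (rule normed_space_E)

lemma coord_diff: "x \<in> carrier E \<Longrightarrow> y \<in> carrier E \<Longrightarrow> coord (x \<ominus>\<^bsub>E\<^esub> y) = coord x - coord y"
  and proj_diff: "x \<in> carrier E \<Longrightarrow> y \<in> carrier E \<Longrightarrow> proj (x \<ominus>\<^bsub>E\<^esub> y) = proj x \<ominus>\<^bsub>R\<^esub> proj y"
  by (simp_all add: E.diff_eq_smult R.diff_eq_smult add_E smult_E)

lemma nrm_diff: "x \<in> carrier E \<Longrightarrow> y \<in> carrier E \<Longrightarrow>
    nrm E (x \<ominus>\<^bsub>E\<^esub> y) = max (cmod (coord x - coord y)) (nrm R (proj x \<ominus>\<^bsub>R\<^esub> proj y))"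
  by (simp add: E_simps(5) coord_diff proj_diff)

lemma banach_space_E: "banach_space K E"
proof (intro banach_space.intro banach_space_axioms.intro normed_space_E)
  show "Metric_space.mcomplete (carrier E) (ndist E)"
    unfolding E.mcomplete_iff
  proof (intro ballI impI)
    fix x :: "nat \<Rightarrow> 'e" assume x: "x \<in> UNIV \<rightarrow> carrier E"
      and C: "\<forall>e>0. \<exists>M. \<forall>m\<ge>M. \<forall>n\<ge>M. nrm E (x m \<ominus>\<^bsub>E\<^esub> x n) < e"
    have xc: "x n \<in> carrier E" for n using x by auto
    have C': "\<exists>M. \<forall>m\<ge>M. \<forall>n\<ge>M. cmod (coord (x m) - coord (x n)) < e \<and>
        nrm R (proj (x m) \<ominus>\<^bsub>R\<^esub> proj (x n)) < e" if "e > 0" for e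
      using C that by (simp add: nrm_diff xc)
    have "Cauchy (\<lambda>n. coord (x n))"
      unfolding Cauchy_def dist_norm using C' by meson
    then obtain a where a: "(\<lambda>n. coord (x n)) \<longlonglongrightarrow> a"
      using Cauchy_convergent_iff convergent_def by blast
    have aK: "a \<in> K"
      using Lim_in_closed_set[OF R.K_closed_set _ _ a] xc by simp
    obtain y where y: "y \<in> carrier R" "(\<lambda>n. nrm R (proj (x n) \<ominus>\<^bsub>R\<^esub> y)) \<longlonglongrightarrow> 0"
    proof (rule R.Cauchy_limit)
      show "\<exists>M. \<forall>m\<ge>M. \<forall>n\<ge>M. nrm R (proj (x m) \<ominus>\<^bsub>R\<^esub> proj (x n)) < e" if "e > 0" for e
        using C'[OF that] by blast
    qed (use xc in auto)
    have l: "j (a, y) \<in> carrier E" using aK y(1) by (rule j_closed)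
    have "(\<lambda>n. max (cmod (coord (x n) - a)) (nrm R (proj (x n) \<ominus>\<^bsub>R\<^esub> y))) \<longlonglongrightarrow> max 0 0"
      by (intro tendsto_max y(2) tendsto_norm_zero LIM_zero a)
    then show "\<exists>l\<in>carrier E. (\<lambda>n. nrm E (x n \<ominus>\<^bsub>E\<^esub> l)) \<longlonglongrightarrow> 0"
      using l aK y(1) by (intro bexI[of _ "j (a, y)"]) (auto simp: nrm_diff xc)
  qed
qed

text \<open>Every functional on the sum is a multiple of the coordinate functional \<open>c\<close>
  plus the lift of a functional on \<open>R\<close>. A bidual element is therefore evaluation at the
  pair of \<open>\<phi> c\<close> and the point \<open>y\<close> that represents it on
  lifts.\<close>

lemma reflexive_E:
  assumes refl: "reflexive_space K R" shows "reflexive_space K E"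
  unfolding E.reflexive_space_iff
proof
  fix \<phi> assume \<phi>: "\<phi> \<in> dual K (dual_space K E)"
  interpret DE: normed_space K "dual_space K E" by (rule E.normed_space_dual)
  interpret DR: normed_space K "dual_space K R" by (rule R.normed_space_dual)
  define lift where "lift g = (\<lambda>x\<in>carrier E. g (proj x))" for g :: "'a \<Rightarrow> complex"
  define c where "c = (\<lambda>x\<in>carrier E. coord x)"
  have c: "c \<in> dual K E" unfolding c_def
    by (rule E.dualI[where B = 1]) (auto simp: add_E smult_E E_simps(5))
  have le: "cmod (g (proj x)) \<le> R.dnorm g * nrm E x" if "g \<in> dual K R" "x \<in> carrier E" for g x
    using R.dual_le_dnorm[OF that(1), of "proj x"] that(2) R.dnorm_nonneg[OF that(1)]
      mult_left_mono[of "nrm R (proj x)" "nrm E x" "R.dnorm g"] by (simp add: E_simps(5))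
  have lift: "lift g \<in> dual K E" if g: "g \<in> dual K R" for g unfolding lift_def
    by (rule E.dualI[OF _ _ _ le[OF g]]) (use g in \<open>auto simp: add_E smult_E R.dual_add R.dual_smult\<close>)
  have lift_norm: "E.dnorm (lift g) \<le> R.dnorm g" if g: "g \<in> dual K R" for g
    using le[OF g] by (intro E.dnorm_le lift g R.dnorm_nonneg) (auto simp: lift_def)
  let ?\<phi>R = "\<lambda>g\<in>dual K R. \<phi> (lift g)"
  have "?\<phi>R \<in> dual K (dual_space K R)"
  proof (rule DR.dualI[where B = "DE.dnorm \<phi>"])
    fix g h assume gh: "g \<in> dual K R" "h \<in> dual K R"
    have "lift (g \<oplus>\<^bsub>dual_space K R\<^esub> h) = lift g \<oplus>\<^bsub>dual_space K E\<^esub> lift h"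
      by (auto simp: lift_def)
    with DE.dual_add[OF \<phi> lift[OF gh(1)] lift[OF gh(2)]]
    show "\<phi> (lift (g \<oplus>\<^bsub>dual_space K R\<^esub> h)) = \<phi> (lift g) + \<phi> (lift h)" by (simp only:)
  next
    fix a g assume ag: "a \<in> K" "g \<in> dual K R"
    have "lift (a \<odot>\<^bsub>dual_space K R\<^esub> g) = a \<odot>\<^bsub>dual_space K E\<^esub> lift g"
      by (auto simp: lift_def)
    with DE.dual_smult[OF \<phi> ag(1) lift[OF ag(2)]]
    show "\<phi> (lift (a \<odot>\<^bsub>dual_space K R\<^esub> g)) = a * \<phi> (lift g)" by (simp only:)
  next
    fix g assume g: "g \<in> dual K R"
    show "cmod (\<phi> (lift g)) \<le> DE.dnorm \<phi> * nrm (dual_space K R) g"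
      using DE.dual_le_dnorm[OF \<phi> lift[OF g]] mult_left_mono[OF lift_norm[OF g] DE.dnorm_nonneg[OF \<phi>]]
      by simp
  qed (use DE.dual_in_K[OF \<phi> lift] in auto)
  then obtain y where y: "y \<in> carrier R" "\<And>g. g \<in> dual K R \<Longrightarrow> \<phi> (lift g) = g y"
    using refl unfolding R.reflexive_space_iff by fastforce
  have \<phi>c: "\<phi> c \<in> K" using DE.dual_in_K[OF \<phi> c] .
  show "\<exists>x\<in>carrier E. \<forall>f\<in>dual K E. \<phi> f = f x"
  proof (intro bexI ballI)
    fix f assume f: "f \<in> dual K E"
    define g where "g = (\<lambda>y\<in>carrier R. f (j (0, y)))"
    have j_add: "j (0, x \<oplus>\<^bsub>R\<^esub> y) = j (0, x) \<oplus>\<^bsub>E\<^esub> j (0, y)"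
      and j_smult: "a \<in> K \<Longrightarrow> j (0, a \<odot>\<^bsub>R\<^esub> x) = a \<odot>\<^bsub>E\<^esub> j (0, x)"
      if "x \<in> carrier R" "y \<in> carrier R" for a x y
      using that by (auto simp: E_simps)
    have g: "g \<in> dual K R" unfolding g_def
    proof (rule R.dualI[where B = "E.dnorm f"])
      show "cmod (f (j (0, y))) \<le> E.dnorm f * nrm R y" if "y \<in> carrier R" for y
        using E.dual_le_dnorm[OF f j_closed[of 0 y]] that R.nrm_nonneg[OF that] by (simp add: E_simps(5))
    qed (use f in \<open>auto simp: j_add j_smult j_closed E.dual_add E.dual_smult\<close>)
    have one: "j (1, \<zero>\<^bsub>R\<^esub>) \<in> carrier E" by (rule j_closed) auto
    have f_j: "f (j (a, y)) = f (j (1, \<zero>\<^bsub>R\<^esub>)) * a + g y" if "a \<in> K" "y \<in> carrier R" for a y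
    proof -
      have "j (a, y) = a \<odot>\<^bsub>E\<^esub> j (1, \<zero>\<^bsub>R\<^esub>) \<oplus>\<^bsub>E\<^esub> j (0, y)"
        using that by (auto simp: E_simps)
      then have "f (j (a, y)) = a * f (j (1, \<zero>\<^bsub>R\<^esub>)) + f (j (0, y))"
        using that one by (simp add: E.dual_add[OF f] E.dual_smult[OF f] smult_E j_closed)
      then show ?thesis using that by (simp add: g_def mult.commute)
    qed
    have fK: "f (j (1, \<zero>\<^bsub>R\<^esub>)) \<in> K" using f one by blast
    have "f x = f (j (1, \<zero>\<^bsub>R\<^esub>)) * coord x + g (proj x)" if "x \<in> carrier E" for x
      using f_j[of "coord x" "proj x"] that by (simp add: j_coord_proj)
    then have "f = f (j (1, \<zero>\<^bsub>R\<^esub>)) \<odot>\<^bsub>dual_space K E\<^esub> c \<oplus>\<^bsub>dual_space K E\<^esub> lift g"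
      by (intro E.dual_eqI[OF f DE.add_closed[OF DE.smult_in_carrier[OF fK c] lift[OF g]]])
        (simp add: c_def lift_def)
    then have "\<phi> f = \<phi> (f (j (1, \<zero>\<^bsub>R\<^esub>)) \<odot>\<^bsub>dual_space K E\<^esub> c \<oplus>\<^bsub>dual_space K E\<^esub> lift g)"
      by (rule arg_cong)
    also have "\<dots> = \<phi> (f (j (1, \<zero>\<^bsub>R\<^esub>)) \<odot>\<^bsub>dual_space K E\<^esub> c) + \<phi> (lift g)"
      by (rule DE.dual_add[OF \<phi> DE.smult_in_carrier[OF fK c] lift[OF g]])
    also have "\<phi> (f (j (1, \<zero>\<^bsub>R\<^esub>)) \<odot>\<^bsub>dual_space K E\<^esub> c) = f (j (1, \<zero>\<^bsub>R\<^esub>)) * \<phi> c"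
      by (rule DE.dual_smult[OF \<phi> fK c])
    finally show "\<phi> f = f (j (\<phi> c, y))" using f_j[OF \<phi>c y(1)] y(2)[OF g] by simp
  qed (rule j_closed[OF \<phi>c y(1)])
qed

end

section \<open>A non-attaining operator on a reflexive space\<close>

text \<open>Each real number is coded by a set of naturals, so a complex sequence becomes one subset
  of the countable type of triples: position, real or imaginary part, element of the code.\<close>

lemma ex_inj_complex_sequences: "\<exists>i :: (nat \<Rightarrow> complex) \<Rightarrow> real. inj i"
proof -
  obtain r :: "nat set \<Rightarrow> real" and B :: "real \<Rightarrow> nat set" where "inj r" "inj B"
    using nat_sets_eqpoll_reals eqpoll_sym[OF nat_sets_eqpoll_reals] unfolding eqpoll_def bij_betw_def
    by blast
  define S where "S s = {(n, b, m). m \<in> B (if b then Re (s n) else Im (s n))}" for s :: "nat \<Rightarrow> complex"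
  have "inj S"
  proof (rule injI)
    fix s s' assume "S s = S s'"
    then have "(n, b, m) \<in> S s \<longleftrightarrow> (n, b, m) \<in> S s'" for n b m by simp
    then have "B (if b then Re (s n) else Im (s n)) = B (if b then Re (s' n) else Im (s' n))" for n b
      unfolding S_def by blast
    then have "(if b then Re (s n) else Im (s n)) = (if b then Re (s' n) else Im (s' n))" for n b
      using injD[OF \<open>inj B\<close>] by blast
    from this[of True] this[of False] show "s = s'" by (auto simp: complex_eq_iff)
  qed
  then have "inj (\<lambda>s. to_nat ` S s)"
    by (simp add: inj_def inj_image_eq_iff)
  from inj_compose[OF \<open>inj r\<close> this] show ?thesis by blast
qed

context weakly_null_sequence
begin

text \<open>A point of the interpolation space is determined by its values under the separating
  functionals, so the whole space injects into the continuum.\<close>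

lemma ex_injection:
  assumes "at_least_continuum TYPE('e)"
  shows "\<exists>j :: complex \<times> 'a \<Rightarrow> 'e. inj_on j (K \<times> interp)"
proof -
  define i1 where "i1 p = (\<lambda>n. case n of 0 \<Rightarrow> fst p | Suc m \<Rightarrow> t m (snd p))" for p :: "complex \<times> 'a"
  have i1: "inj_on i1 (K \<times> interp)"
  proof (rule inj_onI)
    fix p q assume pq: "p \<in> K \<times> interp" "q \<in> K \<times> interp" "i1 p = i1 q"
    have "fst p = fst q" using fun_cong[OF pq(3), of 0] by (simp add: i1_def)
    moreover have "t m (snd p) = t m (snd q)" for m using fun_cong[OF pq(3), of "Suc m"] by (simp add: i1_def)
    then have "t m (snd p \<ominus> snd q) = 0" for m
      using pq interp_closed by (auto simp: dual_diff[OF t_dual])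
    then have "snd p \<ominus> snd q = \<zero>"
      using pq by (intro t_separates interp_in_closed_span interp_diff) auto
    then have "snd p = snd q" using pq interp_closed diff_eq_zero_iff by auto
    ultimately show "p = q" by (rule prod_eqI)
  qed
  obtain i2 :: "(nat \<Rightarrow> complex) \<Rightarrow> real" where i2: "inj i2"
    using ex_inj_complex_sequences by blast
  obtain i3 :: "real \<Rightarrow> 'e" where "inj i3" using assms unfolding at_least_continuum_def by blast
  then have "inj_on (i3 \<circ> i2 \<circ> i1) (K \<times> interp)"
    using i2 by (intro comp_inj_on i1) (auto intro: inj_on_subset)
  then show ?thesis by blast
qed

lemma not_weak_maximizing:
  assumes "at_least_continuum TYPE('e)"
  shows "\<exists>E :: 'e normed_module. banach_space K E \<and> reflexive_space K E \<and>
    \<not> weak_maximizing_property K E F"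
proof -
  obtain j :: "complex \<times> 'a \<Rightarrow> 'e" where j: "inj_on j (K \<times> interp)"
    using ex_injection[OF assms] by blast
  interpret S: scalar_sum_space K R j
    using banach_space_R j by (intro scalar_sum_space.intro scalar_sum_space_axioms.intro) simp_all
  interpret E: normed_space K S.E by (rule S.normed_space_E)
  interpret P: normed_pair K S.E F by (rule normed_pair.intro) (rule S.normed_space_E normed_space_axioms)+
  have proj: "S.proj x \<in> interp" if "x \<in> carrier S.E" for x using S.proj_closed[OF that] by simp
  have le: "nrm F (S.proj x) \<le> nrm S.E x" if "x \<in> carrier S.E" for x
    using nrm_le_N[OF proj[OF that]] by (simp add: S.E_simps(5))
  have T: "bounded_operator K S.E F S.proj"
    by (rule P.bounded_operatorI[where B = 1]) (use le proj in \<open>auto simp: interp_closed S.add_E S.smult_E\<close>)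
  have N_pos: "N (u n) > 0" for n
    using nrm_le_N[OF u_in_interp, of n] by (simp add: nrm_u)
  define v where "v n = complex_of_real (1 / N (u n)) \<odot> u n" for n
  \<comment> \<open>Since \<open>N (v n) = 1\<close>, the constant coordinate 1 keeps
    \<open>x n\<close> on the unit sphere, while the coordinate functional prevents weak convergence
    to 0.\<close>
  define x where "x n = j (1, v n)" for n
  have v: "v n \<in> interp" for n unfolding v_def by (rule interp_smult(1)[OF _ u_in_interp]) auto
  have "N (v n) = 1" for n
    using normed_space.nrm_smult[OF normed_space_R, of "complex_of_real (1 / N (u n))" "u n"] N_pos[of n] u_in_interp
    by (simp add: v_def norm_divide)
  then have sphere: "x n \<in> unit_sphere S.E" for n
    using v by (simp add: unit_sphere_def x_def S.j_closed S.E_simps(5))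
  have coord_x: "S.coord (x n) = 1" and proj_x: "S.proj (x n) = v n" for n
    using v by (simp_all add: x_def)
  have "nrm F (v n) = 1 / N (u n)" for n
    using N_pos[of n] nrm_smult[of "complex_of_real (1 / N (u n))" "u n"] u_closed
    by (simp add: v_def nrm_u norm_divide)
  then have lim: "(\<lambda>n. nrm F (S.proj (x n))) \<longlonglongrightarrow> 1"
    using tendsto_divide[OF tendsto_const N_u, of 1] by (simp add: proj_x)
  have norm_T: "operator_norm S.E F S.proj = 1"
  proof (rule antisym)
    show "operator_norm S.E F S.proj \<le> 1"
      by (rule P.operator_norm_le[OF T]) (use le in auto)
    have "nrm F (S.proj (x n)) \<le> operator_norm S.E F S.proj" for n
      using sphere[of n] by (intro P.op_le_operator_norm1[OF T]) (auto simp: unit_sphere_def)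
    then show "1 \<le> operator_norm S.E F S.proj" using LIMSEQ_le_const2[OF lim] by blast
  qed
  have "\<not> weakly_tendsto K S.E x \<zero>\<^bsub>S.E\<^esub>"
  proof
    assume w: "weakly_tendsto K S.E x \<zero>\<^bsub>S.E\<^esub>"
    have "(\<lambda>x\<in>carrier S.E. S.coord x) \<in> dual K S.E"
      by (rule E.dualI[where B = 1]) (auto simp: S.add_E S.smult_E S.E_simps(5))
    with w have "(\<lambda>n. (\<lambda>x\<in>carrier S.E. S.coord x) (x n)) \<longlonglongrightarrow> (\<lambda>x\<in>carrier S.E. S.coord x) \<zero>\<^bsub>S.E\<^esub>"
      unfolding weakly_tendsto_def by blast
    then have "(\<lambda>n. 1 :: complex) \<longlonglongrightarrow> 0"
      using sphere by (simp add: unit_sphere_def coord_x S.zero_E)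
    then show False using LIMSEQ_unique[OF tendsto_const] by fastforce
  qed
  moreover have "maximizing_sequence S.E F S.proj x"
    using sphere lim by (simp add: maximizing_sequence_def norm_T)
  moreover have "\<not> attains_norm S.E F S.proj"
  proof
    assume "attains_norm S.E F S.proj"
    then obtain y where y: "y \<in> carrier S.E" "nrm S.E y = 1" "nrm F (S.proj y) = 1"
      by (auto simp: attains_norm_def unit_sphere_def norm_T)
    \<comment> \<open>Attainment would give
      \<open>1 = nrm F (S.proj y) < N (S.proj y) \<le> nrm S.E y = 1\<close>.\<close>
    then have "S.proj y \<noteq> \<zero>" by auto
    then have "1 < N (S.proj y)" using nrm_less_N[OF proj[OF y(1)]] y(3) by simp
    then show False using y(2) by (simp add: S.E_simps(5))
  qed
  ultimately have "\<not> weak_maximizing_property K S.E F"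
    using T unfolding weak_maximizing_property_def by blast
  with S.banach_space_E S.reflexive_E[OF reflexive_R] show ?thesis by blast
qed

end

text \<open>A weakly convergent sequence without norm limit has a subsequence at distance at least
  \<open>d > 0\<close> from its weak limit. The differences are weakly null, and normalizing them
  multiplies by scalars of modulus at most \<open>1 / d\<close>, which preserves this.\<close>

lemma (in banach_space) weakly_null_unit_sequence:
  assumes "\<not> Schur_property K E"
  obtains u where "\<forall>n. u n \<in> carrier E" "\<forall>n. nrm E (u n) = 1" "\<forall>f\<in>dual K E. (\<lambda>n. f (u n)) \<longlonglongrightarrow> 0"
proof -
  obtain x l where x: "x \<in> UNIV \<rightarrow> carrier E" "l \<in> carrier E" "weakly_tendsto K E x l"
    and not: "\<not> (\<exists>l\<in>carrier E. (\<lambda>n. nrm E (x n \<ominus> l)) \<longlonglongrightarrow> 0)"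
    using assms unfolding Schur_property_def by blast
  have xc: "x n \<in> carrier E" for n using x(1) by auto
  have "\<not> (\<lambda>n. nrm E (x n \<ominus> l)) \<longlonglongrightarrow> 0" using not x(2) by blast
  then obtain d where d: "d > 0" "\<And>M. \<exists>n\<ge>M. d \<le> nrm E (x n \<ominus> l)"
    unfolding lim_sequentially using nrm_nonneg[OF diff_closed[OF xc x(2)]]
    by (auto simp: not_less)
  then have "infinite {n. d \<le> nrm E (x n \<ominus> l)}"
    unfolding infinite_nat_iff_unbounded_le by auto
  from infinite_enumerate[OF this] obtain r :: "nat \<Rightarrow> nat"
    where r: "strict_mono r" "\<forall>n. d \<le> nrm E (x (r n) \<ominus> l)" by auto
  define y where "y n = x (r n) \<ominus> l" for n
  define a where "a n = complex_of_real (1 / nrm E (y n))" for n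
  have y: "y n \<in> carrier E" "d \<le> nrm E (y n)" for n using r(2) xc x(2) by (auto simp: y_def)
  have a: "a n \<in> K" "cmod (a n) = 1 / nrm E (y n)" for n
    using nrm_nonneg[OF y(1)] unfolding a_def by (auto simp: norm_divide)
  show ?thesis
  proof (rule that)
    show "\<forall>n. a n \<odot> y n \<in> carrier E" using a y by simp
    show "\<forall>n. nrm E (a n \<odot> y n) = 1"
    proof
      fix n show "nrm E (a n \<odot> y n) = 1" using a y[of n] d(1) by (simp add: nrm_smult)
    qed
    show "\<forall>f\<in>dual K E. (\<lambda>n. f (a n \<odot> y n)) \<longlonglongrightarrow> 0"
    proof
      fix f assume f: "f \<in> dual K E"
      have "(\<lambda>n. f (x n)) \<longlonglongrightarrow> f l" using x(3) f unfolding weakly_tendsto_def by blast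
      then have "(\<lambda>n. f (x (r n)) - f l) \<longlonglongrightarrow> 0"
        using LIMSEQ_subseq_LIMSEQ[OF _ r(1)] by (fastforce simp: o_def intro: LIM_zero)
      then have lim: "(\<lambda>n. 1 / d * norm (f (y n))) \<longlonglongrightarrow> 0"
        using f xc x(2) by (intro tendsto_mult_right_zero tendsto_norm_zero) (simp add: y_def dual_diff)
      have "norm (f (a n \<odot> y n)) \<le> 1 / d * norm (f (y n))" for n
        using f a y[of n] d(1) by (auto simp: dual_smult norm_mult intro!: divide_left_mono)
      then show "(\<lambda>n. f (a n \<odot> y n)) \<longlonglongrightarrow> 0"
        by (intro Lim_null_comparison[OF _ lim]) simp
    qed
  qed
qed

theorem theorem2p7:
  fixes K :: "complex set" and F :: "'f normed_module"
  assumes "banach_space K F"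
    and "at_least_continuum TYPE('e)"
  shows "(\<forall>E :: 'e normed_module. banach_space K E \<and> reflexive_space K E \<longrightarrow>
            weak_maximizing_property K E F)
         \<longleftrightarrow> Schur_property K F"
proof
  interpret F: banach_space K F by (rule assms(1))
  assume wmp: "\<forall>E :: 'e normed_module. banach_space K E \<and> reflexive_space K E \<longrightarrow>
    weak_maximizing_property K E F"
  show "Schur_property K F"
  proof (rule ccontr)
    assume "\<not> Schur_property K F"
    then obtain u where u: "\<forall>n. u n \<in> carrier F" "\<forall>n. nrm F (u n) = 1"
      "\<forall>f\<in>dual K F. (\<lambda>n. f (u n)) \<longlonglongrightarrow> 0"
      by (rule F.weakly_null_unit_sequence)
    obtain t :: "nat \<Rightarrow> 'f \<Rightarrow> complex" where t: "\<forall>m. t m \<in> dual K F"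
      "\<forall>m. \<forall>y\<in>carrier F. cmod (t m y) \<le> nrm F y"
      "\<forall>y\<in>F.closed_span u. (\<forall>m. t m y = 0) \<longrightarrow> y = \<zero>\<^bsub>F\<^esub>"
      using F.separating_functionals[of u] u(1) by blast
    interpret weakly_null_sequence K F u t
      by unfold_locales (use u t in auto)
    from not_weak_maximizing[OF assms(2)] wmp show False by blast
  qed
next
  assume Schur: "Schur_property K F"
  have F: "normed_space K F" using assms(1) by (rule banach_space.axioms)
  show "\<forall>E :: 'e normed_module. banach_space K E \<and> reflexive_space K E \<longrightarrow>
    weak_maximizing_property K E F"
  proof (intro allI impI)
    fix E :: "'e normed_module" assume E: "banach_space K E \<and> reflexive_space K E"
    interpret normed_pair K E F
      using E F by (intro normed_pair.intro) (auto dest: banach_space.axioms)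
    show "weak_maximizing_property K E F"
      unfolding weak_maximizing_property_def using Schur_imp_attains_norm E Schur by blast
  qed
qed

end
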